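(* Let $p>3$ be a prime and let $\Gamma\subseteq\mathbb{F}_p^*$ be a multiplicative subgroup with $-1\in\Gamma$. Let $A\subseteq\mathbb{F}_p$ and define $\psi$ by $\mathrm{sf}(A)=|A|/3+\psi$. Then for every $\varepsilon>0$, $$\sum_{\xi\in\mathbb{F}_p^*/\Gamma}\left|\,|A\cap\xi\Gamma|-\frac{|A||\Gamma|}{p-1}\right|^2\ll_\varepsilon \psi^2 p^{1+\varepsilon},$$ where the sum runs over the cosets $\xi\Gamma$ of $\Gamma$ in $\mathbb{F}_p^*$.
   Context: For $A\subseteq\mathbb{F}_p$, $\mathrm{sf}(A)$ denotes the maximal cardinality of a sum-free subset of $A$, i.e. of a subset $S\subseteq A$ with no solutions to $x+y=z$ with $x,y,z\in S$. The notation $X\ll_\varepsilon Y$ means $X\le C_\varepsilon Y$ for a constant $C_\varepsilon>0$ depending only on $\varepsilon$.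
   Formalization: The case 0 ∈ A with ψ = 0 is excluded: there the right side is 0 while the left side is always positive (e.g. p = 11, Γ = {1,−1}, A = {0,1,2}), so the claim as stated fails. *)

theory Defs
  imports Complex_Main "HOL-Number_Theory.Residues" "HOL-Algebra.Left_Coset"
begin

(* x, y, z need not be distinct; in particular no sum-free set contains 0. *)
definition sum_free :: "('a, 'b) ring_scheme \<Rightarrow> 'a set \<Rightarrow> bool" where
  "sum_free R S \<longleftrightarrow> \<not> (\<exists>x\<in>S. \<exists>y\<in>S. \<exists>z\<in>S. x \<oplus>\<^bsub>R\<^esub> y = z)"

(* Meaningful for finite A only. *)
definition sf :: "('a, 'b) ring_scheme \<Rightarrow> 'a set \<Rightarrow> nat" where
  "sf R A = Max (card ` {S. S \<subseteq> A \<and> sum_free R S})"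

abbreviation Fp :: "nat \<Rightarrow> int ring" where
  "Fp p \<equiv> residue_ring (int p)"

abbreviation Fp_star :: "nat \<Rightarrow> int monoid" where
  "Fp_star p \<equiv> units_of (Fp p)"

end

(* For u in F_p^* the points of A that a dilation by u moves into the middle third M = (p/3, 2p/3) form a
   sum-free set, so there are at most |A|/3 + psi of them; on average over u there are at least |A|/3. Hence the
   deviation from |A|/3 has L^1-norm at most 2 psi (p-1), and expanding it in multiplicative characters gives
   |A^(chi)| |M^(chi)| <= 2 psi (p-1) for nonprincipal chi. For even chi the Fourier series of the indicator of M
   yields |M^(chi)| = (sqrt 3 / pi) sqrt p |L(1, conj(chi) chi_3)|, chi_3 being the nonprincipal character modulo 3.
   This L-value is >> p^(-eps): for complex chi by positivity of zeta^3 |L(psi)|^4 |L(psi^2)|^2 near s = 1, for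
   quadratic chi by Siegel's theorem (in Estermann's version), whence the ineffective constant. Finally, by Parseval,
   the variance of A over the cosets of Gamma is at most the maximum of |A^(chi)|^2 over the nonprincipal chi trivial
   on Gamma, and these are even because -1 is in Gamma. *)

theory Submission
  imports Defs "HOL-Complex_Analysis.Complex_Analysis" "HOL-Number_Theory.Number_Theory"
begin

section \<open>Dirichlet convolution\<close>


text \<open>The twist by chi_3 comes from the Fourier coefficients of the middle third: they contain
  sin(2 pi n / 3), a multiple of chi_3(n). The bound on |M^(chi)| turns |A^(chi)| |M^(chi)| << psi p
  into |A^(chi)| << psi p^((1+eps)/2), and squaring gives the exponent 1 + eps. So the lower bound
  for the L-value is the only deep input, and since it may lose p^eps, logarithms are traded for
  small powers throughout. The analytic side uses neither Euler products nor a functional equation: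
  bounded partial sums give L on Re s > 0, zeta comes from the alternating series, and nonnegative
  Dirichlet coefficients are exploited through Taylor expansion at 2. Two cases are forced: the
  product zeta^3 |L(psi)|^4 |L(psi^2)|^2 helps because a zero of order 4 would outweigh a pole of
  order 3, but if psi^2 is principal then L(psi^2) contributes poles of its own and Siegel's theorem
  has to take over. The element 0 needs separate care: it lies in no sum-free set and in no coset,
  yet it counts in |A|, so deleting it raises psi by 1/3.\<close>

definition npow :: "nat \<Rightarrow> complex \<Rightarrow> complex" where
  "npow n s = exp (- (s * of_real (ln (real n))))"

definition factor_pairs :: "nat \<Rightarrow> (nat \<times> nat) set" where
  "factor_pairs n = {(d, e). d * e = n}"

definition dconv :: "(nat \<Rightarrow> complex) \<Rightarrow> (nat \<Rightarrow> complex) \<Rightarrow> nat \<Rightarrow> complex" where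
  "dconv f g n = (\<Sum>(d, e)\<in>factor_pairs n. f d * g e)"

definition conv_prod :: "(nat \<Rightarrow> complex) list \<Rightarrow> nat \<Rightarrow> complex" where
  "conv_prod fs = foldr dconv fs (\<lambda>n. if n = 1 then 1 else 0)"

definition compl_mult :: "(nat \<Rightarrow> complex) \<Rightarrow> bool" where
  "compl_mult f \<longleftrightarrow> f 1 = 1 \<and> (\<forall>m n. f (m * n) = f m * f n)"

lemma conv_prod_Nil: "conv_prod [] = (\<lambda>n. if n = 1 then 1 else 0)"
  and conv_prod_Cons: "conv_prod (f # fs) = dconv f (conv_prod fs)"
  by (simp_all add: conv_prod_def)

lemma finite_factor_pairs [simp]:
  assumes "n > 0" shows "finite (factor_pairs n)"
proof (rule finite_subset)
  show "factor_pairs n \<subseteq> {..n} \<times> {..n}"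
    using assms by (auto simp: factor_pairs_def)
qed auto

text \<open>All pairs (0, e) have product 0. A sum over an infinite set is 0 by default, so
  \<open>dconv f g 0 = 0\<close>, and laws such as associativity hold as equations between functions
  on all of nat.\<close>

lemma infinite_factor_pairs_0: "infinite (factor_pairs 0)"
proof
  assume "finite (factor_pairs 0)"
  moreover have "range (\<lambda>n. (0, n)) \<subseteq> factor_pairs 0" by (auto simp: factor_pairs_def)
  ultimately have "finite (range (\<lambda>n::nat. (0::nat, n)))" by (rule finite_subset[rotated])
  moreover have "inj (\<lambda>n::nat. (0::nat, n))" by (auto simp: inj_def)
  ultimately show False using finite_imageD by blast
qed

lemma dconv_0 [simp]: "dconv f g 0 = 0"
  by (simp add: dconv_def infinite_factor_pairs_0)

lemma factor_pairs_1: "factor_pairs (Suc 0) = {(1, 1)}"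
  by (auto simp: factor_pairs_def)

lemma dconv_1: "dconv f g 1 = f 1 * g 1"
  by (simp add: dconv_def factor_pairs_1)

lemma dconv_commute: "dconv f g = dconv g f"
proof
  fix n
  have "dconv f g n = (\<Sum>(d, e)\<in>prod.swap ` factor_pairs n. f d * g e)"
    unfolding dconv_def by (rule sum.cong) (auto simp: factor_pairs_def image_iff mult.commute)
  also have "\<dots> = dconv g f n"
    unfolding dconv_def by (subst sum.reindex) (auto simp: inj_on_def mult.commute intro!: sum.cong)
  finally show "dconv f g n = dconv g f n" .
qed

lemma dconv_assoc: "dconv (dconv f g) h = dconv f (dconv g h)"
proof
  fix n :: nat
  show "dconv (dconv f g) h n = dconv f (dconv g h) n"
  proof (cases "n = 0")
    case False
    have pos: "d > 0" "e > 0" if "(d, e) \<in> factor_pairs n" for d e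
      using that False by (auto simp: factor_pairs_def intro: Nat.gr0I)
    have "dconv (dconv f g) h n
        = (\<Sum>x\<in>factor_pairs n. \<Sum>y\<in>factor_pairs (fst x). f (fst y) * g (snd y) * h (snd x))"
      by (simp add: dconv_def sum_distrib_right case_prod_unfold)
    also have "\<dots> = (\<Sum>(x, y)\<in>(SIGMA x:factor_pairs n. factor_pairs (fst x)).
                     f (fst y) * g (snd y) * h (snd x))"
      using False pos by (intro sum.Sigma) auto
    also have "\<dots> = (\<Sum>(x, y)\<in>(SIGMA x:factor_pairs n. factor_pairs (snd x)).
                     f (fst x) * g (fst y) * h (snd y))"
      by (rule sum.reindex_bij_witness[where
            i = "\<lambda>((a, bc), (b, c)). ((a * b, c), (a, b))" and
            j = "\<lambda>((ab, c), (a, b)). ((a, b * c), (b, c))"])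
         (auto simp: factor_pairs_def mult_ac)
    also have "\<dots> = (\<Sum>x\<in>factor_pairs n. \<Sum>y\<in>factor_pairs (snd x). f (fst x) * g (fst y) * h (snd y))"
      using False pos by (intro sum.Sigma[symmetric]) auto
    also have "\<dots> = dconv f (dconv g h) n"
      by (simp add: dconv_def sum_distrib_left case_prod_unfold mult_ac)
    finally show ?thesis .
  qed auto
qed

lemma dconv_add_right: "dconv h (\<lambda>n. f n + g n) n = dconv h f n + dconv h g n"
  by (simp add: dconv_def case_prod_unfold sum.distrib algebra_simps)

lemma dconv_cong:
  assumes "\<And>n. n > 0 \<Longrightarrow> f n = f' n" "\<And>n. n > 0 \<Longrightarrow> g n = g' n"
  shows "dconv f g = dconv f' g'"
proof
  fix n :: nat
  show "dconv f g n = dconv f' g' n"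
  proof (cases "n = 0")
    case False
    then show ?thesis unfolding dconv_def
      by (intro sum.cong) (auto simp: factor_pairs_def assms intro!: Nat.gr0I)
  qed auto
qed

text \<open>Multiplication by \<open>ln\<close> is a derivation of the convolution ring. For a product \<open>a\<close> of characters this gives the
  recursion \<open>ln \<sqdot> a = a * (\<Lambda> \<sqdot> S)\<close>, where \<open>S\<close> is the sum of the characters, so that \<open>a \<ge> 0\<close> follows from
  \<open>S \<ge> 0\<close> without Euler products.\<close>

lemma ln_dconv:
  assumes "n > 0"
  shows "of_real (ln n) * dconv f g n
       = dconv (\<lambda>n. of_real (ln n) * f n) g n + dconv f (\<lambda>n. of_real (ln n) * g n) n"
  unfolding dconv_def sum_distrib_left sum.distrib[symmetric]
  by (rule sum.cong) (use assms in \<open>auto simp: factor_pairs_def ln_mult algebra_simps\<close>)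

text \<open>Complete multiplicativity pulls \<open>f n\<close> out of the convolution; what remains
  is the sum of \<open>mangoldt\<close> over the divisors of n, which is
  \<open>ln n\<close>.\<close>

lemma ln_compl_mult:
  assumes "compl_mult f" "n > 0"
  shows "of_real (ln n) * f n = dconv f (\<lambda>d. f d * mangoldt d) n"
proof -
  have "dconv f (\<lambda>d. f d * mangoldt d) n = (\<Sum>x\<in>factor_pairs n. f n * mangoldt (snd x))"
    unfolding dconv_def
    by (rule sum.cong) (use assms in \<open>auto simp: factor_pairs_def compl_mult_def\<close>)
  also have "\<dots> = (\<Sum>d | d dvd n. f n * mangoldt d)"
    by (rule sum.reindex_bij_witness[where i = "\<lambda>d. (n div d, d)" and j = snd])
       (use assms in \<open>auto simp: factor_pairs_def\<close>)
  also have "\<dots> = of_real (ln n) * f n"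
    using assms mangoldt_sum[of n, where 'a = complex] by (simp add: sum_distrib_left[symmetric])
  finally show ?thesis ..
qed

lemma ln_conv_prod:
  assumes "\<And>f. f \<in> set fs \<Longrightarrow> compl_mult f" "n > 0"
  shows "of_real (ln n) * conv_prod fs n = dconv (conv_prod fs) (\<lambda>d. mangoldt d * (\<Sum>f\<leftarrow>fs. f d)) n"
  using assms
proof (induction fs arbitrary: n)
  case Nil
  then show ?case by (auto simp: conv_prod_Nil dconv_def)
next
  case (Cons f fs)
  let ?c = "\<lambda>d. mangoldt d * (\<Sum>f\<leftarrow>fs. f d)"
  have "of_real (ln n) * conv_prod (f # fs) n
      = dconv (\<lambda>n. of_real (ln n) * f n) (conv_prod fs) n + dconv f (\<lambda>n. of_real (ln n) * conv_prod fs n) n"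
    using Cons.prems by (simp add: conv_prod_Cons ln_dconv)
  also have "dconv (\<lambda>n. of_real (ln n) * f n) (conv_prod fs)
      = dconv (dconv f (\<lambda>d. f d * mangoldt d)) (conv_prod fs)"
    using Cons.prems by (intro dconv_cong ln_compl_mult) auto
  also have "\<dots> = dconv (conv_prod (f # fs)) (\<lambda>d. f d * mangoldt d)"
    by (simp add: conv_prod_Cons dconv_assoc) (metis dconv_commute)
  also have "dconv f (\<lambda>n. of_real (ln n) * conv_prod fs n) = dconv f (dconv (conv_prod fs) ?c)"
    using Cons by (intro dconv_cong) auto
  also have "\<dots> = dconv (conv_prod (f # fs)) ?c"
    by (simp add: conv_prod_Cons dconv_assoc)
  also have "dconv (conv_prod (f # fs)) (\<lambda>d. f d * mangoldt d) n + dconv (conv_prod (f # fs)) ?c n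
      = dconv (conv_prod (f # fs)) (\<lambda>d. mangoldt d * (\<Sum>f\<leftarrow>f # fs. f d)) n"
    by (subst dconv_add_right[symmetric]) (simp add: algebra_simps)
  finally show ?case .
qed

lemma conv_prod_1:
  assumes "\<And>f. f \<in> set fs \<Longrightarrow> compl_mult f"
  shows "conv_prod fs 1 = 1"
  using assms by (induction fs) (simp_all add: conv_prod_Nil conv_prod_Cons dconv_1[simplified] compl_mult_def)

lemma sum_nonneg_Reals:
  "(\<And>x. x \<in> A \<Longrightarrow> f x \<in> \<real>\<^sub>\<ge>\<^sub>0) \<Longrightarrow> sum f A \<in> \<real>\<^sub>\<ge>\<^sub>0"
  by (induction A rule: infinite_finite_induct) auto

lemma conv_prod_nonneg:
  assumes "\<And>f. f \<in> set fs \<Longrightarrow> compl_mult f"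
    and "\<And>d. d > 0 \<Longrightarrow> (\<Sum>f\<leftarrow>fs. f d) \<in> \<real>\<^sub>\<ge>\<^sub>0"
    and "n > 0"
  shows "conv_prod fs n \<in> \<real>\<^sub>\<ge>\<^sub>0"
  using assms(3)
proof (induction n rule: less_induct)
  case (less n)
  show ?case
  proof (cases "n = 1")
    case True
    then show ?thesis using conv_prod_1[of fs] assms(1) by simp
  next
    case False
    then have n: "n > 1" using less by simp
    have "conv_prod fs d * (mangoldt e * (\<Sum>f\<leftarrow>fs. f e)) \<in> \<real>\<^sub>\<ge>\<^sub>0" if "(d, e) \<in> factor_pairs n" for d e
    proof (cases "e = 1")
      \<comment> \<open>\<open>mangoldt 1 = 0\<close>, so the term with d = n, the only one out of
        reach of the induction hypothesis, vanishes.\<close>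
      case True
      then show ?thesis by simp
    next
      case False
      have de: "d > 0" "e > 1" "d * e = n" using that n False 
        by (auto simp: factor_pairs_def intro!: Nat.gr0I) 
           (metis One_nat_def Suc_lessI gr0I mult_0_right not_less_zero)
      then have "d * 1 < d * e" by (intro mult_strict_left_mono) auto
      then have "d < n" using de by simp
      moreover have "(mangoldt e :: complex) \<in> \<real>\<^sub>\<ge>\<^sub>0"
        by (metis mangoldt_nonneg nonneg_Reals_of_real_iff of_real_mangoldt)
      ultimately show ?thesis using less de assms(2)[of e] by (intro nonneg_Reals_mult_I) auto
    qed
    then have "dconv (conv_prod fs) (\<lambda>d. mangoldt d * (\<Sum>f\<leftarrow>fs. f d)) n \<in> \<real>\<^sub>\<ge>\<^sub>0"
      unfolding dconv_def by (intro sum_nonneg_Reals) auto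
    then have "of_real (ln n) * conv_prod fs n \<in> \<real>\<^sub>\<ge>\<^sub>0"
      using ln_conv_prod[of fs n] assms(1) n by simp
    then have "of_real (inverse (ln n)) * (of_real (ln n) * conv_prod fs n) \<in> \<real>\<^sub>\<ge>\<^sub>0"
      using n by (intro nonneg_Reals_mult_I[of "of_real (inverse (ln n))" "of_real (ln n) * conv_prod fs n" for n]) auto
    moreover have "of_real (inverse (ln n)) * (of_real (ln n) * conv_prod fs n) = conv_prod fs n"
      using n by (simp flip: mult.assoc of_real_mult)
    ultimately show ?thesis by metis
  qed
qed


section \<open>Absolutely convergent Dirichlet series and their products\<close>

lemma npow_1 [simp]: "npow 1 s = 1" "npow (Suc 0) s = 1"
  by (simp_all add: npow_def)

lemma npow_mult: "m > 0 \<Longrightarrow> n > 0 \<Longrightarrow> npow (m * n) s = npow m s * npow n s"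
  by (simp add: npow_def ln_mult algebra_simps flip: exp_add)

lemma norm_npow: "n > 0 \<Longrightarrow> norm (npow n s) = real n powr (- Re s)"
  by (simp add: npow_def powr_def)

lemma npow_of_real: "n > 0 \<Longrightarrow> npow n (of_real x) = of_real (real n powr (- x))"
  by (simp add: npow_def powr_def flip: exp_of_real)

lemma npow_dirichlet_summable:
  assumes "\<And>n. n > 0 \<Longrightarrow> norm (f n) \<le> 1" "Re s > 1"
  shows "(\<lambda>n. f n * npow n s) summable_on {1..}"
proof -
  have "summable (\<lambda>n. real n powr (- Re s))"
    using assms(2) by (simp add: summable_real_powr_iff)
  then have "(\<lambda>n. real n powr (- Re s)) summable_on UNIV"
    by (intro summable_nonneg_imp_summable_on) auto
  then have "(\<lambda>n. real n powr (- Re s)) summable_on {1..}"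
    by (rule summable_on_subset_banach) auto
  then have "(\<lambda>n. norm (real n powr (- Re s))) summable_on {1..}"
    by (subst (asm) summable_on_iff_abs_summable_on_real)
  then have "(\<lambda>n. norm (f n * npow n s)) summable_on {1..}"
  proof (rule Infinite_Sum.abs_summable_on_comparison_test)
    fix n :: nat assume "n \<in> {1..}"
    then show "norm (f n * npow n s) \<le> norm (real n powr (- Re s))"
      using assms(1)[of n] by (auto simp: norm_mult norm_npow intro!: mult_left_le_one_le)
  qed
  then show ?thesis by (rule abs_summable_summable)
qed

text \<open>Both series converge absolutely, hence so does the double series over pairs (d, e);
  grouping the pairs by their product n = d e produces the convolution.\<close>

lemma has_sum_dconv:
  assumes "((\<lambda>n. f n * npow n s) has_sum F) {1..}" "((\<lambda>n. g n * npow n s) has_sum G) {1..}"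
  shows "((\<lambda>n. dconv f g n * npow n s) has_sum (F * G)) {1..}"
proof -
  let ?f = "\<lambda>n. f n * npow n s" and ?g = "\<lambda>n. g n * npow n s"
  let ?h = "\<lambda>(d, e). ?f d * ?g e"
  have f: "?f summable_on {1..}" "(\<lambda>n. norm (?f n)) summable_on {1..}" and g: "?g summable_on {1..}" "(\<lambda>n. norm (?g n)) summable_on {1..}"
    using assms by (auto simp: has_sum_iff simp flip: summable_on_iff_abs_summable_on_complex)
  have "(\<lambda>x. norm (?h x)) summable_on ({1..} \<times> {1..})"
    unfolding Infinite_Sum.abs_summable_on_Sigma_iff
  proof (intro conjI ballI)
    fix d assume "d \<in> {1::nat..}"
    have "(\<lambda>e. norm (?f d) * norm (?g e)) summable_on {1..}"
      by (intro summable_on_cmult_right g)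
    then show "(\<lambda>y. norm (?h (d, y))) summable_on {1..}"
      by (simp add: norm_mult)
  next
    have "(\<lambda>d. norm (norm (?f d) * (\<Sum>\<^sub>\<infinity>e\<in>{1..}. norm (?g e)))) summable_on {1..}"
      unfolding summable_on_iff_abs_summable_on_real[symmetric]
      by (intro summable_on_cmult_left f)
    then show "(\<lambda>d. norm (\<Sum>\<^sub>\<infinity>y\<in>{1..}. norm (?h (d, y)))) summable_on {1..}"
      by (simp add: norm_mult infsum_cmult_right')
  qed
  then have summ: "?h summable_on ({1..} \<times> {1..})" by (rule abs_summable_summable)
  have "((\<lambda>d. ?f d * G) has_sum (F * G)) {1..}"
    by (intro has_sum_cmult_left assms)
  moreover have "((\<lambda>e. ?h (d, e)) has_sum ?f d * G) {1..}" for d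
    using has_sum_cmult_right[OF assms(2), of "?f d"] by simp
  ultimately have "(?h has_sum (F * G)) ({1..} \<times> {1..})"
    by (intro has_sum_SigmaI[OF _ _ summ])
  moreover have "(?h has_sum (F * G)) ({1..} \<times> {1..}) \<longleftrightarrow>
      ((\<lambda>(n, d, e). f d * g e * npow n s) has_sum (F * G)) (Sigma {1..} factor_pairs)"
    by (rule has_sum_reindex_bij_witness[where
          i = "\<lambda>(n, d, e). (d, e)" and j = "\<lambda>(d, e). (d * e, d, e)"])
       (auto simp: factor_pairs_def npow_mult Suc_le_eq intro!: Nat.gr0I)
  ultimately have "((\<lambda>(n, d, e). f d * g e * npow n s) has_sum (F * G)) (Sigma {1..} factor_pairs)"
    by simp
  then show ?thesis
  proof (rule has_sum_SigmaD)
    fix n assume "n \<in> {1::nat..}"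
    then show "((\<lambda>y. case (n, y) of (n, d, e) \<Rightarrow> f d * g e * npow n s) has_sum dconv f g n * npow n s) (factor_pairs n)"
      by (intro has_sum_finiteI) (auto simp: dconv_def sum_distrib_right case_prod_unfold)
  qed
qed

lemma has_sum_conv_prod:
  assumes "\<And>f. f \<in> set fs \<Longrightarrow> ((\<lambda>n. f n * npow n s) has_sum F f) {1..}"
  shows "((\<lambda>n. conv_prod fs n * npow n s) has_sum (\<Prod>f\<leftarrow>fs. F f)) {1..}"
  using assms
proof (induction fs)
  case Nil
  have "((\<lambda>n. conv_prod [] n * npow n s) has_sum 1) {1::nat}"
    by (intro has_sum_finiteI) (auto simp: conv_prod_Nil)
  then show ?case
    by (subst has_sum_cong_neutral[where T = "{1}"]) (auto simp: conv_prod_Nil)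
next
  case (Cons f fs)
  then have "((\<lambda>n. dconv f (conv_prod fs) n * npow n s) has_sum F f * (\<Prod>f\<leftarrow>fs. F f)) {1..}"
    by (intro has_sum_dconv) auto
  then show ?case by (simp add: conv_prod_Cons)
qed

section \<open>Dirichlet series with bounded partial sums\<close>


definition partial :: "(nat \<Rightarrow> complex) \<Rightarrow> nat \<Rightarrow> complex" where
  "partial f n = (\<Sum>k=1..n. f k)"

definition bounded_partials :: "real \<Rightarrow> (nat \<Rightarrow> complex) \<Rightarrow> bool" where
  "bounded_partials q f \<longleftrightarrow> (\<forall>n. norm (partial f n) \<le> q)"

text \<open>Summation by parts makes the series converge locally uniformly on \<open>Re s > 0\<close>.\<close>

definition Lfun :: "(nat \<Rightarrow> complex) \<Rightarrow> complex \<Rightarrow> complex" where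
  "Lfun f s = (\<Sum>n. partial f (Suc n) * (npow (Suc n) s - npow (Suc (Suc n)) s))"

lemma partial_0 [simp]: "partial f 0 = 0"
  and partial_Suc: "partial f (Suc n) = partial f n + f (Suc n)"
  by (simp_all add: partial_def)

lemma bounded_partialsD: "bounded_partials q f \<Longrightarrow> norm (partial f n) \<le> q"
  by (auto simp: bounded_partials_def)

lemma bounded_partials_nonneg: "bounded_partials q f \<Longrightarrow> q \<ge> 0"
  by (meson bounded_partialsD norm_ge_zero order_trans)

text \<open>Mean value inequality for exp on the segment from -s ln(n+1) to -s ln n: there |exp| is
  at most n^(-Re s), and the segment has length |s| ln(1 + 1/n), at most |s|/n. The gain of 1/n is
  what makes the series \<open>Lfun\<close> converge on Re s > 0.\<close>

lemma npow_diff_bound: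
  assumes "Re s \<ge> 0" "n > 0"
  shows "norm (npow n s - npow (Suc n) s) \<le> norm s * real n powr (- Re s - 1)"
proof -
  let ?a = "- (s * of_real (ln (real n)))" and ?b = "- (s * of_real (ln (real (Suc n))))"
  have "norm (exp ?a - exp ?b) \<le> real n powr (- Re s) * norm (?a - ?b)"
  proof (rule field_differentiable_bound[where S = "closed_segment ?b ?a" and f' = exp])
    fix z assume z: "z \<in> closed_segment ?b ?a"
    show "(exp has_field_derivative exp z) (at z within closed_segment ?b ?a)"
      by (rule DERIV_subset[OF DERIV_exp]) auto
    have "Re z \<le> - Re s * ln (real n)"
    proof -
      obtain u where u: "0 \<le> u" "u \<le> 1" "z = (1 - u) *\<^sub>R ?b + u *\<^sub>R ?a"
        using z by (auto simp: in_segment)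
      have "Re z = - Re s * ((1 - u) * ln (real (Suc n)) + u * ln (real n))"
        unfolding u(3) by (simp add: algebra_simps)
      moreover have "ln (real n) = (1 - u) * ln (real n) + u * ln (real n)"
        by (simp add: algebra_simps)
      moreover have "\<dots> \<le> (1 - u) * ln (real (Suc n)) + u * ln (real n)"
        using u assms by (intro add_mono mult_left_mono) auto
      ultimately have "ln (real n) \<le> (1 - u) * ln (real (Suc n)) + u * ln (real n)" by linarith
      from mult_left_mono_neg[OF this, of "- Re s"] show ?thesis
        using assms(1) \<open>Re z = _\<close> by simp
    qed
    then show "norm (exp z) \<le> real n powr (- Re s)"
      using assms by (simp add: powr_def)
  qed auto
  also have "norm (?a - ?b) = norm (s * of_real (ln (real (Suc n)) - ln (real n)))"
    by (simp add: algebra_simps)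
  also have "\<dots> = norm s * \<bar>ln (real (Suc n)) - ln (real n)\<bar>"
    by (simp add: norm_mult flip: of_real_diff)
  also have "\<bar>ln (real (Suc n)) - ln (real n)\<bar> = ln (1 + 1 / real n)"
  proof -
    have "1 + 1 / real n = real (Suc n) / real n" using assms by (simp add: field_simps)
    then have "ln (1 + 1 / real n) = ln (real (Suc n)) - ln (real n)"
      using assms by (simp add: ln_div)
    moreover have "ln (real n) \<le> ln (real (Suc n))" using assms by simp
    ultimately show ?thesis by simp
  qed
  also have "\<dots> \<le> 1 / real n"
    using assms by (intro ln_add_one_self_le_self) auto
  finally have "norm (exp ?a - exp ?b) \<le> real n powr (- Re s) * (norm s * (1 / real n))"
    by (simp add: mult_left_mono)
  also have "\<dots> = norm s * real n powr (- Re s - 1)"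
    using assms by (simp add: powr_diff)
  finally show ?thesis by (simp add: npow_def)
qed

lemma summable_powr_shift:
  "s > 0 \<Longrightarrow> summable (\<lambda>n. real (Suc n) powr (- s - 1))"
  by (subst summable_Suc_iff[of "\<lambda>n. real n powr (- s - 1)"]) (simp add: summable_real_powr_iff)

lemma Lfun_term_bound:
  assumes "bounded_partials q f" "Re s \<ge> \<sigma>" "\<sigma> \<ge> 0" "norm s \<le> R"
  shows "norm (partial f (Suc n) * (npow (Suc n) s - npow (Suc (Suc n)) s))
         \<le> q * R * real (Suc n) powr (- \<sigma> - 1)"
proof -
  have "norm (partial f (Suc n) * (npow (Suc n) s - npow (Suc (Suc n)) s))
      \<le> q * (norm s * real (Suc n) powr (- Re s - 1))"
    unfolding norm_mult using assms bounded_partials_nonneg[OF assms(1)]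
    by (intro mult_mono npow_diff_bound bounded_partialsD) auto
  also have "\<dots> \<le> q * (R * real (Suc n) powr (- \<sigma> - 1))"
    using assms bounded_partials_nonneg[OF assms(1)] order_trans[OF norm_ge_zero assms(4)]
    by (intro mult_left_mono mult_mono powr_mono) auto
  finally show ?thesis by (simp add: mult.assoc)
qed

lemma Lfun_sums:
  assumes "bounded_partials q f" "Re s > 0"
  shows "(\<lambda>n. partial f (Suc n) * (npow (Suc n) s - npow (Suc (Suc n)) s)) sums Lfun f s"
proof -
  have "summable (\<lambda>n. partial f (Suc n) * (npow (Suc n) s - npow (Suc (Suc n)) s))"
  proof (rule summable_comparison_test)
    show "summable (\<lambda>n. q * norm s * real (Suc n) powr (- Re s - 1))"
      using assms by (intro summable_mult summable_powr_shift)
  qed (use Lfun_term_bound[OF assms(1), of "Re s" s "norm s"] assms in auto)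
  then show ?thesis unfolding Lfun_def by (rule summable_sums)
qed

lemma Lfun_holomorphic:
  assumes "bounded_partials q f"
  shows "Lfun f holomorphic_on {s. Re s > 0}"
proof (rule holomorphic_uniform_sequence)
  show "open {s. Re s > 0}" by (rule open_halfspace_Re_gt)
  show "(\<lambda>s. \<Sum>i<n. partial f (Suc i) * (npow (Suc i) s - npow (Suc (Suc i)) s)) holomorphic_on {s. Re s > 0}" for n
    unfolding npow_def by (intro holomorphic_intros)
  fix x assume x: "x \<in> {s. Re s > 0}"
  \<comment> \<open>With this radius Re z is at least d on the whole closed disc, so a single
    convergent majorant with exponent -d - 1 serves all z in it.\<close>
  define d where "d = Re x / 2"
  have d: "d > 0" using x by (simp add: d_def)
  have Re: "Re z \<ge> d" if "z \<in> cball x d" for z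
    using that abs_Re_le_cmod[of "x - z"] by (auto simp: dist_norm d_def field_simps abs_le_iff)
  have "uniform_limit (cball x d) (\<lambda>n s. \<Sum>i<n. partial f (Suc i) * (npow (Suc i) s - npow (Suc (Suc i)) s))
     (\<lambda>s. \<Sum>n. partial f (Suc n) * (npow (Suc n) s - npow (Suc (Suc n)) s)) sequentially"
  proof (rule Weierstrass_m_test)
    show "summable (\<lambda>n. q * (norm x + d) * real (Suc n) powr (- d - 1))"
      using d by (intro summable_mult summable_powr_shift)
    fix n z assume z: "z \<in> cball x d"
    have "norm z \<le> norm x + d"
      using z norm_triangle_ineq2[of z x] by (auto simp: dist_norm norm_minus_commute)
    then show "norm (partial f (Suc n) * (npow (Suc n) z - npow (Suc (Suc n)) z))
        \<le> q * (norm x + d) * real (Suc n) powr (- d - 1)"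
      using Re[OF z] d by (intro Lfun_term_bound assms) auto
  qed
  then show "\<exists>d>0. cball x d \<subseteq> {s. Re s > 0} \<and> uniform_limit (cball x d)
     (\<lambda>n s. \<Sum>i<n. partial f (Suc i) * (npow (Suc i) s - npow (Suc (Suc i)) s)) (Lfun f) sequentially"
    using d Re by (intro exI[of _ d]) (force simp: Lfun_def[abs_def])
qed

lemma summation_by_parts:
  "(\<Sum>n<N. partial f (Suc n) * (u (Suc n) - u (Suc (Suc n)))) =
   (\<Sum>n=1..N. f n * u n) - partial f N * (u (Suc N) :: complex)"
  by (induction N) (simp_all add: partial_Suc algebra_simps)

lemma npow_tendsto_0:
  assumes "Re s > 0"
  shows "(\<lambda>n. npow (Suc n) s) \<longlonglongrightarrow> 0"
proof (rule tendsto_norm_zero_cancel)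
  have "(\<lambda>n. real (Suc n) powr (- Re s)) \<longlonglongrightarrow> 0"
    using assms by (intro tendsto_neg_powr filterlim_compose[OF filterlim_real_sequentially filterlim_Suc]) auto
  then show "(\<lambda>n. norm (npow (Suc n) s)) \<longlonglongrightarrow> 0"
    by (simp add: norm_npow del: of_nat_Suc)
qed

text \<open>Identifies the regrouped series with the ordinary Dirichlet series: the boundary term of
  the summation by parts is a bounded partial sum times (N+1)^(-s). At s = 1 this is only
  conditional convergence, which is all that is needed there.\<close>

lemma Lfun_limit:
  assumes "bounded_partials q f" "Re s > 0"
  shows "(\<lambda>N. \<Sum>n=1..N. f n * npow n s) \<longlonglongrightarrow> Lfun f s"
proof -
  have "(\<lambda>N. partial f N * npow (Suc N) s) \<longlonglongrightarrow> 0"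
  proof (rule tendsto_0_le[OF npow_tendsto_0[OF assms(2)], of _ q])
    show "\<forall>\<^sub>F N in sequentially. norm (partial f N * npow (Suc N) s) \<le> norm (npow (Suc N) s) * q"
      using bounded_partialsD[OF assms(1)]
      by (auto simp: norm_mult mult.commute[of _ q] intro!: always_eventually mult_right_mono)
  qed
  from tendsto_add[OF Lfun_sums[OF assms, unfolded sums_def summation_by_parts[of f "\<lambda>n. npow n s"]] this]
  show ?thesis by simp
qed

lemma Lfun_has_sum:
  assumes "bounded_partials q f" "\<And>n. n > 0 \<Longrightarrow> norm (f n) \<le> 1" "Re s > 1"
  shows "((\<lambda>n. f n * npow n s) has_sum Lfun f s) {1..}"
proof -
  obtain S where S: "((\<lambda>n. f n * npow n s) has_sum S) {1..}"
    using npow_dirichlet_summable[of f s] assms by (auto simp: summable_on_def)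
  also have "?this \<longleftrightarrow> ((\<lambda>n. f (Suc n) * npow (Suc n) s) has_sum S) UNIV"
    by (rule has_sum_reindex_bij_witness[where i = Suc and j = "\<lambda>n. n - 1"]) auto
  finally have "(\<lambda>n. f (Suc n) * npow (Suc n) s) sums S" by (rule has_sum_imp_sums)
  then have "(\<lambda>N. \<Sum>n=1..N. f n * npow n s) \<longlonglongrightarrow> S"
    by (simp add: sums_def sum.atLeast1_atMost_eq)
  then have "S = Lfun f s"
    using Lfun_limit[OF assms(1), of s] assms(3) LIMSEQ_unique by force
  then show ?thesis using S by simp
qed

lemma Lfun_bound:
  assumes "bounded_partials q f" "Re s \<ge> 1 / 2"
  shows "norm (Lfun f s) \<le> q * norm s * (\<Sum>n. real (Suc n) powr (- (1 / 2) - 1))"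
proof -
  have "norm (Lfun f s) \<le> (\<Sum>n. q * norm s * real (Suc n) powr (- (1 / 2) - 1))"
    unfolding Lfun_def using assms
    by (intro norm_suminf_le summable_mult summable_powr_shift Lfun_term_bound) auto
  then show ?thesis by (subst (asm) suminf_mult) (use summable_powr_shift[of "1/2"] in auto)
qed

text \<open>Summation by parts for g, which is f with its first N values erased. Its partial sums
  are differences of two partial sums of f, whence 2q, and because n^(-x) decreases for real x the
  differences telescope to a single power of N.\<close>

lemma Lfun_tail:
  assumes "bounded_partials q f" "x > 0" "N > 0"
  shows "norm (Lfun f (of_real x) - (\<Sum>n=1..N. f n * npow n (of_real x))) \<le> 2 * q * real N powr (- x)"
proof -
  have bd: "norm ((\<Sum>n=1..N+M. f n * npow n (of_real x)) - (\<Sum>n=1..N. f n * npow n (of_real x)))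
          \<le> 2 * q * real (Suc N) powr (- x)" for M
  proof -
    let ?u = "\<lambda>n. real n powr (- x)"
    define g where "g = (\<lambda>n. if n \<le> N then 0 else f n)"
    have pg: "partial g n = (if n \<le> N then 0 else partial f n - partial f N)" for n
      by (induction n) (auto simp: partial_Suc g_def not_le less_Suc_eq_le dest: le_antisym)
    have png: "norm (partial g n) \<le> 2 * q" for n
      using bounded_partialsD[OF assms(1), of n] bounded_partialsD[OF assms(1), of N]
        bounded_partials_nonneg[OF assms(1)] norm_triangle_ineq4[of "partial f n" "partial f N"]
      by (auto simp: pg)
    have "(\<Sum>n=1..N+M. f n * npow n (of_real x)) - (\<Sum>n=1..N. f n * npow n (of_real x))
        = (\<Sum>n=1..N+M. g n * of_real (?u n))"
    proof (induction M)
      case 0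
      have "(\<Sum>n=1..N. g n * of_real (?u n)) = 0" by (intro sum.neutral) (auto simp: g_def)
      then show ?case by simp
    next
      case (Suc M)
      then show ?case by (simp add: g_def npow_of_real algebra_simps del: of_nat_Suc of_nat_add)
    qed
    also have "\<dots> = (\<Sum>n<N+M. partial g (Suc n) * of_real (?u (Suc n) - ?u (Suc (Suc n))))
                   + partial g (N + M) * of_real (?u (Suc (N + M)))"
      using summation_by_parts[of g "\<lambda>n. of_real (?u n)" "N + M"] by (simp del: of_nat_Suc of_nat_add)
    also have "norm \<dots> \<le> (\<Sum>n\<in>{N..<N+M}. 2 * q * (?u (Suc n) - ?u (Suc (Suc n)))) + 2 * q * ?u (Suc (N + M))"
    proof (intro norm_triangle_le add_mono)
      have "norm (\<Sum>n<N+M. partial g (Suc n) * of_real (?u (Suc n) - ?u (Suc (Suc n)))) =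
            norm (\<Sum>n\<in>{N..<N+M}. partial g (Suc n) * of_real (?u (Suc n) - ?u (Suc (Suc n))))"
        by (intro arg_cong[where f = norm] sum.mono_neutral_right) (auto simp: pg)
      also have "\<dots> \<le> (\<Sum>n\<in>{N..<N+M}. 2 * q * (?u (Suc n) - ?u (Suc (Suc n))))"
      proof (rule sum_norm_le)
        fix n
        have "?u (Suc n) - ?u (Suc (Suc n)) \<ge> 0" using assms by (simp add: powr_mono2')
        then show "norm (partial g (Suc n) * of_real (?u (Suc n) - ?u (Suc (Suc n))))
            \<le> 2 * q * (?u (Suc n) - ?u (Suc (Suc n)))"
          unfolding norm_mult norm_of_real using png bounded_partials_nonneg[OF assms(1)]
            by (intro mult_mono) auto
      qed
      finally show "norm (\<Sum>n<N+M. partial g (Suc n) * of_real (?u (Suc n) - ?u (Suc (Suc n)))) \<le> \<dots>" .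
      show "norm (partial g (N + M) * of_real (?u (Suc (N + M)))) \<le> 2 * q * ?u (Suc (N + M))"
        unfolding norm_mult using png bounded_partials_nonneg[OF assms(1)] by (intro mult_mono) auto
    qed
    also have "(\<Sum>n\<in>{N..<N+M}. 2 * q * (?u (Suc n) - ?u (Suc (Suc n)))) = 2 * q * (?u (Suc N) - ?u (Suc (N + M)))"
      by (induction M) (simp_all add: algebra_simps del: of_nat_Suc of_nat_add)
    finally show ?thesis by (simp add: algebra_simps del: of_nat_Suc)
  qed
  have "(\<lambda>M. \<Sum>n=1..M+N. f n * npow n (of_real x)) \<longlonglongrightarrow> Lfun f (of_real x)"
    using assms by (intro LIMSEQ_ignore_initial_segment Lfun_limit) auto
  then have "(\<lambda>M. norm ((\<Sum>n=1..M+N. f n * npow n (of_real x)) - (\<Sum>n=1..N. f n * npow n (of_real x))))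
      \<longlonglongrightarrow> norm (Lfun f (of_real x) - (\<Sum>n=1..N. f n * npow n (of_real x)))"
    by (intro tendsto_norm tendsto_diff tendsto_const)
  moreover have "norm ((\<Sum>n=1..M+N. f n * npow n (of_real x)) - (\<Sum>n=1..N. f n * npow n (of_real x)))
      \<le> 2 * q * real (Suc N) powr (- x)" for M
    using bd[of M] unfolding add.commute[of N M] .
  ultimately have "norm (Lfun f (of_real x) - (\<Sum>n=1..N. f n * npow n (of_real x))) \<le> 2 * q * real (Suc N) powr (- x)"
    by (intro LIMSEQ_le_const2[where X = "\<lambda>M. norm ((\<Sum>n=1..M+N. f n * npow n (of_real x)) - (\<Sum>n=1..N. f n * npow n (of_real x)))"]) blast+
  also have "\<dots> \<le> 2 * q * real N powr (- x)"
    using assms bounded_partials_nonneg[OF assms(1)] by (intro mult_left_mono powr_mono2') auto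
  finally show ?thesis .
qed

lemma Lfun_real_bound:
  assumes "bounded_partials q f" "x > 0" "norm (f 1) \<le> 1"
  shows "norm (Lfun f (of_real x)) \<le> 2 * q + 1"
  using Lfun_tail[OF assms(1,2), of 1] assms(3) norm_triangle_ineq2[of "Lfun f (of_real x)" "f 1"] by simp

lemma Lfun_cnj:
  assumes "bounded_partials q f" "Re s > 0"
  shows "Lfun (\<lambda>n. cnj (f n)) (cnj s) = cnj (Lfun f s)"
proof -
  have "(\<lambda>n. cnj (partial f (Suc n) * (npow (Suc n) s - npow (Suc (Suc n)) s))) sums cnj (Lfun f s)"
    using Lfun_sums[OF assms] by (simp only: sums_cnj)
  moreover have "cnj (npow n s) = npow n (cnj s)" for n
    by (simp add: npow_def exp_cnj)
  ultimately show ?thesis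
    by (simp add: Lfun_def sums_iff partial_def del: sum.cl_ivl_Suc)
qed

section \<open>A lower bound for the residue\<close>


lemma higher_deriv_dirichlet_polynomial:
  "(deriv ^^ k) (\<lambda>s. \<Sum>n\<in>A. of_real (a n) * npow n s)
   = (\<lambda>s. \<Sum>n\<in>A. of_real (a n * (- ln (real n)) ^ k) * npow n s)"
proof (induction k)
  case (Suc k)
  have "((\<lambda>s. \<Sum>n\<in>A. of_real (a n * (- ln (real n)) ^ k) * npow n s) has_field_derivative
         (\<Sum>n\<in>A. of_real (a n * (- ln (real n)) ^ Suc k) * npow n s)) (at s)" for s
    unfolding npow_def by (auto intro!: derivative_eq_intros sum.cong)
  then show ?case by (simp add: Suc DERIV_imp_deriv fun_eq_iff del: power_Suc)
qed auto

lemma higher_deriv_inverse_shift: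
  fixes l :: complex
  assumes "w \<noteq> 1"
  shows "(deriv ^^ k) (\<lambda>z. l / (z - 1)) w = l * (-1) ^ k * fact k / (w - 1) ^ Suc k"
  using assms
proof (induction k arbitrary: w)
  case (Suc k)
  have "(deriv ^^ Suc k) (\<lambda>z. l / (z - 1)) w = deriv (\<lambda>w. l * (-1) ^ k * fact k / (w - 1) ^ Suc k) w"
    unfolding funpow.simps o_def
  proof (rule deriv_cong_ev)
    have "\<forall>\<^sub>F z in nhds w. z \<in> - {1}"
      using Suc.prems by (intro eventually_nhds_in_open) auto
    then show "\<forall>\<^sub>F z in nhds w. (deriv ^^ k) (\<lambda>z. l / (z - 1)) z = l * (-1) ^ k * fact k / (z - 1) ^ Suc k"
      by eventually_elim (use Suc.IH in auto)
  qed auto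
  also have "\<dots> = l * (-1) ^ Suc k * fact (Suc k) / (w - 1) ^ Suc (Suc k)"
  proof (rule DERIV_imp_deriv)
    define d C where "d = w - 1" and "C = l * (-1) ^ k * fact k"
    have d: "d \<noteq> 0" using Suc.prems by (simp add: d_def)
    have "((\<lambda>w. C / (w - 1) ^ Suc k) has_field_derivative
          (0 * (w - 1) ^ Suc k - C * (of_nat (Suc k) * (w - 1) ^ k)) / ((w - 1) ^ Suc k * (w - 1) ^ Suc k)) (at w)"
      using d by (intro DERIV_divide DERIV_const) (auto intro!: derivative_eq_intros simp: d_def simp del: power_Suc)
    also have "(0 * (w - 1) ^ Suc k - C * (of_nat (Suc k) * (w - 1) ^ k)) / ((w - 1) ^ Suc k * (w - 1) ^ Suc k)
        = - (C * of_nat (Suc k)) / (w - 1) ^ Suc (Suc k)"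
      using d unfolding d_def[symmetric] by (simp add: divide_simps)
    also have "- (C * of_nat (Suc k)) = l * (-1) ^ Suc k * fact (Suc k)"
      by (simp add: C_def algebra_simps)
    finally show "((\<lambda>w. l * (-1) ^ k * fact k / (w - 1) ^ Suc k) has_field_derivative
          l * (-1) ^ Suc k * fact (Suc k) / (w - 1) ^ Suc (Suc k)) (at w)"
      unfolding C_def .
  qed
  finally show ?case .
qed auto

text \<open>The Dirichlet series is \<open>Q s / (s - 1)\<close>. Its Taylor coefficients at \<open>2\<close>, in powers of \<open>2 - s\<close>, are
  \<open>\<Sum>n. a n * n\<^sup>-\<^sup>2 * (ln n)\<^sup>k / k!\<close>, those of the polar part \<open>\<lambda> / (s - 1)\<close> are all equal to \<open>\<lambda>\<close>.\<close>

locale nonneg_dirichlet =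
  fixes Q :: "complex \<Rightarrow> complex" and a :: "nat \<Rightarrow> real" and l :: real
  assumes holo: "Q holomorphic_on ball 2 2"
    and Q1: "Q 1 = of_real l"
    and nonneg: "\<And>n. n > 0 \<Longrightarrow> a n \<ge> 0"
    and series: "\<And>s. Re s > 1 \<Longrightarrow> ((\<lambda>n. of_real (a n) * npow n s) has_sum Q s / (s - 1)) {1..}"
begin

text \<open>The Dirichlet series minus its polar part. With the removable singularity at 1 filled
  in, the Taylor series at 2 converges on all of \<open>ball 2 2\<close>, so also to the left of 1,
  where the Dirichlet series itself is not known to converge.\<close>

definition reg :: "complex \<Rightarrow> complex" where
  "reg z = (if z = 1 then deriv Q 1 else (Q z - Q 1) / (z - 1))"

text \<open>The sign makes these the coefficients in powers of 2 - x, which are positive for x < 2;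
  lower bounds on coefficients then become lower bounds on values.\<close>

definition coef :: "nat \<Rightarrow> complex" where
  "coef k = (-1) ^ k * (deriv ^^ k) reg 2 / fact k"

lemma reg_holo: "reg holomorphic_on ball 2 2"
  unfolding reg_def by (rule pole_lemma[OF holo]) (auto simp: dist_norm interior_open)

lemma reg_sums:
  assumes "0 < x" "x < 4"
  shows "(\<lambda>k. coef k * of_real ((2 - x) ^ k)) sums reg (of_real x)"
proof -
  have "norm (2 - complex_of_real x) = \<bar>2 - x\<bar>"
    by (metis norm_of_real of_real_diff of_real_numeral)
  then have "(\<lambda>k. (deriv ^^ k) reg 2 / fact k * (of_real x - 2) ^ k) sums reg (of_real x)"
    using assms by (intro holomorphic_power_series[OF reg_holo]) (auto simp: dist_norm)
  moreover have "(deriv ^^ k) reg 2 / fact k * (of_real x - 2) ^ k = coef k * of_real ((2 - x) ^ k)" for k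
  proof -
    have "(of_real x - 2 :: complex) ^ k = ((-1) * of_real (2 - x)) ^ k" by simp
    also have "\<dots> = (-1) ^ k * of_real ((2 - x) ^ k)" by (simp only: power_mult_distrib of_real_power)
    finally show ?thesis by (simp add: coef_def)
  qed
  ultimately show ?thesis by simp
qed

text \<open>Justifies termwise differentiation at 2. On this disc Re s >= 3/2, and since the
  coefficients are nonnegative the convergent series at 3/2 is a majorant.\<close>

lemma uniform_partial_sums:
  "uniform_limit (ball 2 (1/2)) (\<lambda>N s. \<Sum>n\<in>{1..N}. of_real (a n) * npow n s) (\<lambda>s. Q s / (s - 1)) sequentially"
proof -
  have lim: "(\<lambda>n. of_real (a (Suc n)) * npow (Suc n) s) sums (Q s / (s - 1))" if "Re s > 1" for s
  proof -
    have "((\<lambda>n. of_real (a n) * npow n s) has_sum Q s / (s - 1)) {1..} \<longleftrightarrow>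
          ((\<lambda>n. of_real (a (Suc n)) * npow (Suc n) s) has_sum Q s / (s - 1)) UNIV"
      by (rule has_sum_reindex_bij_witness[where i = Suc and j = "\<lambda>n. n - 1"]) auto
    then show ?thesis using series[OF that] has_sum_imp_sums by blast
  qed
  have "summable (\<lambda>n. norm (of_real (a (Suc n)) * npow (Suc n) (of_real (3/2))))"
  proof -
    have "(\<lambda>n. of_real (a (Suc n) * real (Suc n) powr (- (3/2)))) sums (Q (of_real (3/2)) / (of_real (3/2) - 1))"
      using lim[of "of_real (3/2)"] by (simp add: npow_of_real del: of_nat_Suc of_real_divide)
    then have "summable (\<lambda>n. complex_of_real (a (Suc n) * real (Suc n) powr (- (3/2))))"
      by (rule sums_summable)
    then have "summable (\<lambda>n. a (Suc n) * real (Suc n) powr (- (3/2)))"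
      by (simp only: summable_of_real_iff)
    then show ?thesis
      using nonneg by (simp add: norm_mult norm_npow del: of_nat_Suc of_real_divide)
  qed
  then have "uniform_limit (ball 2 (1/2)) (\<lambda>N s. \<Sum>n<N. of_real (a (Suc n)) * npow (Suc n) s)
      (\<lambda>s. \<Sum>n. of_real (a (Suc n)) * npow (Suc n) s) sequentially"
  proof (rule Weierstrass_m_test[rotated])
    fix n and s :: complex assume "s \<in> ball 2 (1/2)"
    then have "Re s \<ge> 3/2" using abs_Re_le_cmod[of "2 - s"] by (auto simp: dist_norm)
    then show "norm (of_real (a (Suc n)) * npow (Suc n) s) \<le> norm (of_real (a (Suc n)) * npow (Suc n) (of_real (3/2)))"
      by (auto simp: norm_mult norm_npow simp del: of_nat_Suc of_real_divide intro!: mult_left_mono powr_mono)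
  qed
  then show ?thesis
  proof (subst uniform_limit_cong'[where g = "\<lambda>N s. \<Sum>n<N. of_real (a (Suc n)) * npow (Suc n) s"
        and i = "\<lambda>s. \<Sum>n. of_real (a (Suc n)) * npow (Suc n) s"], goal_cases)
    case (1 N s)
    then show ?case by (simp add: sum.atLeast1_atMost_eq)
  next
    case (2 s)
    then have "Re s > 1" using abs_Re_le_cmod[of "2 - s"] by (auto simp: dist_norm)
    then show ?case using lim sums_unique by blast
  qed auto
qed

text \<open>Differentiating termwise, the k-th coefficient of the Dirichlet series is an infinite
  sum of nonnegative terms, of which every partial sum is a lower bound; the polar part subtracts l.
  The uses with N = 0 and N = 1 give -l and, for k = 0, 1 - l.\<close>

lemma coef_lower: "Re (coef k) \<ge> (\<Sum>n=1..N. a n * ln (real n) ^ k * real n powr - 2) / fact k - l"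
proof -
  let ?f = "\<lambda>s. Q s / (s - 1)"
  let ?F = "\<lambda>N. \<Sum>n=1..N. a n * ln (real n) ^ k * real n powr - 2"
  have sub: "ball 2 (1/2) \<subseteq> ball (2::complex) 2" by auto
  have ne: "s \<noteq> 1" if "s \<in> ball 2 (1/2)" for s :: complex
    using that by (auto simp: dist_norm)
  have A: "(\<lambda>N. (deriv ^^ k) (\<lambda>s. \<Sum>n\<in>{1..N}. of_real (a n) * npow n s) 2) \<longlonglongrightarrow> (deriv ^^ k) ?f 2"
    by (rule higher_deriv_complex_uniform_limit[OF uniform_partial_sums])
       (auto simp: npow_def intro!: always_eventually holomorphic_intros)
  have B: "(-1) ^ k * (deriv ^^ k) (\<lambda>s. \<Sum>n\<in>{1..N}. of_real (a n) * npow n s) 2 = of_real (?F N)" for N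
  proof -
    have "(-1) ^ k * (deriv ^^ k) (\<lambda>s. \<Sum>n\<in>{1..N}. of_real (a n) * npow n s) 2
       = (\<Sum>n=1..N. (-1) ^ k * (of_real (a n * (- ln (real n)) ^ k) * npow n (of_real 2)))"
      by (simp only: higher_deriv_dirichlet_polynomial sum_distrib_left of_real_numeral)
    also have "\<dots> = (\<Sum>n=1..N. of_real (a n * ln (real n) ^ k * real n powr - 2))"
    proof (rule sum.cong)
      fix n assume "n \<in> {1..N}"
      have "(-1) ^ k * (- ln (real n)) ^ k = ln (real n) ^ k" by (simp flip: power_mult_distrib)
      then have "of_real ((-1) ^ k) * complex_of_real (a n * (- ln (real n)) ^ k) = of_real (a n * ln (real n) ^ k)"
        by (simp only: flip: of_real_mult) (simp add: mult_ac)
      then show "(-1) ^ k * (of_real (a n * (- ln (real n)) ^ k) * npow n (of_real 2))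
          = of_real (a n * ln (real n) ^ k * real n powr - 2)"
        using \<open>n \<in> {1..N}\<close> by (simp add: npow_of_real del: of_real_numeral flip: mult.assoc)
    qed auto
    finally show ?thesis by simp
  qed
  have "(\<lambda>N. of_real (?F N)) \<longlonglongrightarrow> (-1) ^ k * (deriv ^^ k) ?f 2"
    using tendsto_mult_left[OF A, of "(-1) ^ k"] unfolding B .
  from tendsto_Re[OF this] have lim: "?F \<longlonglongrightarrow> Re ((-1) ^ k * (deriv ^^ k) ?f 2)"
    unfolding Re_complex_of_real .
  have "incseq ?F"
    by (intro incseq_SucI) (auto intro!: add_increasing2 mult_nonneg_nonneg nonneg)
  then have F: "?F N \<le> Re ((-1) ^ k * (deriv ^^ k) ?f 2)"
    using lim by (rule incseq_le)
  have f_holo: "?f holomorphic_on ball 2 (1/2)"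
    using ne by (intro holomorphic_intros holomorphic_on_subset[OF holo sub]) auto
  have l_holo: "(\<lambda>s. of_real l / (s - 1)) holomorphic_on ball 2 (1/2)"
    using ne by (intro holomorphic_intros) auto
  have "(deriv ^^ k) reg 2 = (deriv ^^ k) (\<lambda>s. ?f s - of_real l / (s - 1)) 2"
  proof (rule higher_deriv_transform_within_open)
    show "reg holomorphic_on ball 2 (1/2)" by (rule holomorphic_on_subset[OF reg_holo sub])
    show "(\<lambda>s. ?f s - of_real l / (s - 1)) holomorphic_on ball 2 (1/2)"
      by (intro holomorphic_on_diff f_holo l_holo)
    show "reg s = ?f s - of_real l / (s - 1)" if "s \<in> ball 2 (1/2)" for s
      using ne[OF that] by (simp add: reg_def Q1 diff_divide_distrib)
  qed auto
  also have "\<dots> = (deriv ^^ k) ?f 2 - (deriv ^^ k) (\<lambda>s. of_real l / (s - 1)) 2"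
    by (rule higher_deriv_diff[OF f_holo l_holo]) auto
  also have "\<dots> = (deriv ^^ k) ?f 2 - of_real l * (-1) ^ k * fact k"
    by (subst higher_deriv_inverse_shift) auto
  finally have "coef k = (-1) ^ k * (deriv ^^ k) ?f 2 / fact k - of_real l"
  proof -
    assume *: "(deriv ^^ k) reg 2 = (deriv ^^ k) ?f 2 - of_real l * (-1) ^ k * fact k"
    have "(-1) ^ k * (of_real l * (-1) ^ k * fact k) = ((-1) ^ k * (-1) ^ k) * of_real l * (fact k :: complex)"
      by (simp only: mult_ac)
    also have "(-1) ^ k * (-1) ^ k = (1::complex)" by (simp flip: power_mult_distrib)
    finally show ?thesis unfolding coef_def * right_diff_distrib diff_divide_distrib by simp
  qed
  then have "Re (coef k) = Re ((-1) ^ k * (deriv ^^ k) ?f 2) / fact k - l"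
    using Re_divide_of_real[of _ "fact k"] by simp
  then show ?thesis using F by (simp add: divide_right_mono)
qed

lemma Re_reg:
  assumes "x \<noteq> 1"
  shows "Re (reg (of_real x)) = (Re (Q (of_real x)) - l) / (x - 1)"
proof -
  have "reg (of_real x) = (Q (of_real x) - of_real l) / of_real (x - 1)"
    using assms by (simp add: reg_def Q1)
  then show ?thesis by (simp only: Re_divide_of_real) simp
qed

lemma Re_reg_sums:
  assumes "0 < x" "x < 4"
  shows "(\<lambda>k. Re (coef k) * (2 - x) ^ k) sums Re (reg (of_real x))"
  using sums_Re[OF reg_sums[OF assms]] by simp

text \<open>Landau's argument. With l = 0 there is no pole, so the Taylor series at 2 represents
  Q(s)/(s - 1) down to x. Expanding n^(2-x) as an exponential series in (2 - x) ln n allows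
  comparison with that Taylor series coefficient by coefficient.\<close>

lemma partial_sum_le:
  assumes "l = 0" "0 < x" "x < 1"
  shows "(\<Sum>n=1..N. a n * real n powr - x) \<le> Re (Q (of_real x)) / (x - 1)"
proof -
  have "(\<lambda>k. a n * real n powr - 2 * ((2 - x) * ln (real n)) ^ k / fact k) sums (a n * real n powr - x)"
    if "n \<in> {1..N}" for n
  proof -
    have "(\<lambda>k. (a n * real n powr - 2) * (((2 - x) * ln (real n)) ^ k /\<^sub>R fact k)) sums
        ((a n * real n powr - 2) * exp ((2 - x) * ln (real n)))"
      by (intro sums_mult exp_converges)
    also have "exp ((2 - x) * ln (real n)) = real n powr (2 - x)" using that by (simp add: powr_def)
    also have "a n * real n powr - 2 * real n powr (2 - x) = a n * real n powr - x"
      by (simp flip: powr_add)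
    finally show ?thesis by (simp add: field_simps)
  qed
  then have "(\<lambda>k. \<Sum>n=1..N. a n * real n powr - 2 * ((2 - x) * ln (real n)) ^ k / fact k) sums (\<Sum>n=1..N. a n * real n powr - x)"
    by (rule sums_sum)
  moreover have "(\<Sum>n=1..N. a n * real n powr - 2 * ((2 - x) * ln (real n)) ^ k / fact k) \<le> Re (coef k) * (2 - x) ^ k" for k
  proof -
    have "(\<Sum>n=1..N. a n * real n powr - 2 * ((2 - x) * ln (real n)) ^ k / fact k)
        = ((\<Sum>n=1..N. a n * ln (real n) ^ k * real n powr - 2) / fact k) * (2 - x) ^ k"
      unfolding sum_divide_distrib sum_distrib_right by (rule sum.cong) (simp_all add: power_mult_distrib)
    also have "\<dots> \<le> Re (coef k) * (2 - x) ^ k"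
      using coef_lower[where k = k and N = N] assms by (intro mult_right_mono) auto
    finally show ?thesis .
  qed
  ultimately have "(\<Sum>n=1..N. a n * real n powr - x) \<le> Re (reg (of_real x))"
    using assms by (intro sums_le[OF _ _ Re_reg_sums]) auto
  then show ?thesis using assms by (simp add: Re_reg)
qed

text \<open>Cauchy's inequality on the circle of radius 3/2 about 2. That circle keeps distance 1/2
  from the point 1, so |reg| <= 2B / (1/2) = 4B on it.\<close>

lemma coef_upper:
  assumes "\<And>z. norm (z - 2) = 3/2 \<Longrightarrow> norm (Q z) \<le> B" "l \<le> B" "- l \<le> B"
  shows "norm (coef k) \<le> 4 * B * (2/3) ^ k"
proof -
  have "norm ((deriv ^^ k) reg 2) \<le> fact k * (4 * B) / (3/2) ^ k"
  proof (rule Cauchy_inequality)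
    show "reg holomorphic_on ball 2 (3/2)" by (rule holomorphic_on_subset[OF reg_holo]) auto
    have "reg holomorphic_on cball 2 (3/2)" by (rule holomorphic_on_subset[OF reg_holo]) auto
    then show "continuous_on (cball 2 (3/2)) reg" by (rule holomorphic_on_imp_continuous_on)
    fix z :: complex assume z: "norm (2 - z) = 3/2"
    have "norm (z - 1) \<ge> 1/2"
    proof -
      have eq: "1 - (z - 1) = 2 - z" by simp
      show ?thesis using norm_triangle_ineq4[of 1 "z - 1"] unfolding eq z by simp
    qed
    then have "z \<noteq> 1" "norm (z - 1) \<ge> 1/2" by auto
    have "B \<ge> 0" using assms by linarith
    have "norm (Q z - Q 1) \<le> B + B"
      using assms z by (intro norm_triangle_le_diff add_mono) (auto simp: Q1 norm_minus_commute)
    then have "norm (Q z - Q 1) / norm (z - 1) \<le> (B + B) / (1/2)"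
      using \<open>norm (z - 1) \<ge> 1/2\<close> \<open>B \<ge> 0\<close> by (intro frac_le) auto
    then show "norm (reg z) \<le> 4 * B"
      using \<open>z \<noteq> 1\<close> by (simp add: reg_def norm_divide)
  qed auto
  then have "norm ((deriv ^^ k) reg 2) / fact k \<le> (fact k * (4 * B) / (3/2) ^ k) / fact k"
    by (intro divide_right_mono) auto
  then show ?thesis
    by (simp add: coef_def norm_mult norm_divide norm_power power_divide field_simps)
qed

text \<open>Estermann's argument: Q(x) >= 0 bounds the regular part at x from above by l / (1 - x).
  From below its Taylor series is at least 1 minus l times a geometric sum of K terms, up to a small
  tail. A small residue l would make the two contradictory.\<close>

theorem residue_lower_bound:
  assumes a1: "a 1 = 1"
    and bound: "\<And>z. norm (z - 2) = 3/2 \<Longrightarrow> norm (Q z) \<le> B" "l \<le> B" "- l \<le> B" "B \<ge> 1"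
    and x: "3/4 \<le> x" "x < 1" and sign: "Re (Q (of_real x)) \<ge> 0"
  shows "l \<ge> (1 - x) / 6 * (48 * B) powr (- 6 * (1 - x))"
proof -
  \<comment> \<open>As 5/6 <= exp(-1/6), this length gives (5/6)^K <= 1/(48 B), so the tail 24 B
    (5/6)^K is at most 1/2, half of the leading coefficient 1.\<close>
  define K where "K = nat \<lceil>6 * ln (48 * B)\<rceil>"
  define y where "y = 2 - x"
  have y: "1 < y" "y \<le> 5/4" "y > 0" using x by (auto simp: y_def)
  have lnB: "ln (48 * B) > 0" using bound by (intro ln_gt_zero) auto
  have K: "6 * ln (48 * B) \<le> real K" "real K \<le> 6 * ln (48 * B) + 1" "K > 0"
    using lnB unfolding K_def by linarith+
  have "(5/6 :: real) \<le> exp (- (1/6))"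
    using exp_ge_add_one_self[of "- (1/6)"] by simp
  then have "(5/6 :: real) ^ K \<le> exp (- (1/6)) ^ K" by (intro power_mono) auto
  also have "\<dots> = exp (- (real K / 6))" by (simp flip: exp_of_nat_mult)
  also have "\<dots> \<le> exp (- ln (48 * B))" using K by simp
  also have "\<dots> = 1 / (48 * B)" using bound by (simp add: exp_minus field_simps)
  finally have tail: "24 * B * (5/6) ^ K \<le> 1/2" using bound by (simp add: field_simps)

  have lower0: "Re (coef 0) \<ge> 1 - l" using coef_lower[where N = 1 and k = 0] a1 by simp
  have lower: "Re (coef k) \<ge> - l" for k using coef_lower[where N = 0 and k = k] by simp
  \<comment> \<open>Coefficients are at most 4B (2/3)^k and y <= 5/4 because x >= 3/4, so the tail
    is dominated by a geometric series of ratio 2/3 * 5/4 = 5/6; 24 is 4 / (1 - 5/6).\<close>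
  have "Re (reg (of_real x)) \<ge> (\<Sum>k<K. Re (coef k) * y ^ k) - 24 * B * (5/6) ^ K"
  proof -
    have sm: "(\<lambda>k. Re (coef (k + K)) * y ^ (k + K)) sums (Re (reg (of_real x)) - (\<Sum>k<K. Re (coef k) * y ^ k))"
      using Re_reg_sums[of x] x unfolding y_def by (intro sums_split_initial_segment) auto
    have geo: "(\<lambda>k. - (4 * B * (5/6) ^ K) * (5/6) ^ k) sums (- (4 * B * (5/6) ^ K) * (1 / (1 - 5/6)))"
      by (intro sums_mult geometric_sums) auto
    have le: "- (4 * B * (5/6) ^ K) * (5/6) ^ k \<le> Re (coef (k + K)) * y ^ (k + K)" for k
    proof -
      have "\<bar>Re (coef (k + K)) * y ^ (k + K)\<bar> \<le> (4 * B * (2/3) ^ (k + K)) * (5/4) ^ (k + K)"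
      proof -
        have "norm (coef (k + K)) \<le> 4 * B * (2/3) ^ (k + K)"
          by (rule coef_upper[OF bound(1-3)])
        then have c: "\<bar>Re (coef (k + K))\<bar> \<le> 4 * B * (2/3) ^ (k + K)"
          using abs_Re_le_cmod[of "coef (k + K)"] by linarith
        have p: "\<bar>y ^ (k + K)\<bar> \<le> (5/4) ^ (k + K)"
          unfolding power_abs using y by (intro power_mono) auto
        have "0 \<le> 4 * B * (2/3) ^ (k + K)" using bound(4) by simp
        then show ?thesis unfolding abs_mult by (rule mult_mono[OF c p _ abs_ge_zero])
      qed
      also have "\<dots> = 4 * B * (2/3 * (5/4)) ^ (k + K)" by (simp only: power_mult_distrib mult.assoc)
      also have "\<dots> = (4 * B * (5/6) ^ K) * (5/6) ^ k" by (simp add: power_add)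
      finally have "- (Re (coef (k + K)) * y ^ (k + K)) \<le> (4 * B * (5/6) ^ K) * (5/6) ^ k"
        by (rule abs_le_D2)
      then show ?thesis unfolding mult_minus_left by (subst minus_le_iff)
    qed
    have "- (4 * B * (5/6) ^ K) * (1 / (1 - 5/6)) \<le> Re (reg (of_real x)) - (\<Sum>k<K. Re (coef k) * y ^ k)"
      by (rule sums_le[OF le geo sm])
    then show ?thesis by simp
  qed
  moreover have "(\<Sum>k<K. Re (coef k) * y ^ k) \<ge> 1 - l * ((y ^ K - 1) / (y - 1))"
  proof -
    have "(\<Sum>k<K. Re (coef k) * y ^ k) \<ge> (\<Sum>k<K. (if k = 0 then 1 else 0) - l * y ^ k)"
    proof (intro sum_mono)
      fix k
      show "(if k = 0 then 1 else 0) - l * y ^ k \<le> Re (coef k) * y ^ k"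
        using lower0 mult_right_mono[OF lower[of k], of "y ^ k"] y by auto
    qed
    also have "(\<Sum>k<K. (if k = 0 then 1 else 0) - l * y ^ k) = 1 - l * (\<Sum>k<K. y ^ k)"
      using K by (simp add: sum_subtractf sum_distrib_left)
    also have "(\<Sum>k<K. y ^ k) = (y ^ K - 1) / (y - 1)"
      using y by (intro geometric_sum) auto
    finally show ?thesis .
  qed
  \<comment> \<open>The only use of the sign hypothesis: reg(x) = (Q(x) - l) / (x - 1) with x <
    1.\<close>
  moreover have "Re (reg (of_real x)) \<le> l / (1 - x)"
  proof -
    have "Re (reg (of_real x)) = l / (1 - x) - Re (Q (of_real x)) / (1 - x)"
      using x by (simp add: Re_reg divide_simps) (simp add: algebra_simps)
    then show ?thesis using sign x by simp
  qed
  ultimately have "1/2 \<le> l / (1 - x) + l * ((y ^ K - 1) / (y - 1))"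
    using tail by linarith
  also have "y - 1 = 1 - x" by (simp add: y_def)
  also have "l / (1 - x) + l * ((y ^ K - 1) / (1 - x)) = l * y ^ K / (1 - x)"
    by (simp add: right_diff_distrib flip: add_divide_distrib)
  finally have main: "(1 - x) / 2 \<le> l * y ^ K"
    using x by (simp add: field_simps)
  have "y ^ K \<le> exp (1 - x) ^ K"
    using exp_ge_add_one_self[of "1 - x"] y by (intro power_mono) (auto simp: y_def)
  also have "\<dots> = exp (real K * (1 - x))" by (simp flip: exp_of_nat_mult)
  also have "\<dots> \<le> exp (6 * (1 - x) * ln (48 * B) + 1)"
  proof -
    have "real K * (1 - x) \<le> (6 * ln (48 * B) + 1) * (1 - x)"
      using K x by (intro mult_right_mono) auto
    then show ?thesis using x by (simp add: algebra_simps)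
  qed
  also have "\<dots> = (48 * B) powr (6 * (1 - x)) * exp 1"
    using bound by (simp add: powr_def exp_add)
  \<comment> \<open>The excess exp 1 stems from rounding K up; bounding it by 3 turns the 1/2 above
    into the 1/6 of the claim.\<close>
  also have "\<dots> \<le> (48 * B) powr (6 * (1 - x)) * 3"
    using exp_le by (intro mult_left_mono) auto
  finally have yK: "y ^ K \<le> (48 * B) powr (6 * (1 - x)) * 3" .
  have "l > 0" using main x y by (metis diff_gt_0_iff_gt half_gt_zero less_le_trans zero_less_mult_pos2 zero_less_power)
  then have le: "(1 - x) / 2 \<le> l * ((48 * B) powr (6 * (1 - x)) * 3)"
    using main mult_left_mono[OF yK, of l] by linarith
  have "- 6 * (1 - x) = - (6 * (1 - x))" by simp
  then have "(48 * B) powr (- 6 * (1 - x)) = 1 / (48 * B) powr (6 * (1 - x))"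
    by (simp only: powr_minus_divide)
  moreover have "(48 * B) powr (6 * (1 - x)) > 0" using bound by simp
  ultimately show ?thesis
    using le by (simp add: pos_divide_le_eq)
qed

end

section \<open>The zeta function near 1\<close>


definition alt :: "nat \<Rightarrow> complex" where
  "alt n = (if odd n then 1 else -1)"

text \<open>\<open>zpole s = (1 - 2\<^sup>1\<^sup>-\<^sup>s) / (s - 1)\<close>, so that \<open>zreg s = (s - 1) \<zeta>(s)\<close>, as the alternating zeta
  function \<^term>\<open>Lfun alt\<close> is \<open>(1 - 2\<^sup>1\<^sup>-\<^sup>s) \<zeta>(s)\<close>.\<close>

definition zpole :: "complex \<Rightarrow> complex" where
  "zpole s = (if s = 1 then of_real (ln 2) else (1 - exp ((1 - s) * of_real (ln 2))) / (s - 1))"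

definition zreg :: "complex \<Rightarrow> complex" where
  "zreg s = Lfun alt s / zpole s"

lemma partial_alt: "partial alt n = (if odd n then 1 else 0)"
  by (induction n) (auto simp: partial_Suc alt_def)

lemma bounded_partials_alt: "bounded_partials 1 alt"
  by (simp add: bounded_partials_def partial_alt)

lemma zpole_holo: "zpole holomorphic_on UNIV"
proof -
  let ?f = "\<lambda>s. 1 - exp ((1 - s) * of_real (ln 2)) :: complex"
  have d: "deriv ?f 1 = of_real (ln 2)"
    by (rule DERIV_imp_deriv) (auto intro!: derivative_eq_intros)
  have "(\<lambda>z. if z = 1 then deriv ?f 1 else (?f z - ?f 1) / (z - 1)) holomorphic_on UNIV"
    by (rule pole_lemma) (auto intro!: holomorphic_intros)
  also have "(\<lambda>z. if z = 1 then deriv ?f 1 else (?f z - ?f 1) / (z - 1)) = zpole"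
    by (auto simp: zpole_def d fun_eq_iff)
  finally show ?thesis .
qed

text \<open>The zeros of 1 - 2^(1-s) are 1 + 2 pi i n / ln 2. The one with n = 0 is cancelled by s -
  1, and the others have |Im s| > 2 because 2 pi > 2 ln 2, hence lie outside this disc.\<close>

lemma zpole_nonzero:
  assumes "s \<in> ball 2 2"
  shows "zpole s \<noteq> 0"
proof (cases "s = 1")
  case False
  show ?thesis
  proof
    assume "zpole s = 0"
    then have "exp ((1 - s) * of_real (ln 2)) = 1" using False by (simp add: zpole_def)
    then obtain n :: int where n: "Re ((1 - s) * of_real (ln 2)) = 0" "Im ((1 - s) * of_real (ln 2)) = of_int (2 * n) * pi"
      unfolding exp_eq_1 by blast
    have "\<bar>Im s\<bar> < 2" using assms abs_Im_le_cmod[of "2 - s"] by (auto simp: dist_norm)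
    moreover have l: "0 < ln (2::real)" "ln (2::real) \<le> 1" using ln_le_minus_one[of "2::real"] by auto
    ultimately have "\<bar>Im s\<bar> * ln 2 < 2 * 1" by (intro mult_less_le_imp_less) auto
    moreover have "\<bar>Im s\<bar> * ln 2 = \<bar>of_int n\<bar> * (2 * pi)"
    proof -
      have e: "- (Im s * ln 2) = of_int (2 * n) * pi" using n(2) by simp
      have "\<bar>Im s\<bar> * ln 2 = \<bar>- (Im s * ln 2)\<bar>" using l by (simp add: abs_mult)
      also have "\<dots> = \<bar>of_int n\<bar> * (2 * pi)" unfolding e by (simp add: abs_mult)
      finally show ?thesis .
    qed
    ultimately have "\<bar>of_int n\<bar> * (2 * pi) < 2 * 1" by (simp only:)
    moreover have "\<bar>of_int n :: real\<bar> * 2 \<le> \<bar>of_int n\<bar> * (2 * pi)"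
      using pi_gt3 by (intro mult_left_mono) auto
    ultimately have "\<bar>of_int n :: real\<bar> < 1" by linarith
    then have "n = 0" by linarith
    then have "Im s = 0" "Re s = 1" using n l by auto
    then show False using False by (simp add: complex_eq_iff)
  qed
qed (auto simp: zpole_def)

lemma zreg_holo: "zreg holomorphic_on ball 2 2"
proof -
  have "ball 2 2 \<subseteq> {s. Re s > 0}"
  proof
    fix s :: complex assume "s \<in> ball 2 2"
    then show "s \<in> {s. Re s > 0}"
      using abs_Re_le_cmod[of "2 - s"] by (auto simp: dist_norm)
  qed
  then have "Lfun alt holomorphic_on ball 2 2"
    using Lfun_holomorphic[OF bounded_partials_alt] holomorphic_on_subset by blast
  then show ?thesis unfolding zreg_def[abs_def]
    by (intro holomorphic_on_divide holomorphic_on_subset[OF zpole_holo] zpole_nonzero) auto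
qed

lemma zreg_bound:
  obtains Z where "Z \<ge> 1" "\<And>s. s \<in> cball 2 (3/2) \<Longrightarrow> norm (zreg s) \<le> Z"
proof -
  have "zreg holomorphic_on cball 2 (3/2)" by (rule holomorphic_on_subset[OF zreg_holo]) auto
  then have "compact (zreg ` cball 2 (3/2))"
    by (intro compact_continuous_image holomorphic_on_imp_continuous_on compact_cball)
  then have "bounded (zreg ` cball 2 (3/2))" by (rule compact_imp_bounded)
  then obtain B where "\<forall>y\<in>zreg ` cball 2 (3/2). norm y \<le> B" unfolding bounded_iff ..
  then have B: "\<And>s. s \<in> cball 2 (3/2) \<Longrightarrow> norm (zreg s) \<le> B" by (rule bspec) (rule imageI)
  show ?thesis
  proof (rule that)
    show "norm (zreg s) \<le> max 1 B" if "s \<in> cball 2 (3/2)" for s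
      using B[OF that] by simp
  qed simp
qed

text \<open>The terms -2 * 2^(-s) n^(-s) are -2 times the powers of the even integers; added to the
  zeta series they give the alternating one. Then 1 - 2^(1-s), nonzero as its exponential has
  modulus below 1, is divided out.\<close>

lemma zeta_series:
  assumes "Re s > 1"
  shows "((\<lambda>n. 1 * npow n s) has_sum zreg s / (s - 1)) {1..}"
proof -
  define z where "z = infsum (\<lambda>n. 1 * npow n s) {1..}"
  have z: "((\<lambda>n. 1 * npow n s) has_sum z) {1..}"
    unfolding z_def using npow_dirichlet_summable[of "\<lambda>_. 1" s] assms by (intro has_sum_infsum) auto
  have "((\<lambda>n. -2 * npow 2 s * (1 * npow n s)) has_sum -2 * npow 2 s * z) {1..}"
    by (intro has_sum_cmult_right z)
  also have "?this \<longleftrightarrow> ((\<lambda>n. -2 * npow n s) has_sum -2 * npow 2 s * z) {n\<in>{1..}. even n}"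
    by (rule has_sum_reindex_bij_witness[where i = "\<lambda>n. n div 2" and j = "\<lambda>n. 2 * n"])
       (auto simp: npow_mult)
  also have "\<dots> \<longleftrightarrow> ((\<lambda>n. if even n then -2 * npow n s else 0) has_sum -2 * npow 2 s * z) {1..}"
    by (rule has_sum_cong_neutral) auto
  finally have "((\<lambda>n. 1 * npow n s + (if even n then -2 * npow n s else 0)) has_sum (z + -2 * npow 2 s * z)) {1..}"
    by (intro has_sum_add z)
  also have "?this \<longleftrightarrow> ((\<lambda>n. alt n * npow n s) has_sum (z + -2 * npow 2 s * z)) {1..}"
    by (rule has_sum_cong) (auto simp: alt_def)
  finally have "((\<lambda>n. alt n * npow n s) has_sum (z + -2 * npow 2 s * z)) {1..}" .
  moreover have "((\<lambda>n. alt n * npow n s) has_sum Lfun alt s) {1..}"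
    using assms by (intro Lfun_has_sum[OF bounded_partials_alt]) (auto simp: alt_def)
  ultimately have z': "z + -2 * npow 2 s * z = Lfun alt s" by (rule has_sum_unique)
  have n2: "2 * npow 2 s = exp ((1 - s) * of_real (ln 2))"
  proof -
    have "exp (of_real (ln 2)) = (2::complex)" by (simp only: exp_of_real) simp
    then have "2 * npow 2 s = exp (of_real (ln 2)) * exp (- (s * of_real (ln 2)))"
      by (simp add: npow_def)
    also have "\<dots> = exp ((1 - s) * of_real (ln 2))"
      unfolding exp_add[symmetric] by (simp add: left_diff_distrib)
    finally show ?thesis .
  qed
  have "s \<noteq> 1" using assms by auto
  have "Lfun alt s = z * (1 - 2 * npow 2 s)" unfolding z'[symmetric] by (simp add: right_diff_distrib)
  also have "1 - 2 * npow 2 s = zpole s * (s - 1)"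
    unfolding n2 using \<open>s \<noteq> 1\<close> by (simp add: zpole_def)
  finally have L: "Lfun alt s = z * (zpole s * (s - 1))" .
  have "norm (exp ((1 - s) * of_real (ln 2))) < 1"
    using assms by (simp add: mult_less_0_iff)
  then have "exp ((1 - s) * of_real (ln 2)) \<noteq> 1" by (intro notI) (simp only: norm_one less_irrefl)
  then have "zpole s \<noteq> 0" using \<open>s \<noteq> 1\<close> by (simp add: zpole_def)
  then have "z = zreg s / (s - 1)" using L \<open>s \<noteq> 1\<close> by (simp add: zreg_def)
  then show ?thesis using z by simp
qed

text \<open>The partial sums of \<open>alt\<close> are 0 or 1, so \<open>Lfun alt x\<close> is a
  series of nonnegative terms with positive first term; in \<open>zpole x\<close>, the numerator 1 -
  2^(1-x) and x - 1 have the same sign. Hence on the positive axis the sign of zreg times L-values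
  is decided by the L-values.\<close>

lemma zreg_real:
  assumes "x > 0"
  obtains y where "y > 0" "zreg (of_real x) = of_real y"
proof -
  have L: "Lfun alt (of_real x) \<in> \<real>"
    using Lfun_cnj[OF bounded_partials_alt, of "of_real x"] assms
    by (simp add: Reals_cnj_iff alt_def[abs_def] if_distrib cong: if_cong)
  then obtain r where r: "Lfun alt (of_real x) = of_real r" by (auto simp: Reals_def)
  have "r > 0"
  proof -
    have sums: "(\<lambda>n. Re (partial alt (Suc n) * (npow (Suc n) (of_real x) - npow (Suc (Suc n)) (of_real x)))) sums r"
      using sums_Re[OF Lfun_sums[OF bounded_partials_alt, of "of_real x"]] assms r by simp
    have t: "Re (partial alt (Suc n) * (npow (Suc n) (of_real x) - npow (Suc (Suc n)) (of_real x)))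
       = (if even n then real (Suc n) powr - x - real (Suc (Suc n)) powr - x else 0)" for n
      by (simp add: partial_alt npow_of_real flip: of_real_diff del: of_nat_Suc)
    have mono: "real (Suc (Suc n)) powr - x < real (Suc n) powr - x" for n
      using assms by (intro powr_less_mono2_neg) auto
    have "0 < (\<Sum>n. if even n then real (Suc n) powr - x - real (Suc (Suc n)) powr - x else 0)"
    proof (rule suminf_pos2[where i = 0])
      show "summable (\<lambda>n. if even n then real (Suc n) powr - x - real (Suc (Suc n)) powr - x else 0)"
        by (rule sums_summable[OF sums[unfolded t]])
      show "0 \<le> (if even n then real (Suc n) powr - x - real (Suc (Suc n)) powr - x else 0)" for n
        using less_imp_le[OF mono[of n]] by (simp del: of_nat_Suc)
      show "0 < (if even (0::nat) then real (Suc 0) powr - x - real (Suc (Suc 0)) powr - x else 0)"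
        using mono[of 0] by (simp del: of_nat_Suc)
    qed
    then show ?thesis unfolding sums_unique[OF sums[unfolded t], symmetric] .
  qed
  define k where "k = (if x = 1 then ln 2 else (1 - 2 powr (1 - x)) / (x - 1))"
  have zk: "zpole (of_real x) = of_real k"
  proof -
    have "(1 - of_real x) * of_real (ln 2) = complex_of_real ((1 - x) * ln 2)" by simp
    then have "exp ((1 - of_real x) * of_real (ln 2)) = complex_of_real (exp ((1 - x) * ln 2))"
      by (simp only: exp_of_real)
    also have "exp ((1 - x) * ln 2) = 2 powr (1 - x)" by (simp add: powr_def)
    finally show ?thesis by (simp add: zpole_def k_def)
  qed
  have k: "k > 0"
  proof -
    consider "x = 1" | "x > 1" | "x < 1" by linarith
    then show ?thesis
    proof cases
      case 2
      then have "2 powr (1 - x) < 2 powr (0::real)" by (intro powr_less_mono) auto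
      then show ?thesis using 2 by (simp add: k_def)
    next
      case 3
      then have "2 powr (0::real) < 2 powr (1 - x)" by (intro powr_less_mono) auto
      then show ?thesis using 3 by (simp add: k_def divide_neg_neg)
    qed (simp add: k_def)
  qed
  show ?thesis
  proof (rule that)
    show "r / k > 0" using \<open>r > 0\<close> k by simp
    show "zreg (of_real x) = of_real (r / k)" by (simp add: zreg_def r zk)
  qed
qed

section \<open>Lower bounds for values at 1\<close>


text \<open>What the analytic part uses of a nonprincipal character of modulus q. Periodicity is
  replaced by the bound q on partial sums, so a bound may be enlarged freely and characters of
  different moduli can be treated with a common q.\<close>

definition bounded_char :: "real \<Rightarrow> (nat \<Rightarrow> complex) \<Rightarrow> bool" where
  "bounded_char q \<psi> \<longleftrightarrow> compl_mult \<psi> \<and> (\<forall>n. norm (\<psi> n) \<le> 1) \<and> bounded_partials q \<psi>"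

lemma bounded_charD:
  assumes "bounded_char q \<psi>"
  shows "compl_mult \<psi>" "norm (\<psi> n) \<le> 1" "bounded_partials q \<psi>"
  using assms by (auto simp: bounded_char_def)

lemma Lfun_real:
  assumes "bounded_char q \<psi>" "\<And>n. \<psi> n \<in> \<real>" "x > 0"
  shows "Lfun \<psi> (of_real x) = of_real (Re (Lfun \<psi> (of_real x)))"
proof -
  have "cnj (\<psi> n) = \<psi> n" for n using assms(2) by (simp add: Reals_cnj_iff)
  then have "cnj (Lfun \<psi> (of_real x)) = Lfun \<psi> (of_real x)"
    using Lfun_cnj[OF bounded_charD(3)[OF assms(1)], of "of_real x"] assms(3) by simp
  then show ?thesis by (simp only: Reals_cnj_iff[symmetric] of_real_Re)
qed

lemma prod_list_holomorphic_on:
  "(\<And>f. f \<in> set fs \<Longrightarrow> F f holomorphic_on A) \<Longrightarrow> (\<lambda>s. \<Prod>f\<leftarrow>fs. F f s) holomorphic_on A"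
  by (induction fs) (auto intro!: holomorphic_intros)

lemma norm_prod_list_le:
  fixes F :: "'a \<Rightarrow> complex"
  assumes "\<And>f. f \<in> set fs \<Longrightarrow> norm (F f) \<le> B" "B \<ge> 0"
  shows "norm (\<Prod>f\<leftarrow>fs. F f) \<le> B ^ length fs"
  using assms(1)
proof (induction fs)
  case (Cons f fs)
  have "norm (F f * (\<Prod>f\<leftarrow>fs. F f)) \<le> B * B ^ length fs"
    unfolding norm_mult using Cons assms(2) by (intro mult_mono) auto
  then show ?case by simp
qed auto

lemma half_plane_ball: "s \<in> ball 2 2 \<Longrightarrow> Re s > 0"
  using abs_Re_le_cmod[of "2 - s"] by (auto simp: dist_norm)

text \<open>The hypothesis on 1 + sum of psi(d) is exactly what \<open>conv_prod_nonneg\<close> asks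
  of the list of characters with the constant 1 in front. Reality of the characters makes Q(1), the
  residue of the product, real.\<close>

lemma zeta_product:
  assumes "\<And>\<psi>. \<psi> \<in> set \<psi>s \<Longrightarrow> bounded_char q \<psi>"
    and "\<And>\<psi> n. \<psi> \<in> set \<psi>s \<Longrightarrow> \<psi> n \<in> \<real>"
    and "\<And>d. d > 0 \<Longrightarrow> 1 + (\<Sum>\<psi>\<leftarrow>\<psi>s. \<psi> d) \<in> \<real>\<^sub>\<ge>\<^sub>0"
  defines "Q \<equiv> \<lambda>s. zreg s * (\<Prod>\<psi>\<leftarrow>\<psi>s. Lfun \<psi> s)"
  defines "a \<equiv> \<lambda>n. Re (conv_prod ((\<lambda>_. 1) # \<psi>s) n)"
  shows "nonneg_dirichlet Q a (Re (Q 1))" and "a 1 = 1"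
proof -
  have cm: "compl_mult f" if "f \<in> set ((\<lambda>_. 1) # \<psi>s)" for f
    using that assms(1) by (auto simp: compl_mult_def[of "\<lambda>_. 1"] dest: bounded_charD)
  show "a 1 = 1" using conv_prod_1[of "(\<lambda>_. 1) # \<psi>s", OF cm] by (simp add: a_def)
  have nonneg: "conv_prod ((\<lambda>_. 1) # \<psi>s) n \<in> \<real>\<^sub>\<ge>\<^sub>0" if "n > 0" for n
    using that assms(3) by (intro conv_prod_nonneg cm) auto
  show "nonneg_dirichlet Q a (Re (Q 1))"
  proof
    have "Lfun \<psi> holomorphic_on ball 2 2" if "\<psi> \<in> set \<psi>s" for \<psi>
      using Lfun_holomorphic[OF bounded_charD(3)[OF assms(1)[OF that]]]
      by (rule holomorphic_on_subset) (auto dest: half_plane_ball)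
    then show "Q holomorphic_on ball 2 2"
      unfolding Q_def by (intro holomorphic_on_mult zreg_holo prod_list_holomorphic_on)
    have "(\<Prod>\<psi>\<leftarrow>\<psi>s. Lfun \<psi> 1) \<in> \<real>"
      using assms(1,2)
    proof (induction \<psi>s)
      case (Cons \<psi> \<psi>s)
      have "Lfun \<psi> (of_real 1) \<in> \<real>"
        by (subst Lfun_real[of q]) (use Cons.prems in auto)
      then show ?case using Cons by simp
    qed auto
    moreover have "zreg 1 \<in> \<real>"
      using zreg_real[of 1] by (metis Reals_of_real of_real_1 zero_less_one)
    ultimately have "Q 1 \<in> \<real>" by (simp add: Q_def)
    then show "Q 1 = of_real (Re (Q 1))" by (simp only: of_real_Re)
    show "a n \<ge> 0" if "n > 0" for n
      using nonneg[OF that] by (simp add: a_def complex_nonneg_Reals_iff)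
    fix s :: complex assume s: "Re s > 1"
    have "((\<lambda>n. conv_prod ((\<lambda>_. 1) # \<psi>s) n * npow n s) has_sum
          (zreg s / (s - 1) * (\<Prod>\<psi>\<leftarrow>\<psi>s. Lfun \<psi> s))) {1..}"
      unfolding conv_prod_Cons
      using s by (intro has_sum_dconv zeta_series has_sum_conv_prod Lfun_has_sum[of q] assms(1)[THEN bounded_charD(3)]
          assms(1)[THEN bounded_charD(2)]) auto
    also have "zreg s / (s - 1) * (\<Prod>\<psi>\<leftarrow>\<psi>s. Lfun \<psi> s) = Q s / (s - 1)" by (simp add: Q_def)
    also have "((\<lambda>n. conv_prod ((\<lambda>_. 1) # \<psi>s) n * npow n s) has_sum (Q s / (s - 1))) {1..} \<longleftrightarrow>
        ((\<lambda>n. of_real (a n) * npow n s) has_sum (Q s / (s - 1))) {1..}"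
    proof (rule has_sum_cong)
      fix n :: nat assume "n \<in> {1..}"
      then have "conv_prod ((\<lambda>_. 1) # \<psi>s) n \<in> \<real>" using nonneg[of n] by (intro nonneg_Reals_Real) auto
      then show "conv_prod ((\<lambda>_. 1) # \<psi>s) n * npow n s = of_real (a n) * npow n s"
        by (simp only: a_def of_real_Re)
    qed
    finally show "((\<lambda>n. of_real (a n) * npow n s) has_sum (Q s / (s - 1))) {1..}" .
  qed
qed

text \<open>\<open>residue_lower_bound\<close> for zeta times the L-functions, with B = Z (D
  q)^length and with Z, D absolute. The further division by Z removes |zreg 1|, so that the residue
  bound becomes one for the L-values alone.\<close>

lemma L_product_lower_bound:
  obtains Z D where "Z \<ge> 1" "D \<ge> 1"
    "\<And>q \<psi>s x. q \<ge> 1 \<Longrightarrow> (\<And>\<psi>. \<psi> \<in> set \<psi>s \<Longrightarrow> bounded_char q \<psi>) \<Longrightarrow>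
      (\<And>\<psi> n. \<psi> \<in> set \<psi>s \<Longrightarrow> \<psi> n \<in> \<real>) \<Longrightarrow>
      (\<And>d. d > 0 \<Longrightarrow> 1 + (\<Sum>\<psi>\<leftarrow>\<psi>s. \<psi> d) \<in> \<real>\<^sub>\<ge>\<^sub>0) \<Longrightarrow>
      3/4 \<le> x \<Longrightarrow> x < 1 \<Longrightarrow> (\<Prod>\<psi>\<leftarrow>\<psi>s. Re (Lfun \<psi> (of_real x))) \<ge> 0 \<Longrightarrow>
      norm (\<Prod>\<psi>\<leftarrow>\<psi>s. Lfun \<psi> 1) \<ge> (1 - x) / (6 * Z) * (48 * (Z * (D * q) ^ length \<psi>s)) powr (- 6 * (1 - x))"
proof -
  obtain Z where Z: "Z \<ge> 1" "\<And>s. s \<in> cball 2 (3/2) \<Longrightarrow> norm (zreg s) \<le> Z"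
    using zreg_bound by blast
  define C where "C = (\<Sum>n. real (Suc n) powr (- (1 / 2) - 1))"
  \<comment> \<open>The 4 bounds |s| on the disc, where |s| <= 2 + 3/2; C is the sum of n^(-3/2)
    from \<open>Lfun_bound\<close>.\<close>
  define D where "D = max 1 (4 * C)"
  have D1: "D \<ge> 1" by (simp add: D_def)
  have "norm (\<Prod>\<psi>\<leftarrow>\<psi>s. Lfun \<psi> 1) \<ge> (1 - x) / (6 * Z) * (48 * (Z * (D * q) ^ length \<psi>s)) powr (- 6 * (1 - x))"
    if q: "q \<ge> 1" and ch: "\<And>\<psi>. \<psi> \<in> set \<psi>s \<Longrightarrow> bounded_char q \<psi>"
      and re: "\<And>\<psi> n. \<psi> \<in> set \<psi>s \<Longrightarrow> \<psi> n \<in> \<real>"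
      and nn: "\<And>d. d > 0 \<Longrightarrow> 1 + (\<Sum>\<psi>\<leftarrow>\<psi>s. \<psi> d) \<in> \<real>\<^sub>\<ge>\<^sub>0"
      and x: "3/4 \<le> x" "x < 1" and sign: "(\<Prod>\<psi>\<leftarrow>\<psi>s. Re (Lfun \<psi> (of_real x))) \<ge> 0"
    for q x :: real and \<psi>s
  proof -
    define Q where "Q = (\<lambda>s. zreg s * (\<Prod>\<psi>\<leftarrow>\<psi>s. Lfun \<psi> s))"
    define a where "a = (\<lambda>n. Re (conv_prod ((\<lambda>_. 1) # \<psi>s) n))"
    define B where "B = Z * (D * q) ^ length \<psi>s"
    interpret nonneg_dirichlet Q a "Re (Q 1)"
      unfolding Q_def a_def by (rule zeta_product(1)[where \<psi>s = \<psi>s and q = q]) (fact ch re nn)+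
    have a1: "a 1 = 1" unfolding a_def by (rule zeta_product(2)[where \<psi>s = \<psi>s and q = q]) (fact ch re nn)+
    have Dq: "D * q \<ge> 1" using mult_mono[of 1 D 1 q] D1 q by simp
    have "(D * q) ^ length \<psi>s \<ge> 1" using Dq by (rule one_le_power)
    then have B1: "B \<ge> 1" using mult_mono[of 1 Z 1 "(D * q) ^ length \<psi>s"] Z by (simp add: B_def)
    have prod: "norm (\<Prod>\<psi>\<leftarrow>\<psi>s. Lfun \<psi> s) \<le> (D * q) ^ length \<psi>s" if s: "s \<in> cball 2 (3/2)" for s
    proof (rule norm_prod_list_le)
      fix \<psi> assume \<psi>: "\<psi> \<in> set \<psi>s"
      have "Re s \<ge> 1/2" using s abs_Re_le_cmod[of "2 - s"] by (auto simp: dist_norm)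
      then have "norm (Lfun \<psi> s) \<le> q * norm s * C"
        unfolding C_def by (rule Lfun_bound[OF bounded_charD(3)[OF ch[OF \<psi>]]])
      moreover have "norm s \<le> 4" using s norm_triangle_ineq2[of s 2] by (auto simp: dist_norm norm_minus_commute)
      moreover have "C \<ge> 0" unfolding C_def by (intro suminf_nonneg summable_powr_shift) auto
      ultimately have "norm (Lfun \<psi> s) \<le> q * 4 * C"
        using q by (meson mult_left_mono mult_right_mono order_trans zero_le_one)
      also have "\<dots> = q * (4 * C)" by simp
      also have "\<dots> \<le> q * D" using q by (intro mult_left_mono) (auto simp: D_def)
      finally show "norm (Lfun \<psi> s) \<le> D * q" by (simp add: mult.commute)
    qed (use Dq in simp)
    have bound: "norm (Q s) \<le> B" if s: "s \<in> cball 2 (3/2)" for s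
      unfolding Q_def B_def norm_mult using Z s prod[OF s] by (intro mult_mono) auto
    have 1: "(1::complex) \<in> cball 2 (3/2)" by (simp add: dist_norm)
    have "\<bar>Re (Q 1)\<bar> \<le> B" using bound[OF 1] abs_Re_le_cmod[of "Q 1"] by linarith
    then have l: "Re (Q 1) \<le> B" "- Re (Q 1) \<le> B" by auto
    have Qx: "Re (Q (of_real x)) \<ge> 0"
    proof -
      obtain y where y: "y > 0" "zreg (of_real x) = of_real y"
        using zreg_real[of x] x by (metis less_le_trans zero_less_divide_iff zero_less_numeral)
      have "(\<Prod>\<psi>\<leftarrow>\<psi>s. Lfun \<psi> (of_real x)) = of_real (\<Prod>\<psi>\<leftarrow>\<psi>s. Re (Lfun \<psi> (of_real x)))"
        using ch re
      proof (induction \<psi>s)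
        case (Cons \<psi> \<psi>s)
        then show ?case using Lfun_real[of q \<psi> x] x by simp
      qed auto
      then show ?thesis using y sign by (simp add: Q_def)
    qed
    have "Re (Q 1) \<ge> (1 - x) / 6 * (48 * B) powr (- 6 * (1 - x))"
    proof (rule residue_lower_bound[OF a1 _ l B1 x Qx])
      fix z :: complex assume "norm (z - 2) = 3/2"
      then show "norm (Q z) \<le> B" by (intro bound) (simp add: dist_norm norm_minus_commute)
    qed
    also have "Re (Q 1) \<le> norm (Q 1)" by (rule complex_Re_le_cmod)
    also have "\<dots> \<le> Z * norm (\<Prod>\<psi>\<leftarrow>\<psi>s. Lfun \<psi> 1)"
      unfolding Q_def norm_mult using Z(2)[OF 1] by (rule mult_right_mono) simp
    finally show ?thesis
      using Z(1) unfolding B_def[symmetric] by (simp add: divide_simps mult_ac)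
  qed
  then show ?thesis using that[of Z D] Z(1) D1 by blast
qed


section \<open>Nonvanishing and positivity at 1 for real characters\<close>

text \<open>Uniformity as x tends to 0 is the point; \<open>zreg_bound\<close> stops at 1/2. The
  alternating series is at most 3 in modulus, and the denominator is at least ln 2 >= 1/2.\<close>

lemma zreg_small:
  assumes "0 < x" "x < 1"
  shows "norm (zreg (of_real x)) \<le> 6"
proof -
  have L: "norm (Lfun alt (of_real x)) \<le> 3"
    using Lfun_real_bound[OF bounded_partials_alt assms(1)] by (simp add: alt_def)
  have e: "(1 - of_real x) * of_real (ln 2) = complex_of_real ((1 - x) * ln 2)" by simp
  have e': "complex_of_real x - 1 = of_real (x - 1)" by simp
  have "zpole (of_real x) = (1 - of_real (exp ((1 - x) * ln 2))) / of_real (x - 1)"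
    unfolding zpole_def e exp_of_real e' using assms by simp
  also have "\<dots> = of_real ((exp ((1 - x) * ln 2) - 1) / (1 - x))"
    using assms by (simp add: divide_simps) (simp add: algebra_simps)
  finally have z: "zpole (of_real x) = of_real ((exp ((1 - x) * ln 2) - 1) / (1 - x))" .
  have "(1 - x) * ln 2 \<le> exp ((1 - x) * ln 2) - 1"
    using exp_ge_add_one_self[of "(1 - x) * ln 2"] by linarith
  then have "ln 2 \<le> (exp ((1 - x) * ln 2) - 1) / (1 - x)"
    using assms by (simp add: pos_le_divide_eq mult.commute)
  moreover have "1/2 \<le> ln (2::real)" using ln2_ge_two_thirds by simp
  ultimately have "1/2 \<le> norm (zpole (of_real x))" unfolding z norm_of_real by linarith
  then have "norm (Lfun alt (of_real x)) / norm (zpole (of_real x)) \<le> 3 / (1/2)"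
    using L by (intro frac_le) auto
  then show ?thesis by (simp add: zreg_def norm_divide)
qed

lemma dconv_unit: "n > 0 \<Longrightarrow> dconv f (\<lambda>n. if n = 1 then 1 else 0) n = f n"
proof -
  assume n: "n > 0"
  have "dconv f (\<lambda>n. if n = 1 then 1 else 0) n = (\<Sum>x\<in>{(n, 1::nat)}. f (fst x) * 1)"
    unfolding dconv_def
    by (rule sum.mono_neutral_cong_right[OF finite_factor_pairs[OF n]])
       (use n in \<open>auto simp: factor_pairs_def split: if_splits\<close>)
  then show ?thesis by simp
qed

text \<open>For a real value t of the character, 1 + t + t^2 >= 3/4, so the coefficients of zeta L
  stay away from 0 at all prime squares.\<close>

lemma conv_prod_prime_square:
  assumes "compl_mult \<psi>" "prime p"
  shows "conv_prod [\<lambda>_. 1, \<psi>] (p\<^sup>2) = 1 + \<psi> p + (\<psi> p)\<^sup>2"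
proof -
  have p: "p > 1" "p\<^sup>2 \<noteq> 1" "p\<^sup>2 \<noteq> p" using prime_gt_1_nat[OF assms(2)] by (auto simp: power2_eq_square)
  have fp: "factor_pairs (p\<^sup>2) = {(p\<^sup>2, 1), (p, p), (1, p\<^sup>2)}"
  proof (intro equalityI subsetI)
    fix x assume x: "x \<in> factor_pairs (p\<^sup>2)"
    then have xe: "fst x * snd x = p\<^sup>2" by (auto simp: factor_pairs_def)
    then have "fst x dvd p\<^sup>2" by (metis dvd_triv_left)
    then obtain i where i: "i \<le> 2" "fst x = p ^ i" using divides_primepow_nat[OF assms(2)] by blast
    have "i = 0 \<or> i = 1 \<or> i = 2" using i by linarith
    then show "x \<in> {(p\<^sup>2, 1), (p, p), (1, p\<^sup>2)}"
      using xe i p by (cases x) (auto simp: power2_eq_square)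
  qed (auto simp: factor_pairs_def power2_eq_square)
  have "conv_prod [\<lambda>_. 1, \<psi>] = dconv (\<lambda>_. 1) \<psi>"
    unfolding conv_prod_Cons conv_prod_Nil by (rule dconv_cong) (auto simp: dconv_unit[simplified])
  then have "conv_prod [\<lambda>_. 1, \<psi>] (p\<^sup>2) = (\<Sum>(d, e)\<in>{(p\<^sup>2, 1), (p, p), (1, p\<^sup>2)}. 1 * \<psi> e)"
    by (simp only: dconv_def fp)
  also have "\<dots> = \<psi> 1 + \<psi> p + \<psi> (p * p)"
    using p by (simp add: power2_eq_square)
  also have "\<dots> = 1 + \<psi> p + (\<psi> p)\<^sup>2"
    using assms(1) unfolding compl_mult_def power2_eq_square by simp
  finally show ?thesis .
qed

lemma one_plus_real_char_nonneg:
  assumes "bounded_char q \<psi>" "\<And>n. \<psi> n \<in> \<real>"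
  shows "1 + (\<Sum>\<psi>\<leftarrow>[\<psi>]. \<psi> d) \<in> \<real>\<^sub>\<ge>\<^sub>0"
proof -
  have "\<psi> d = of_real (Re (\<psi> d))" using assms(2) by simp
  moreover have "Re (\<psi> d) \<ge> - 1"
    using bounded_charD(2)[OF assms(1), of d] abs_Re_le_cmod[of "\<psi> d"] by linarith
  ultimately show ?thesis by (auto simp: complex_nonneg_Reals_iff complex_is_Real_iff[symmetric] assms(2))
qed

text \<open>A zero at 1 cancels the pole of zeta. By \<open>partial_sum_le\<close> the sums of a(n)
  n^(-x) are then bounded uniformly for 0 < x < 1/2, and in the limit x -> 0 so are the sums of
  a(n), against the contribution of at least 3/4 from every prime square.\<close>

lemma L_real_nonvanishing:
  assumes ch: "bounded_char q \<psi>" and re: "\<And>n. \<psi> n \<in> \<real>"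
  shows "Lfun \<psi> 1 \<noteq> 0"
proof
  assume L0: "Lfun \<psi> 1 = 0"
  define Q where "Q = (\<lambda>s. zreg s * (\<Prod>\<psi>\<leftarrow>[\<psi>]. Lfun \<psi> s))"
  define a where "a = (\<lambda>n. Re (conv_prod ((\<lambda>_. 1) # [\<psi>]) n))"
  interpret nonneg_dirichlet Q a "Re (Q 1)"
    unfolding Q_def a_def
    by (rule zeta_product(1)[where \<psi>s = "[\<psi>]" and q = q]) (use one_plus_real_char_nonneg[OF ch re] ch re in auto)
  have Q10: "Re (Q 1) = 0" by (simp add: Q_def L0)
  \<comment> \<open>This is 6 (2q + 1) / (1/2), from |zreg| <= 6, |L| <= 2q + 1 and |x - 1| >=
    1/2.\<close>
  define K where "K = 12 * (2 * q + 1)"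
  have q0: "q \<ge> 0" using bounded_partials_nonneg[OF bounded_charD(3)[OF ch]] .
  have bound: "(\<Sum>n=1..N. a n * real n powr - x) \<le> K" if x: "0 < x" "x < 1/2" for N x
  proof -
    have "norm (Q (of_real x)) \<le> 6 * (2 * q + 1)"
    proof -
      have "norm (Lfun \<psi> (of_real x)) \<le> 2 * q + 1"
        using Lfun_real_bound[OF bounded_charD(3)[OF ch] x(1)] bounded_charD(2)[OF ch] by simp
      then have "norm (zreg (of_real x)) * norm (Lfun \<psi> (of_real x)) \<le> 6 * (2 * q + 1)"
        using x by (intro mult_mono zreg_small) auto
      then show ?thesis by (simp add: Q_def norm_mult)
    qed
    then have B: "\<bar>Re (Q (of_real x)) / (x - 1)\<bar> \<le> (6 * (2 * q + 1)) / (1/2)"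
      unfolding abs_divide using x q0 abs_Re_le_cmod[of "Q (of_real x)"] by (intro frac_le) auto
    then show ?thesis
      using order_trans[OF partial_sum_le[OF Q10, of x N] abs_le_D1[OF B]] x by (simp add: K_def)
  qed
  have bound0: "(\<Sum>n=1..N. a n) \<le> K" for N
  proof (rule tendsto_upperbound)
    have "((\<lambda>x. a n * real n powr - x) \<longlongrightarrow> a n * real n powr - 0) (at_right 0)" if "n \<in> {1..N}" for n
      using that by (intro tendsto_intros) auto
    then have "((\<lambda>x. \<Sum>n=1..N. a n * real n powr - x) \<longlongrightarrow> (\<Sum>n=1..N. a n * real n powr - 0)) (at_right 0)"
      by (rule tendsto_sum)
    also have "(\<Sum>n=1..N. a n * real n powr - 0) = (\<Sum>n=1..N. a n)" by (rule sum.cong) auto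
    finally show "((\<lambda>x. \<Sum>n=1..N. a n * real n powr - x) \<longlongrightarrow> (\<Sum>n=1..N. a n)) (at_right 0)" .
    show "\<forall>\<^sub>F x in at_right 0. (\<Sum>n=1..N. a n * real n powr - x) \<le> K"
    proof (rule eventually_mono[OF eventually_at_right_real[of 0 "1/2"]])
      fix x :: real assume "x \<in> {0<..<1/2}"
      then show "(\<Sum>n=1..N. a n * real n powr - x) \<le> K" using bound[of x N] by simp
    qed simp
  qed auto
  obtain P where P: "finite P" "card P = nat \<lceil>2 * K\<rceil> + 1" "P \<subseteq> {p::nat. prime p}"
    using infinite_arbitrarily_large[OF primes_infinite] by blast
  define N where "N = Max ((\<lambda>p. p\<^sup>2) ` P)"
  have asq: "a (p\<^sup>2) \<ge> 3/4" if "prime p" for p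
  proof -
    obtain r where r: "\<psi> p = of_real r" using re[of p] by (auto simp: Reals_def)
    have "a (p\<^sup>2) = 1 + r + r\<^sup>2"
      unfolding a_def conv_prod_prime_square[OF bounded_charD(1)[OF ch] that] r by simp
    also have "\<dots> = 3/4 + (r + 1/2)\<^sup>2" by (simp add: power2_eq_square algebra_simps)
    finally show ?thesis by simp
  qed
  have inj: "inj_on (\<lambda>p::nat. p\<^sup>2) P" by (auto simp: inj_on_def)
  have "2 * K < card P" using P(2) by linarith
  then have "K < (\<Sum>p\<in>P. 3/4)" using P by (simp add: K_def q0)
  also have "\<dots> \<le> (\<Sum>p\<in>P. a (p\<^sup>2))" using P(3) asq by (intro sum_mono) auto
  also have "\<dots> = (\<Sum>n\<in>(\<lambda>p. p\<^sup>2) ` P. a n)" by (simp add: sum.reindex[OF inj])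
  also have "\<dots> \<le> (\<Sum>n=1..N. a n)"
  proof (rule sum_mono2)
    show "(\<lambda>p. p\<^sup>2) ` P \<subseteq> {1..N}"
      using P unfolding N_def by (auto simp: Suc_le_eq prime_gt_0_nat)
    show "0 \<le> a b" if "b \<in> {1..N} - (\<lambda>p. p\<^sup>2) ` P" for b using that nonneg[of b] by auto
  qed auto
  also have "\<dots> \<le> K" by (rule bound0)
  finally show False by simp
qed

lemma Lfun_continuous:
  assumes "bounded_char q \<psi>"
  shows "continuous_on {0<..} (\<lambda>x. Re (Lfun \<psi> (of_real x)))"
proof -
  have "continuous_on {s. Re s > 0} (Lfun \<psi>)"
    by (rule holomorphic_on_imp_continuous_on[OF Lfun_holomorphic[OF bounded_charD(3)[OF assms]]])
  then have "continuous_on {0<..} (\<lambda>x::real. Lfun \<psi> (of_real x))"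
    by (rule continuous_on_compose2[where f = of_real]) (auto intro!: continuous_intros)
  then show ?thesis by (intro continuous_intros)
qed

text \<open>To the right of 1 the series of zeta L has nonnegative terms and first term 1, while
  zeta is positive. At 1 itself a nonpositive value would by continuity force a zero in [1, 2],
  which only 1 could be, and nonvanishing excludes it.\<close>

lemma L_real_pos:
  assumes ch: "bounded_char q \<psi>" and re: "\<And>n. \<psi> n \<in> \<real>" and x: "x \<ge> 1"
  shows "Re (Lfun \<psi> (of_real x)) > 0"
proof -
  have gt: "Re (Lfun \<psi> (of_real x)) > 0" if x: "x > 1" for x
  proof -
    define Q where "Q = (\<lambda>s. zreg s * (\<Prod>\<psi>\<leftarrow>[\<psi>]. Lfun \<psi> s))"
    define a where "a = (\<lambda>n. Re (conv_prod ((\<lambda>_. 1) # [\<psi>]) n))"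
    interpret nonneg_dirichlet Q a "Re (Q 1)"
      unfolding Q_def a_def
      by (rule zeta_product(1)[where \<psi>s = "[\<psi>]" and q = q]) (use one_plus_real_char_nonneg[OF ch re] ch re in auto)
    have a1: "a 1 = 1" unfolding a_def
      by (rule zeta_product(2)[where \<psi>s = "[\<psi>]" and q = q]) (use one_plus_real_char_nonneg[OF ch re] ch re in auto)
    have "((\<lambda>n. Re (of_real (a n) * npow n (of_real x))) has_sum Re (Q (of_real x) / (of_real x - 1))) {1..}"
      using x by (intro has_sum_Re series) auto
    then have "sum (\<lambda>n. Re (of_real (a n) * npow n (of_real x))) {1} \<le> Re (Q (of_real x) / (of_real x - 1))"
      by (rule finite_sum_le_has_sum) (auto simp: npow_of_real nonneg Suc_le_eq)
    then have "Re (Q (of_real x) / of_real (x - 1)) \<ge> 1" using a1 by simp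
    then have "Re (Q (of_real x)) > 0"
      unfolding Re_divide_of_real using x by (simp add: pos_le_divide_eq)
    moreover obtain y where y: "y > 0" "zreg (of_real x) = of_real y"
      using zreg_real[of x] x by (metis less_trans zero_less_one)
    ultimately have "0 < y * Re (Lfun \<psi> (of_real x))" by (simp add: Q_def)
    then show ?thesis using y(1) by (simp add: zero_less_mult_iff)
  qed
  have ge: "Re (Lfun \<psi> (of_real 1)) > 0"
  proof (rule ccontr)
    assume neg: "\<not> ?thesis"
    have cont: "continuous_on {1..2} (\<lambda>x. Re (Lfun \<psi> (of_real x)))"
      by (rule continuous_on_subset[OF Lfun_continuous[OF ch]]) auto
    obtain z where z: "1 \<le> z" "z \<le> 2" "Re (Lfun \<psi> (of_real z)) = 0"
      using IVT'[OF _ _ _ cont, of 0] neg gt[of 2] by auto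
    then have "z = 1" using gt[of z] by (cases "z = 1") auto
    then have "Re (Lfun \<psi> (of_real 1)) = 0" using z by simp
    then have "Lfun \<psi> 1 = 0" using Lfun_real[OF ch re, of 1] by simp
    then show False using L_real_nonvanishing[OF ch re] by simp
  qed
  show ?thesis using gt[of x] ge x by (cases "x = 1") auto
qed

section \<open>Upper bounds for L to the right of 1\<close>

text \<open>A power in place of ln N: n^(-1) <= n^(-1-\<eta>) N^\<eta> for n <= N, and the remaining
  series converges.\<close>

lemma sum_inverse_bound:
  assumes "\<eta> > 0"
  obtains C where "C \<ge> 1" "\<And>N. (\<Sum>n=1..N. real n powr - 1) \<le> C * real N powr \<eta>"
proof -
  define C where "C = (\<Sum>n. real (Suc n) powr (- \<eta> - 1))"
  have sm: "summable (\<lambda>n. real (Suc n) powr (- \<eta> - 1))" by (rule summable_powr_shift[OF assms])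
  have "(\<Sum>n<1. real (Suc n) powr (- \<eta> - 1)) \<le> C"
    unfolding C_def by (rule sum_le_suminf[OF sm]) auto
  then have "C \<ge> 1" by simp
  moreover have "(\<Sum>n=1..N. real n powr - 1) \<le> C * real N powr \<eta>" for N
  proof -
    have "(\<Sum>n=1..N. real n powr - 1) \<le> (\<Sum>n=1..N. real n powr (- \<eta> - 1) * real N powr \<eta>)"
    proof (rule sum_mono)
      fix n assume n: "n \<in> {1..N}"
      have "real n powr - 1 = real n powr (- \<eta> - 1) * real n powr \<eta>"
        by (simp flip: powr_add)
      also have "\<dots> \<le> real n powr (- \<eta> - 1) * real N powr \<eta>"
        using n assms by (intro mult_left_mono powr_mono2) auto
      finally show "real n powr - 1 \<le> \<dots>" .
    qed
    also have "\<dots> = (\<Sum>n<N. real (Suc n) powr (- \<eta> - 1)) * real N powr \<eta>"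
      by (simp add: sum_distrib_right sum.atLeast1_atMost_eq)
    also have "\<dots> \<le> C * real N powr \<eta>"
      unfolding C_def by (intro mult_right_mono sum_le_suminf[OF sm]) auto
    finally show ?thesis .
  qed
  ultimately show ?thesis by (rule that)
qed

text \<open>The series is cut at N, about q: the head is bounded trivially by the harmonic sum, and
  the tail by 2q/N <= 2.\<close>

lemma L_upper_bound:
  assumes "\<eta> > 0"
  obtains C where "C \<ge> 1"
    "\<And>q \<psi> x. q \<ge> 1 \<Longrightarrow> bounded_char q \<psi> \<Longrightarrow> x \<ge> 1 \<Longrightarrow> norm (Lfun \<psi> (of_real x)) \<le> C * q powr \<eta>"
proof -
  obtain C where C: "C \<ge> 1" "\<And>N. (\<Sum>n=1..N. real n powr - 1) \<le> C * real N powr \<eta>"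
    using sum_inverse_bound[OF assms] by blast
  define C' where "C' = C * 2 powr \<eta> + 2"
  have "C' \<ge> 1" using C(1) by (simp add: C'_def)
  moreover have "norm (Lfun \<psi> (of_real x)) \<le> C' * q powr \<eta>"
    if q: "q \<ge> 1" and ch: "bounded_char q \<psi>" and x: "x \<ge> 1" for q \<psi> x
  proof -
    define N where "N = nat \<lceil>q\<rceil>"
    have N: "q \<le> real N" "real N \<le> 2 * q" "N > 0" using q unfolding N_def by linarith+
    have "norm (\<Sum>n=1..N. \<psi> n * npow n (of_real x)) \<le> (\<Sum>n=1..N. real n powr - 1)"
    proof (rule sum_norm_le)
      fix n assume n: "n \<in> {1..N}"
      have "norm (\<psi> n * npow n (of_real x)) \<le> 1 * real n powr (- x)"
        unfolding norm_mult using n bounded_charD(2)[OF ch, of n] by (intro mult_mono) (auto simp: norm_npow)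
      also have "\<dots> \<le> real n powr - 1" using n x powr_mono[of "- x" "- 1" "real n"] by simp
      finally show "norm (\<psi> n * npow n (of_real x)) \<le> real n powr - 1" .
    qed
    also have "\<dots> \<le> C * real N powr \<eta>" by (rule C(2))
    also have "\<dots> \<le> C * (2 * q) powr \<eta>" using N C assms by (intro mult_left_mono powr_mono2) auto
    also have "\<dots> = C * 2 powr \<eta> * q powr \<eta>" using q by (simp add: powr_mult)
    finally have 1: "norm (\<Sum>n=1..N. \<psi> n * npow n (of_real x)) \<le> C * 2 powr \<eta> * q powr \<eta>" .
    have "norm (Lfun \<psi> (of_real x) - (\<Sum>n=1..N. \<psi> n * npow n (of_real x))) \<le> 2 * q * real N powr (- x)"
      using x N by (intro Lfun_tail bounded_charD[OF ch]) auto
    also have "\<dots> \<le> 2 * q * real N powr (- 1)"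
      using q N x by (intro mult_left_mono powr_mono) auto
    also have "\<dots> \<le> 2" using q N by (simp add: powr_minus_divide divide_le_eq)
    also have "\<dots> \<le> 2 * q powr \<eta>" using q assms ge_one_powr_ge_zero[of q \<eta>] by simp
    finally have "norm (Lfun \<psi> (of_real x)) \<le> C * 2 powr \<eta> * q powr \<eta> + 2 * q powr \<eta>"
      using 1 norm_triangle_ineq2[of "Lfun \<psi> (of_real x)" "\<Sum>n=1..N. \<psi> n * npow n (of_real x)"] by linarith
    then show ?thesis by (simp add: C'_def algebra_simps)
  qed
  ultimately show ?thesis by (rule that)
qed


section \<open>Siegel's theorem\<close>

text \<open>The sum factors as (1 + f)(1 + g), both factors being nonnegative for real characters.
  This positivity is why f g has to be included in the product.\<close>

lemma two_real_chars_nonneg: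
  assumes "bounded_char q f" "bounded_char q' g" "\<And>n. f n \<in> \<real>" "\<And>n. g n \<in> \<real>"
  shows "1 + (\<Sum>\<psi>\<leftarrow>[f, g, \<lambda>n. f n * g n]. \<psi> d) \<in> \<real>\<^sub>\<ge>\<^sub>0"
proof -
  have "1 + f d \<in> \<real>\<^sub>\<ge>\<^sub>0" "1 + g d \<in> \<real>\<^sub>\<ge>\<^sub>0"
    using one_plus_real_char_nonneg[OF assms(1,3), of d] one_plus_real_char_nonneg[OF assms(2,4), of d] by auto
  then have "(1 + f d) * (1 + g d) \<in> \<real>\<^sub>\<ge>\<^sub>0" by (rule nonneg_Reals_mult_I)
  also have "(1 + f d) * (1 + g d) = 1 + (\<Sum>\<psi>\<leftarrow>[f, g, \<lambda>n. f n * g n]. \<psi> d)"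
    by (simp add: algebra_simps)
  finally show ?thesis .
qed

lemma bounded_char_mono: "bounded_char q f \<Longrightarrow> q \<le> q' \<Longrightarrow> bounded_char q' f"
  by (auto simp: bounded_char_def bounded_partials_def intro: order_trans)

lemma bounded_char_mult:
  assumes "bounded_char q f" "bounded_char q' g" "bounded_partials q'' (\<lambda>n. f n * g n)"
  shows "bounded_char q'' (\<lambda>n. f n * g n)"
  unfolding bounded_char_def
proof (intro conjI allI)
  show "compl_mult (\<lambda>n. f n * g n)"
    using assms(1,2)[THEN bounded_charD(1)] by (auto simp: compl_mult_def)
  show "norm (f n * g n) \<le> 1" for n
    using assms(1,2)[THEN bounded_charD(2), of n] mult_mono[of "norm (f n)" 1 "norm (g n)" 1] by (simp add: norm_mult)
qed (fact assms(3))

text \<open>If some \<open>L(s, \<psi>\<^sub>1)\<close> vanishes at a \<open>\<beta>\<close> close to \<open>1\<close>, this character repels the others through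
  \<open>\<zeta> L(\<psi>\<^sub>1) L(\<psi>) L(\<psi>\<^sub>1\<psi>)\<close>; otherwise \<open>\<zeta> L(\<psi>)\<close> is nonpositive near \<open>1\<close> for every \<open>\<psi>\<close>.\<close>

theorem siegel:
  fixes F :: "(real \<times> (nat \<Rightarrow> complex)) set"
  assumes F: "\<And>q \<psi>. (q, \<psi>) \<in> F \<Longrightarrow> q \<ge> 1 \<and> bounded_char q \<psi> \<and> (\<forall>n. \<psi> n \<in> \<real>)"
    and indep: "\<And>q f q' g. (q, f) \<in> F \<Longrightarrow> (q', g) \<in> F \<Longrightarrow> q \<noteq> q' \<Longrightarrow>
        bounded_partials (q * q') (\<lambda>n. f n * g n)"
    and fin: "\<And>q. finite {\<psi>. (q, \<psi>) \<in> F}"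
    and "\<epsilon> > 0"
  obtains c where "c > 0" "\<And>q \<psi>. (q, \<psi>) \<in> F \<Longrightarrow> norm (Lfun \<psi> 1) \<ge> c * q powr (- \<epsilon>)"
proof -
  obtain Z D where Z: "Z \<ge> 1" and D: "D \<ge> 1" and bound:
    "\<And>q \<psi>s x. q \<ge> 1 \<Longrightarrow> (\<And>\<psi>. \<psi> \<in> set \<psi>s \<Longrightarrow> bounded_char q \<psi>) \<Longrightarrow>
      (\<And>\<psi> n. \<psi> \<in> set \<psi>s \<Longrightarrow> \<psi> n \<in> \<real>) \<Longrightarrow>
      (\<And>d. d > 0 \<Longrightarrow> 1 + (\<Sum>\<psi>\<leftarrow>\<psi>s. \<psi> d) \<in> \<real>\<^sub>\<ge>\<^sub>0) \<Longrightarrow>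
      3/4 \<le> x \<Longrightarrow> x < 1 \<Longrightarrow> (\<Prod>\<psi>\<leftarrow>\<psi>s. Re (Lfun \<psi> (of_real x))) \<ge> 0 \<Longrightarrow>
      norm (\<Prod>\<psi>\<leftarrow>\<psi>s. Lfun \<psi> 1) \<ge> (1 - x) / (6 * Z) * (48 * (Z * (D * q) ^ length \<psi>s)) powr (- 6 * (1 - x))"
    using L_product_lower_bound by blast
  \<comment> \<open>The cap 1/4 keeps 1 - \<delta> >= 3/4. Three L-functions to the power -6\<delta>
    cost q^(-18\<delta>), at least q^(-\<epsilon>/2); the other \<epsilon>/2 pays for the upper
    bound of L(1, f \<psi>).\<close>
  define \<delta> where "\<delta> = min (1/4) (\<epsilon> / 36)"
  have \<delta>: "\<delta> > 0" "\<delta> \<le> 1/4" "36 * \<delta> \<le> \<epsilon>" using assms(4) by (auto simp: \<delta>_def)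
  show ?thesis
  proof (cases "\<forall>(q, \<psi>)\<in>F. Re (Lfun \<psi> (of_real (1 - \<delta>))) \<ge> 0")
    case True
    define c where "c = \<delta> / (6 * Z) * (48 * (Z * D)) powr (- 6 * \<delta>)"
    have "c > 0" using \<delta> Z D by (simp add: c_def)
    moreover have "norm (Lfun \<psi> 1) \<ge> c * q powr (- \<epsilon>)" if q: "(q, \<psi>) \<in> F" for q \<psi>
    proof -
      have q1: "q \<ge> 1" and ch: "bounded_char q \<psi>" and re: "\<And>n. \<psi> n \<in> \<real>" using F[OF q] by auto
      have "norm (\<Prod>\<psi>\<leftarrow>[\<psi>]. Lfun \<psi> 1) \<ge> (1 - (1 - \<delta>)) / (6 * Z) * (48 * (Z * (D * q) ^ length [\<psi>])) powr (- 6 * (1 - (1 - \<delta>)))"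
        by (rule bound[OF q1]) (use one_plus_real_char_nonneg[OF ch re] ch re \<delta> True q in auto)
      then have "norm (Lfun \<psi> 1) \<ge> \<delta> / (6 * Z) * (48 * (Z * D) * q) powr (- 6 * \<delta>)"
        by (simp add: mult.assoc)
      also have "\<delta> / (6 * Z) * (48 * (Z * D) * q) powr (- 6 * \<delta>) = c * q powr (- 6 * \<delta>)"
        using Z D q1 by (subst powr_mult) (auto simp: c_def)
      also have "c * q powr (- \<epsilon>) \<le> c * q powr (- 6 * \<delta>)"
        using \<open>c > 0\<close> q1 \<delta> by (intro mult_left_mono powr_mono) auto
      finally show ?thesis .
    qed
    ultimately show ?thesis by (rule that)
  next
    case False
    then obtain q1 f where qf: "(q1, f) \<in> F" and neg: "Re (Lfun f (of_real (1 - \<delta>))) < 0" by force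
    have q1: "q1 \<ge> 1" and chf: "bounded_char q1 f" and ref: "\<And>n. f n \<in> \<real>" using F[OF qf] by auto
    have cont: "continuous_on {1 - \<delta>..1} (\<lambda>x. Re (Lfun f (of_real x)))"
      by (rule continuous_on_subset[OF Lfun_continuous[OF chf]]) (use \<delta> in auto)
    \<comment> \<open>L(f) changes sign between 1 - \<delta> and 1. At its zero \<beta> the product
      of the three L-values vanishes, so the sign condition of \<open>bound\<close> holds whatever
      the signs of the other two factors.\<close>
    obtain \<beta> where \<beta>: "1 - \<delta> \<le> \<beta>" "\<beta> \<le> 1" "Re (Lfun f (of_real \<beta>)) = 0"
      using IVT'[OF _ _ _ cont, of 0] neg L_real_pos[OF chf ref, of 1] \<delta> by auto
    have \<beta>1: "\<beta> < 1" using \<beta> L_real_pos[OF chf ref, of 1] by (cases "\<beta> = 1") auto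
    have "\<epsilon> / 2 > 0" using assms(4) by simp
    then obtain C where C: "C \<ge> 1" "\<And>q \<psi> x. q \<ge> 1 \<Longrightarrow> bounded_char q \<psi> \<Longrightarrow> x \<ge> 1 \<Longrightarrow>
        norm (Lfun \<psi> (of_real x)) \<le> C * q powr (\<epsilon> / 2)"
      using L_upper_bound by blast
    define c0 where "c0 = (1 - \<beta>) / (6 * Z) * (48 * (Z * (D * q1) ^ 3)) powr (- 6 * \<delta>)"
    define c1 where "c1 = c0 / ((C * q1 powr (\<epsilon> / 2)) * (C * q1 powr (\<epsilon> / 2)))"
    define S where "S = {\<psi>. (q1, \<psi>) \<in> F}"
    \<comment> \<open>For modulus q1 the product with f is not covered by \<open>indep\<close>.
      These characters are finitely many and do not vanish at 1, so the minimum is a positive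
      constant.\<close>
    define c2 where "c2 = Min ((\<lambda>\<psi>. norm (Lfun \<psi> 1)) ` S)"
    have S: "finite S" "f \<in> S" using fin qf by (auto simp: S_def)
    have c0: "c0 > 0" using \<beta>1 Z D q1 by (simp add: c0_def)
    then have c1: "c1 > 0" using C q1 by (simp add: c1_def)
    have "c2 \<in> (\<lambda>\<psi>. norm (Lfun \<psi> 1)) ` S" unfolding c2_def using S by (intro Min_in) auto
    then obtain \<psi>0 where "\<psi>0 \<in> S" "c2 = norm (Lfun \<psi>0 1)" by auto
    then have c2: "c2 > 0" using L_real_nonvanishing[of q1 \<psi>0] F[of q1 \<psi>0] by (auto simp: S_def)
    have "norm (Lfun \<psi> 1) \<ge> min c1 c2 * q powr (- \<epsilon>)" if q: "(q, \<psi>) \<in> F" for q \<psi>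
    proof -
      have q1': "q \<ge> 1" and ch: "bounded_char q \<psi>" and re: "\<And>n. \<psi> n \<in> \<real>" using F[OF q] by auto
      show ?thesis
      proof (cases "q = q1")
        case True
        then have "c2 \<le> norm (Lfun \<psi> 1)" unfolding c2_def using S q by (intro Min_le) (auto simp: S_def)
        moreover have "q powr (- \<epsilon>) \<le> 1" using q1' assms(4) powr_mono[of "- \<epsilon>" 0 q] by simp
        then have "min c1 c2 * q powr (- \<epsilon>) \<le> c2 * 1" using c1 c2 by (intro mult_mono) auto
        ultimately show ?thesis by simp
      next
        case False
        define g where "g = (\<lambda>n. f n * \<psi> n)"
        have qq: "q1 * q \<ge> 1" "q1 * q \<ge> q" "q1 * q \<ge> q1"
          using q1 q1' mult_mono[of 1 q1 1 q] mult_right_mono[of 1 q1 q] mult_left_mono[of 1 q q1] by auto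
        have chg: "bounded_char (q1 * q) g"
          unfolding g_def using bounded_char_mult[OF chf ch indep[OF qf q]] False by auto
        have "norm (\<Prod>\<psi>\<leftarrow>[f, \<psi>, g]. Lfun \<psi> 1) \<ge> (1 - \<beta>) / (6 * Z) *
            (48 * (Z * (D * (q1 * q)) ^ length [f, \<psi>, g])) powr (- 6 * (1 - \<beta>))"
        proof (rule bound[OF qq(1)])
          show "bounded_char (q1 * q) h" if "h \<in> set [f, \<psi>, g]" for h
            using that chg bounded_char_mono[OF ch qq(2)] bounded_char_mono[OF chf qq(3)] by auto
          show "h n \<in> \<real>" if "h \<in> set [f, \<psi>, g]" for h n
            using that ref re by (auto simp: g_def)
          show "1 + (\<Sum>\<psi>\<leftarrow>[f, \<psi>, g]. \<psi> d) \<in> \<real>\<^sub>\<ge>\<^sub>0" for d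
            unfolding g_def by (rule two_real_chars_nonneg[OF chf ch ref re])
        qed (use \<beta> \<beta>1 \<delta> in auto)
        also have "(48 * (Z * (D * (q1 * q)) ^ length [f, \<psi>, g])) powr (- 6 * (1 - \<beta>))
            \<ge> (48 * (Z * (D * (q1 * q)) ^ 3)) powr (- 6 * \<delta>)"
        proof -
          have "(1::real) * 1 \<le> D * (q1 * q)" using D qq by (intro mult_mono) auto
          then have "(1::real) \<le> (D * (q1 * q)) ^ 3" by (intro one_le_power) auto
          then have "(1::real) * (1 * 1) \<le> 48 * (Z * (D * (q1 * q)) ^ 3)" using Z by (intro mult_mono) auto
          then show ?thesis using \<beta> by (auto simp: numeral_3_eq_3 intro!: powr_mono)
        qed
        then have "(1 - \<beta>) / (6 * Z) * (48 * (Z * (D * (q1 * q)) ^ 3)) powr (- 6 * \<delta>) \<le>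
          (1 - \<beta>) / (6 * Z) * (48 * (Z * (D * (q1 * q)) ^ length [f, \<psi>, g])) powr (- 6 * (1 - \<beta>))"
          using \<beta>1 Z by (intro mult_left_mono) auto
        finally have "(1 - \<beta>) / (6 * Z) * (48 * (Z * (D * (q1 * q)) ^ 3)) powr (- 6 * \<delta>)
            \<le> norm (Lfun f 1) * norm (Lfun \<psi> 1) * norm (Lfun g 1)"
          by (simp add: norm_mult mult.assoc)
        also have "(48 * (Z * (D * (q1 * q)) ^ 3)) powr (- 6 * \<delta>) =
            (48 * (Z * (D * q1) ^ 3)) powr (- 6 * \<delta>) * q powr (- 18 * \<delta>)"
        proof -
          have "48 * (Z * (D * (q1 * q)) ^ 3) = (48 * (Z * (D * q1) ^ 3)) * q ^ 3"
            by (simp add: power_mult_distrib)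
          moreover have "(q ^ 3) powr (- 6 * \<delta>) = q powr (- 18 * \<delta>)"
            using q1' by (simp add: powr_powr flip: powr_numeral)
          ultimately show ?thesis using Z D q1 q1' by (simp add: powr_mult)
        qed
        also have "norm (Lfun f 1) * norm (Lfun \<psi> 1) * norm (Lfun g 1) \<le>
            (C * q1 powr (\<epsilon> / 2)) * norm (Lfun \<psi> 1) * (C * (q1 * q) powr (\<epsilon> / 2))"
          using C(2)[OF q1 chf, of 1] C(2)[OF qq(1) chg, of 1] C(1) by (intro mult_mono) auto
        also have "\<dots> = norm (Lfun \<psi> 1) * q powr (\<epsilon> / 2) * ((C * q1 powr (\<epsilon> / 2)) * (C * q1 powr (\<epsilon> / 2)))"
          using q1 q1' by (simp add: powr_mult mult_ac)
        finally have "c0 * q powr (- 18 * \<delta>) \<le> norm (Lfun \<psi> 1) * q powr (\<epsilon> / 2) * ((C * q1 powr (\<epsilon> / 2)) * (C * q1 powr (\<epsilon> / 2)))"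
          by (simp add: c0_def mult.assoc)
        then have "c1 * q powr (- 18 * \<delta>) \<le> norm (Lfun \<psi> 1) * q powr (\<epsilon> / 2)"
          using C(1) q1 by (simp add: c1_def pos_divide_le_eq)
        then have "c1 * q powr (- 18 * \<delta>) * q powr (- (\<epsilon> / 2)) \<le> norm (Lfun \<psi> 1) * q powr (\<epsilon> / 2) * q powr (- (\<epsilon> / 2))"
          by (intro mult_right_mono) auto
        then have "c1 * q powr (- 18 * \<delta> - \<epsilon> / 2) \<le> norm (Lfun \<psi> 1)"
          using q1' by (simp add: mult.assoc flip: powr_add)
        moreover have "min c1 c2 * q powr (- \<epsilon>) \<le> c1 * q powr (- 18 * \<delta> - \<epsilon> / 2)"
          using c1 c2 q1' \<delta> by (intro mult_mono powr_mono) auto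
        ultimately show ?thesis by linarith
      qed
    qed
    moreover have "min c1 c2 > 0" using c1 c2 by simp
    ultimately show ?thesis using that by blast
  qed
qed

section \<open>Lower bounds for characters with nonprincipal square\<close>

text \<open>Plays the role of a bound on L' near 1. Below N, 1 - n^(-\<delta>) <= \<delta> ln n <=
  \<delta> N^\<kappa> / \<kappa>, and the harmonic sum costs another N^\<kappa>; the tails at 1 and
  at 1 + \<delta> are at most 2q/N each.\<close>

lemma L_difference_bound:
  assumes \<kappa>: "\<kappa> > 0"
  obtains C where "C \<ge> 1"
    "\<And>q \<psi> \<delta> N. bounded_char q \<psi> \<Longrightarrow> \<delta> > 0 \<Longrightarrow> N > 0 \<Longrightarrow>
      norm (Lfun \<psi> (of_real (1 + \<delta>)) - Lfun \<psi> 1) \<le> C * \<delta> * real N powr (2 * \<kappa>) + 4 * q / real N"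
proof -
  obtain C where C: "C \<ge> 1" "\<And>N. (\<Sum>n=1..N. real n powr - 1) \<le> C * real N powr \<kappa>"
    using sum_inverse_bound[OF \<kappa>] by blast
  have "norm (Lfun \<psi> (of_real (1 + \<delta>)) - Lfun \<psi> 1) \<le> max 1 (C / \<kappa>) * \<delta> * real N powr (2 * \<kappa>) + 4 * q / real N"
    if ch: "bounded_char q \<psi>" and \<delta>: "\<delta> > 0" and N: "N > 0" for q \<psi> \<delta> N
  proof -
    let ?S = "\<lambda>x. \<Sum>n=1..N. \<psi> n * npow n (of_real x)"
    have q0: "q \<ge> 0" using bounded_partials_nonneg[OF bounded_charD(3)[OF ch]] .
    have tail: "norm (Lfun \<psi> (of_real x) - ?S x) \<le> 2 * q / real N" if "x \<ge> 1" for x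
    proof -
      have "norm (Lfun \<psi> (of_real x) - ?S x) \<le> 2 * q * real N powr (- x)"
        using that N by (intro Lfun_tail bounded_charD[OF ch]) auto
      also have "\<dots> \<le> 2 * q * real N powr (- 1)"
        using that N q0 by (intro mult_left_mono powr_mono) auto
      finally show ?thesis using N by (simp add: powr_minus_divide)
    qed
    have "norm (?S (1 + \<delta>) - ?S 1) \<le> (\<Sum>n=1..N. real n powr - 1 * (\<delta> * (real N powr \<kappa> / \<kappa>)))"
      unfolding sum_subtractf[symmetric]
    proof (rule sum_norm_le)
      fix n assume n: "n \<in> {1..N}"
      have "- (1 + \<delta>) = - 1 + - \<delta>" by simp
      then have e: "real n powr - (1 + \<delta>) = real n powr - 1 * real n powr - \<delta>"
        by (simp only: powr_add)
      have "norm (\<psi> n * npow n (of_real (1 + \<delta>)) - \<psi> n * npow n (of_real 1))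
          = norm (\<psi> n) * \<bar>real n powr - (1 + \<delta>) - real n powr - 1\<bar>"
      proof -
        have "n > 0" using n by simp
        then have "npow n (of_real (1 + \<delta>)) - npow n (of_real 1) = of_real (real n powr - (1 + \<delta>) - real n powr - 1)"
          by (simp only: npow_of_real of_real_diff)
        then show ?thesis by (simp only: right_diff_distrib[symmetric] norm_mult norm_of_real)
      qed
      also have "\<dots> \<le> \<bar>real n powr - (1 + \<delta>) - real n powr - 1\<bar>"
        using bounded_charD(2)[OF ch] by (intro mult_left_le_one_le) auto
      also have "real n powr - (1 + \<delta>) - real n powr - 1 = - (real n powr - 1 * (1 - real n powr - \<delta>))"
        unfolding e by (simp add: algebra_simps)
      also have "\<bar>- (real n powr - 1 * (1 - real n powr - \<delta>))\<bar> = real n powr - 1 * (1 - real n powr - \<delta>)"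
      proof -
        have "real n powr - \<delta> \<le> 1" using powr_mono[of "- \<delta>" 0 "real n"] n \<delta> by simp
        then show ?thesis by (simp add: abs_mult)
      qed
      also have "\<dots> \<le> real n powr - 1 * (\<delta> * (real N powr \<kappa> / \<kappa>))"
      proof (rule mult_left_mono)
        have "1 - real n powr - \<delta> \<le> \<delta> * ln (real n)"
          using n exp_ge_add_one_self[of "- \<delta> * ln (real n)"] by (simp add: powr_def)
        also have "ln (real n) \<le> real n powr \<kappa> / \<kappa>" using n \<kappa> by (intro ln_powr_bound) auto
        then have "\<delta> * ln (real n) \<le> \<delta> * (real n powr \<kappa> / \<kappa>)" using \<delta> by (intro mult_left_mono) auto
        also have "\<dots> \<le> \<delta> * (real N powr \<kappa> / \<kappa>)"
          using n \<kappa> \<delta> by (intro mult_left_mono divide_right_mono powr_mono2) auto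
        finally show "1 - real n powr - \<delta> \<le> \<delta> * (real N powr \<kappa> / \<kappa>)" .
      qed simp
      finally show "norm (\<psi> n * npow n (of_real (1 + \<delta>)) - \<psi> n * npow n (of_real 1))
          \<le> real n powr - 1 * (\<delta> * (real N powr \<kappa> / \<kappa>))" .
    qed
    also have "\<dots> = (\<Sum>n=1..N. real n powr - 1) * (\<delta> * (real N powr \<kappa> / \<kappa>))"
      by (rule sum_distrib_right[symmetric])
    also have "\<dots> \<le> C * real N powr \<kappa> * (\<delta> * (real N powr \<kappa> / \<kappa>))"
      using \<delta> \<kappa> C(2) by (intro mult_right_mono) auto
    also have "\<dots> = (C / \<kappa>) * \<delta> * real N powr (2 * \<kappa>)"
      by (simp add: field_simps flip: powr_add)
    also have "\<dots> \<le> max 1 (C / \<kappa>) * \<delta> * real N powr (2 * \<kappa>)"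
      using \<delta> by (intro mult_right_mono) auto
    finally have main: "norm (?S (1 + \<delta>) - ?S 1) \<le> max 1 (C / \<kappa>) * \<delta> * real N powr (2 * \<kappa>)" .
    have "Lfun \<psi> (of_real (1 + \<delta>)) - Lfun \<psi> 1 = (Lfun \<psi> (of_real (1 + \<delta>)) - ?S (1 + \<delta>))
        - (Lfun \<psi> (of_real 1) - ?S 1) + (?S (1 + \<delta>) - ?S 1)" by simp
    also have "norm \<dots> \<le> (2 * q / real N + 2 * q / real N) + max 1 (C / \<kappa>) * \<delta> * real N powr (2 * \<kappa>)"
      using \<delta> by (intro norm_triangle_le add_mono norm_triangle_le_diff tail main) auto
    finally show ?thesis by simp
  qed
  then show ?thesis using that[of "max 1 (C / \<kappa>)"] by auto
qed


text \<open>A relative of the 3-4-1 inequality: 3 + 4 Re z + 2 Re(z^2) = (1 + 2 Re z)^2 + 2 (1 -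
  |z|^2). The second summand vanishes on the unit circle and takes care of the places where the
  character is 0.\<close>

lemma quartic_char_nonneg:
  assumes "norm (z::complex) \<le> 1"
  shows "(\<Sum>w\<leftarrow>[1, 1, 1, z, z, cnj z, cnj z, z\<^sup>2, (cnj z)\<^sup>2]. w) \<in> \<real>\<^sub>\<ge>\<^sub>0"
proof -
  have "(norm z)\<^sup>2 \<le> 1" using assms by (simp add: power_le_one)
  then have n: "(Re z)\<^sup>2 + (Im z)\<^sup>2 \<le> 1" by (simp add: cmod_power2)
  have "3 + 4 * Re z + 2 * ((Re z)\<^sup>2 - (Im z)\<^sup>2) = (1 + 2 * Re z)\<^sup>2 + 2 * (1 - ((Re z)\<^sup>2 + (Im z)\<^sup>2))"
    by (simp add: power2_eq_square algebra_simps)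
  also have "\<dots> \<ge> 0" using n by (intro add_nonneg_nonneg) auto
  finally have "3 + 4 * Re z + 2 * ((Re z)\<^sup>2 - (Im z)\<^sup>2) \<ge> 0" .
  then show ?thesis
    unfolding complex_nonneg_Reals_iff by (simp add: power2_eq_square algebra_simps)
qed

text \<open>The nine factors have a convolution product with nonnegative coefficients and first
  coefficient 1. Conjugate characters enter so that the product is real; their L-values at real x
  are conjugates, hence the doubled exponents.\<close>

lemma product_ge_1:
  assumes ch: "bounded_char q \<psi>" and ch2: "bounded_char q (\<lambda>n. (\<psi> n)\<^sup>2)" and x: "x > 1"
  shows "(norm (zreg (of_real x)) / (x - 1)) ^ 3 * norm (Lfun \<psi> (of_real x)) ^ 4 *
         norm (Lfun (\<lambda>n. (\<psi> n)\<^sup>2) (of_real x)) ^ 2 \<ge> 1"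
proof -
  let ?\<psi>2 = "\<lambda>n. (\<psi> n)\<^sup>2" and ?\<psi>c = "\<lambda>n. cnj (\<psi> n)" and ?\<psi>c2 = "\<lambda>n. (cnj (\<psi> n))\<^sup>2"
  let ?s = "complex_of_real x"
  define fs where "fs = [\<lambda>_. 1, \<lambda>_. 1, \<lambda>_. 1, \<psi>, \<psi>, ?\<psi>c, ?\<psi>c, ?\<psi>2, ?\<psi>c2]"
  define F where "F = (\<lambda>f. infsum (\<lambda>n. f n * npow n ?s) {1..})"
  have L: "((\<lambda>n. \<psi> n * npow n ?s) has_sum Lfun \<psi> ?s) {1..}"
    and L2: "((\<lambda>n. ?\<psi>2 n * npow n ?s) has_sum Lfun ?\<psi>2 ?s) {1..}"
    using Lfun_has_sum[OF bounded_charD(3)[OF ch] bounded_charD(2)[OF ch], of ?s]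
      Lfun_has_sum[OF bounded_charD(3)[OF ch2] bounded_charD(2)[OF ch2], of ?s] x by auto
  have npc: "cnj (npow n ?s) = npow n ?s" for n
    by (simp add: npow_def exp_cnj)
  have Lc: "((\<lambda>n. ?\<psi>c n * npow n ?s) has_sum cnj (Lfun \<psi> ?s)) {1..}"
    using has_sum_cnj_iff[of "\<lambda>n. \<psi> n * npow n ?s"] L by (simp add: npc)
  have L2c: "((\<lambda>n. ?\<psi>c2 n * npow n ?s) has_sum cnj (Lfun ?\<psi>2 ?s)) {1..}"
    using has_sum_cnj_iff[of "\<lambda>n. ?\<psi>2 n * npow n ?s"] L2 by (simp add: npc)
  have z: "((\<lambda>n. 1 * npow n ?s) has_sum (zreg ?s / (?s - 1))) {1..}"
    using x by (intro zeta_series) auto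
  have F: "F (\<lambda>_. 1) = zreg ?s / (?s - 1)" "F \<psi> = Lfun \<psi> ?s" "F ?\<psi>c = cnj (Lfun \<psi> ?s)"
      "F ?\<psi>2 = Lfun ?\<psi>2 ?s" "F ?\<psi>c2 = cnj (Lfun ?\<psi>2 ?s)"
    unfolding F_def by (rule infsumI, fact z L Lc L2 L2c)+
  have Fsum: "((\<lambda>n. f n * npow n ?s) has_sum F f) {1..}" if "f \<in> set fs" for f
    using that z L Lc L2 L2c unfolding fs_def by (auto simp: F simp del: One_nat_def)
  have cm: "compl_mult f" if "f \<in> set fs" for f
    using that bounded_charD(1)[OF ch] unfolding fs_def
    by (auto simp: compl_mult_def power_mult_distrib)
  have nn: "conv_prod fs n \<in> \<real>\<^sub>\<ge>\<^sub>0" if "n > 0" for n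
  proof (rule conv_prod_nonneg[OF cm _ that])
    show "(\<Sum>f\<leftarrow>fs. f d) \<in> \<real>\<^sub>\<ge>\<^sub>0" for d
      using quartic_char_nonneg[OF bounded_charD(2)[OF ch, of d]] by (simp add: fs_def)
  qed
  have "((\<lambda>n. Re (conv_prod fs n * npow n ?s)) has_sum Re (\<Prod>f\<leftarrow>fs. F f)) {1..}"
    by (intro has_sum_Re has_sum_conv_prod Fsum)
  then have "sum (\<lambda>n. Re (conv_prod fs n * npow n ?s)) {1} \<le> Re (\<Prod>f\<leftarrow>fs. F f)"
  proof (rule finite_sum_le_has_sum)
    show "Re (conv_prod fs n * npow n ?s) \<ge> 0" if "n \<in> {1..} - {1}" for n
      using that nn[of n] by (auto simp: npow_of_real complex_nonneg_Reals_iff)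
  qed auto
  then have "1 \<le> Re (\<Prod>f\<leftarrow>fs. F f)" using conv_prod_1[of fs, OF cm] by simp
  also have "\<dots> \<le> norm (\<Prod>f\<leftarrow>fs. F f)" by (rule complex_Re_le_cmod)
  also have "(\<Prod>f\<leftarrow>fs. F f) = (zreg ?s / (?s - 1)) ^ 3 * ((Lfun \<psi> ?s)\<^sup>2 * (cnj (Lfun \<psi> ?s))\<^sup>2) *
      (Lfun ?\<psi>2 ?s * cnj (Lfun ?\<psi>2 ?s))"
    unfolding fs_def list.map prod_list.Cons prod_list.Nil F
    by (simp only: power2_eq_square power3_eq_cube mult_ac mult_1_right mult_1)
  also have "norm \<dots> = (norm (zreg ?s / (?s - 1))) ^ 3 * norm (Lfun \<psi> ?s) ^ 4 * norm (Lfun ?\<psi>2 ?s) ^ 2"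
  proof -
    have "a\<^sup>2 * a\<^sup>2 = a ^ 4" "a * a = a\<^sup>2" for a :: real
      by (simp_all add: power2_eq_square power4_eq_xxxx mult.assoc)
    then show ?thesis by (simp only: norm_mult norm_power complex_mod_cnj)
  qed
  also have "norm (zreg ?s / (?s - 1)) = norm (zreg ?s) / (x - 1)"
  proof -
    have "?s - 1 = of_real (x - 1)" by simp
    then show ?thesis using x by (simp only: norm_divide norm_of_real)
  qed
  finally show ?thesis .
qed

lemma fourth_root:
  assumes "(x::real) \<ge> 0"
  shows "(x ^ 4) powr (1/4) = x"
proof (cases "x = 0")
  case False
  then have "x ^ 4 = x powr 4" using assms by simp
  then have "(x ^ 4) powr (1/4) = x powr (4 * (1/4))" by (simp only: powr_powr)
  then show ?thesis using assms by simp
qed simp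

text \<open>At 1 + \<delta> the product inequality gives |L| >> \<delta>^(3/4), while passing to 1
  changes L by at most about \<delta>^(1 - 2\<kappa>), up to small powers of q. As 3/4 < 1, the
  choice \<delta> = c0 q^(-\<eta>) with small c0 leaves at least half of the lower bound.\<close>

theorem complex_char_lower_bound:
  assumes "0 < \<eta>" "\<eta> \<le> 1"
  obtains c where "c > 0"
    "\<And>q \<psi>. q \<ge> 1 \<Longrightarrow> bounded_char q \<psi> \<Longrightarrow> bounded_char q (\<lambda>n. (\<psi> n)\<^sup>2) \<Longrightarrow>
       norm (Lfun \<psi> 1) \<ge> c * q powr (- \<eta>)"
proof -
  \<comment> \<open>Small enough for 4\<kappa> + 2\<eta>\<kappa> + \<kappa>/2 <= \<eta>/4 =
    8\<kappa>, which makes the power of q in the difference no larger than \<open>E\<close>.\<close>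
  define \<kappa> where "\<kappa> = \<eta> / 32"
  have \<kappa>: "\<kappa> > 0" "\<kappa> \<le> 1/32" using assms by (auto simp: \<kappa>_def)
  obtain Z where Z: "Z \<ge> 1" "\<And>s. s \<in> cball 2 (3/2) \<Longrightarrow> norm (zreg s) \<le> Z"
    using zreg_bound by blast
  obtain C where C: "C \<ge> 1"
    "\<And>q \<psi> x. q \<ge> 1 \<Longrightarrow> bounded_char q \<psi> \<Longrightarrow> x \<ge> 1 \<Longrightarrow> norm (Lfun \<psi> (of_real x)) \<le> C * q powr \<kappa>"
    using L_upper_bound[OF \<kappa>(1)] by blast
  obtain D where D: "D \<ge> 1"
    "\<And>q \<psi> \<delta> N. bounded_char q \<psi> \<Longrightarrow> \<delta> > 0 \<Longrightarrow> N > 0 \<Longrightarrow>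
      norm (Lfun \<psi> (of_real (1 + \<delta>)) - Lfun \<psi> 1) \<le> D * \<delta> * real N powr (2 * \<kappa>) + 4 * q / real N"
    using L_difference_bound[OF \<kappa>(1)] by blast
  define A where "A = 2 * D + 4"
  define c1 where "c1 = (Z ^ 3 * C ^ 2) powr (- (1/4))"
  \<comment> \<open>3/16 = 15/16 - 3/4 is the surplus of the exponent of \<delta> in the difference,
    at least 15/16, over the one in the lower bound. Its inverse 16/3 yields A c0^(3/16) <=
    c1/2.\<close>
  define c0 where "c0 = min 1 ((c1 / (2 * A)) powr (16/3))"
  have A: "A > 0" using D(1) by (simp add: A_def)
  have c1: "c1 > 0" using Z(1) C(1) by (simp add: c1_def)
  have c0: "c0 > 0" "c0 \<le> 1" using c1 A by (auto simp: c0_def)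
  have c0A: "A * c0 powr (3/16) \<le> c1 / 2"
  proof -
    have "c0 powr (3/16) \<le> ((c1 / (2 * A)) powr (16/3)) powr (3/16)"
      using c0 by (intro powr_mono2) (auto simp: c0_def)
    also have "\<dots> = c1 / (2 * A)" using c1 A by (simp add: powr_powr)
    finally show ?thesis using A by (simp add: field_simps)
  qed
  have "norm (Lfun \<psi> 1) \<ge> c1 / 2 * c0 powr (3/4) * q powr (- \<eta>)"
    if q: "q \<ge> 1" and ch: "bounded_char q \<psi>" and ch2: "bounded_char q (\<lambda>n. (\<psi> n)\<^sup>2)" for q \<psi>
  proof -
    define \<delta> where "\<delta> = c0 * q powr (- \<eta>)"
    define E where "E = q powr (- (3/4) * \<eta> - \<kappa> / 2)"
    have "q powr (- \<eta>) \<le> 1" using powr_mono[of "- \<eta>" 0 q] q assms by simp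
    then have \<delta>: "0 < \<delta>" "\<delta> \<le> 1"
      using c0 q mult_mono[of c0 1 "q powr (- \<eta>)" 1] by (auto simp: \<delta>_def)
    let ?L = "norm (Lfun \<psi> (of_real (1 + \<delta>)))" and ?L2 = "norm (Lfun (\<lambda>n. (\<psi> n)\<^sup>2) (of_real (1 + \<delta>)))"
    have "complex_of_real (1 + \<delta>) \<in> cball 2 (3/2)"
    proof -
      have "2 - complex_of_real (1 + \<delta>) = of_real (1 - \<delta>)" by simp
      then have "norm (2 - complex_of_real (1 + \<delta>)) = \<bar>1 - \<delta>\<bar>" by (simp only: norm_of_real)
      then show ?thesis using \<delta> by (simp add: dist_norm)
    qed
    then have zb: "norm (zreg (of_real (1 + \<delta>))) / \<delta> \<le> Z / \<delta>"
      using Z(2) \<delta> by (intro divide_right_mono) auto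
    have L2b: "?L2 \<le> C * q powr \<kappa>" using C(2)[OF q ch2, of "1 + \<delta>"] \<delta> by simp
    have "1 \<le> (norm (zreg (of_real (1 + \<delta>))) / \<delta>) ^ 3 * ?L ^ 4 * ?L2 ^ 2"
      using product_ge_1[OF ch ch2, of "1 + \<delta>"] \<delta> by simp
    also have "\<dots> \<le> (Z / \<delta>) ^ 3 * ?L ^ 4 * (C * q powr \<kappa>) ^ 2"
      using zb L2b Z(1) \<delta> by (intro mult_mono power_mono) auto
    also have "\<dots> = ?L ^ 4 * ((Z ^ 3 * C ^ 2) * (q powr (2 * \<kappa>) * \<delta> powr (- 3)))"
    proof -
      have "(q powr \<kappa>) ^ 2 = q powr (2 * \<kappa>)" by (simp add: power2_eq_square flip: powr_add)
      moreover have "\<delta> powr (- 3) = 1 / \<delta> ^ 3" using \<delta> powr_minus_divide[of \<delta> 3] by simp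
      ultimately show ?thesis by (simp add: power_mult_distrib power_divide)
    qed
    finally have "1 powr (1/4) \<le> (?L ^ 4 * ((Z ^ 3 * C ^ 2) * (q powr (2 * \<kappa>) * \<delta> powr (- 3)))) powr (1/4)"
      by (intro powr_mono2) auto
    also have "\<dots> = ?L * ((Z ^ 3 * C ^ 2) powr (1/4) * (q powr (\<kappa> / 2) * \<delta> powr (- (3/4))))"
    proof -
      have split: "(x * (y * (u * v))) powr r = x powr r * (y powr r * (u powr r * v powr r))"
        if "x \<ge> 0" "y \<ge> 0" "u \<ge> 0" "v \<ge> 0" for x y u v r :: real
        using that by (simp add: powr_mult)
      have "(q powr (2 * \<kappa>)) powr (1/4) = q powr (\<kappa> / 2)" unfolding powr_powr by simp
      moreover have "(\<delta> powr (- 3)) powr (1/4) = \<delta> powr (- (3/4))" unfolding powr_powr by simp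
      moreover have "(Z ^ 3 * C ^ 2) \<ge> 0" using Z(1) C(1) by simp
      ultimately show ?thesis
        by (subst split) (auto simp only: fourth_root[OF norm_ge_zero] powr_ge_zero zero_le_power norm_ge_zero)
    qed
    also have "\<dots> = ?L / (c1 * (q powr (- \<kappa> / 2) * \<delta> powr (3/4)))"
      by (simp add: c1_def powr_minus_divide)
    finally have "1 \<le> ?L / (c1 * (q powr (- \<kappa> / 2) * \<delta> powr (3/4)))" by simp
    then have "c1 * (q powr (- \<kappa> / 2) * \<delta> powr (3/4)) \<le> ?L"
      using c1 q \<delta> by (simp add: pos_le_divide_eq)
    also have "c1 * (q powr (- \<kappa> / 2) * \<delta> powr (3/4)) = c1 * c0 powr (3/4) * E"
    proof -
      have "\<delta> powr (3/4) = c0 powr (3/4) * q powr (- (3/4) * \<eta>)"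
        using c0 q by (simp add: \<delta>_def powr_mult powr_powr mult.commute)
      moreover have "q powr (- \<kappa> / 2) * q powr (- (3/4) * \<eta>) = E"
        unfolding E_def powr_add[symmetric] by (rule arg_cong[where f = "\<lambda>t. q powr t"]) simp
      ultimately show ?thesis by (simp add: mult_ac)
    qed
    finally have low: "c1 * c0 powr (3/4) * E \<le> ?L" .

    \<comment> \<open>With N >= q^2/\<delta> the truncation error 4q/N is at most 4\<delta>, no
      worse than the main part of the difference, while N^(2\<kappa>) is still a small power of
      q/\<delta>.\<close>
    define N where "N = nat \<lceil>q\<^sup>2 / \<delta>\<rceil>"
    have q2: "q\<^sup>2 / \<delta> \<ge> 1"
    proof -
      have "\<delta> \<le> q\<^sup>2" using \<delta> q one_le_power[of q 2] by linarith
      then show ?thesis using \<delta> by simp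
    qed
    have N: "q\<^sup>2 / \<delta> \<le> real N" "real N \<le> 2 * (q\<^sup>2 / \<delta>)" "N > 0"
      using q2 unfolding N_def by linarith+
    have "4 * q / real N \<le> 4 * q / (q\<^sup>2 / \<delta>)"
      using N q q2 by (intro frac_le) linarith+
    also have "\<dots> = 4 * \<delta> / q" using q \<delta> by (simp add: power2_eq_square)
    also have "\<dots> \<le> 4 * \<delta> / 1" using q \<delta> by (intro divide_left_mono) auto
    finally have t1: "4 * q / real N \<le> 4 * \<delta>" by simp
    have "real N powr (2 * \<kappa>) \<le> (2 * (q\<^sup>2 / \<delta>)) powr (2 * \<kappa>)"
      using N \<kappa> by (intro powr_mono2) auto
    also have "\<dots> = 2 powr (2 * \<kappa>) * (q powr (4 * \<kappa>) * \<delta> powr (- (2 * \<kappa>)))"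
    proof -
      have "q\<^sup>2 = q powr 2" using q by simp
      then have "(q\<^sup>2) powr (2 * \<kappa>) = q powr (4 * \<kappa>)" by (simp only: powr_powr) simp
      then show ?thesis using q \<delta> by (simp add: powr_mult powr_divide powr_minus_divide)
    qed
    also have "\<dots> \<le> 2 * (q powr (4 * \<kappa>) * \<delta> powr (- (2 * \<kappa>)))"
      using \<kappa> powr_mono[of "2 * \<kappa>" 1 "2::real"] by (intro mult_right_mono) auto
    finally have t2: "real N powr (2 * \<kappa>) \<le> 2 * (q powr (4 * \<kappa>) * \<delta> powr (- (2 * \<kappa>)))" .
    have t3: "q powr (4 * \<kappa>) * \<delta> powr (- (2 * \<kappa>)) \<ge> 1"
    proof -
      have "\<delta> powr (- (2 * \<kappa>)) \<ge> \<delta> powr 0" using \<delta> \<kappa> by (intro powr_mono') auto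
      then show ?thesis
        using \<delta> \<kappa> q mult_mono[of 1 "q powr (4 * \<kappa>)" 1 "\<delta> powr (- (2 * \<kappa>))"] ge_one_powr_ge_zero[of q "4 * \<kappa>"] by simp
    qed
    have "norm (Lfun \<psi> (of_real (1 + \<delta>)) - Lfun \<psi> 1) \<le> D * \<delta> * real N powr (2 * \<kappa>) + 4 * q / real N"
      by (rule D(2)[OF ch \<delta>(1) N(3)])
    also have "\<dots> \<le> D * \<delta> * (2 * (q powr (4 * \<kappa>) * \<delta> powr (- (2 * \<kappa>)))) + 4 * \<delta> * (q powr (4 * \<kappa>) * \<delta> powr (- (2 * \<kappa>)))"
    proof (rule add_mono)
      show "D * \<delta> * real N powr (2 * \<kappa>) \<le> D * \<delta> * (2 * (q powr (4 * \<kappa>) * \<delta> powr (- (2 * \<kappa>))))"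
        using t2 D(1) \<delta> by (intro mult_left_mono) auto
      have "4 * \<delta> * 1 \<le> 4 * \<delta> * (q powr (4 * \<kappa>) * \<delta> powr (- (2 * \<kappa>)))"
        using t3 \<delta> by (intro mult_left_mono) auto
      then show "4 * q / real N \<le> 4 * \<delta> * (q powr (4 * \<kappa>) * \<delta> powr (- (2 * \<kappa>)))" using t1 by linarith
    qed
    also have "\<dots> = A * (q powr (4 * \<kappa>) * (\<delta> * \<delta> powr (- (2 * \<kappa>))))"
      by (simp add: A_def algebra_simps)
    also have "\<delta> * \<delta> powr (- (2 * \<kappa>)) = \<delta> powr (1 - 2 * \<kappa>)"
      using \<delta> by (simp add: powr_diff powr_minus_divide)
    also have "\<delta> powr (1 - 2 * \<kappa>) = c0 powr (1 - 2 * \<kappa>) * q powr (- \<eta> * (1 - 2 * \<kappa>))"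
      using c0 q by (simp add: \<delta>_def powr_mult powr_powr)
    also have "A * (q powr (4 * \<kappa>) * (c0 powr (1 - 2 * \<kappa>) * q powr (- \<eta> * (1 - 2 * \<kappa>))))
        = A * c0 powr (1 - 2 * \<kappa>) * q powr (4 * \<kappa> - \<eta> * (1 - 2 * \<kappa>))"
    proof -
      have "q powr (4 * \<kappa>) * q powr (- \<eta> * (1 - 2 * \<kappa>)) = q powr (4 * \<kappa> - \<eta> * (1 - 2 * \<kappa>))"
        unfolding powr_add[symmetric] by simp
      then have "A * c0 powr (1 - 2 * \<kappa>) * (q powr (4 * \<kappa>) * q powr (- \<eta> * (1 - 2 * \<kappa>)))
          = A * c0 powr (1 - 2 * \<kappa>) * q powr (4 * \<kappa> - \<eta> * (1 - 2 * \<kappa>))" by (simp only:)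
      then show ?thesis by (simp only: mult_ac)
    qed
    also have "\<dots> \<le> A * c0 powr (15/16) * E"
    proof (intro mult_mono mult_left_mono)
      show "c0 powr (1 - 2 * \<kappa>) \<le> c0 powr (15/16)" using c0 \<kappa> by (intro powr_mono') auto
      have "\<eta> * \<kappa> \<le> 1 * \<kappa>" using assms \<kappa> by (intro mult_right_mono) auto
      moreover have "\<eta> = 32 * \<kappa>" by (simp add: \<kappa>_def)
      moreover have "4 * \<kappa> - \<eta> * (1 - 2 * \<kappa>) = 4 * \<kappa> - \<eta> + 2 * (\<eta> * \<kappa>)" by (simp add: algebra_simps)
      ultimately have "4 * \<kappa> - \<eta> * (1 - 2 * \<kappa>) \<le> - (3/4) * \<eta> - \<kappa> / 2"
        using \<kappa> by linarith
      then show "q powr (4 * \<kappa> - \<eta> * (1 - 2 * \<kappa>)) \<le> E" unfolding E_def using q by (intro powr_mono) auto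
    qed (use A in auto)
    also have "\<dots> = (A * c0 powr (3/16)) * (c0 powr (3/4) * E)"
    proof -
      have "c0 powr (15/16) = c0 powr (3/16) * c0 powr (3/4)" unfolding powr_add[symmetric] by simp
      then show ?thesis by (simp only: mult.assoc)
    qed
    also have "\<dots> \<le> (c1 / 2) * (c0 powr (3/4) * E)"
      using c0A by (intro mult_right_mono) (auto simp: E_def)
    finally have diff: "norm (Lfun \<psi> (of_real (1 + \<delta>)) - Lfun \<psi> 1) \<le> (c1 / 2) * (c0 powr (3/4) * E)" .
    have "?L \<le> norm (Lfun \<psi> (of_real (1 + \<delta>)) - Lfun \<psi> 1) + norm (Lfun \<psi> 1)"
      using norm_triangle_ineq[of "Lfun \<psi> (of_real (1 + \<delta>)) - Lfun \<psi> 1" "Lfun \<psi> 1"] by simp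
    then have "c1 * c0 powr (3/4) * E - (c1 / 2) * (c0 powr (3/4) * E) \<le> norm (Lfun \<psi> 1)"
      using low diff by linarith
    then have "c1 / 2 * c0 powr (3/4) * E \<le> norm (Lfun \<psi> 1)" by (simp add: field_simps)
    moreover have "q powr (- \<eta>) \<le> E" unfolding E_def using q assms by (intro powr_mono) (auto simp: \<kappa>_def)
    then have "c1 / 2 * c0 powr (3/4) * q powr (- \<eta>) \<le> c1 / 2 * c0 powr (3/4) * E"
      using c1 by (intro mult_left_mono) auto
    ultimately show ?thesis by linarith
  qed
  moreover have "c1 / 2 * c0 powr (3/4) > 0" using c1 c0 by simp
  ultimately show ?thesis using that by blast
qed

section \<open>Dirichlet characters modulo a prime\<close>


lemma periodic_sum_zero:
  fixes f :: "nat \<Rightarrow> complex"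
  assumes "compl_mult f" "\<And>n. f (n mod m) = f n" "coprime u m" "f u \<noteq> 1" "m > 0"
  shows "(\<Sum>n<m. f n) = 0"
proof -
  have inj: "inj_on (\<lambda>n. u * n mod m) {..<m}"
  proof (rule inj_onI)
    fix a b assume ab: "a \<in> {..<m}" "b \<in> {..<m}" "u * a mod m = u * b mod m"
    then have "[u * a = u * b] (mod m)" by (simp add: unique_euclidean_semiring_class.cong_def)
    then have "[a = b] (mod m)" using cong_mult_lcancel_nat[of u m a b] assms(3) by simp
    then show "a = b" using ab by (simp add: unique_euclidean_semiring_class.cong_def)
  qed
  moreover have "(\<lambda>n. u * n mod m) ` {..<m} \<subseteq> {..<m}" using assms(5) by auto
  ultimately have bij: "(\<lambda>n. u * n mod m) ` {..<m} = {..<m}" by (simp add: endo_inj_surj)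
  have "f u * (\<Sum>n<m. f n) = (\<Sum>n<m. f (u * n mod m))"
    using assms(1,2) by (simp add: compl_mult_def sum_distrib_left)
  also have "\<dots> = (\<Sum>n\<in>(\<lambda>n. u * n mod m) ` {..<m}. f n)"
    by (simp add: sum.reindex[OF inj])
  also have "\<dots> = (\<Sum>n<m. f n)" by (simp only: bij)
  finally have "(f u - 1) * (\<Sum>n<m. f n) = 0" by (simp add: algebra_simps)
  then show ?thesis using assms(4) by simp
qed

lemma periodic_sum_mod:
  fixes f :: "nat \<Rightarrow> complex"
  assumes "\<And>n. f (n mod m) = f n" "(\<Sum>n<m. f n) = 0"
  shows "(\<Sum>n<N. f n) = (\<Sum>n<N mod m. f n)"
proof (induction N rule: less_induct)
  case (less N)
  show ?case
  proof (cases "N < m \<or> m = 0")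
    case False
    then have N: "N = m + (N - m)" "N - m < N" by auto
    have "(\<Sum>n<N. f n) = (\<Sum>n<m. f n) + (\<Sum>n<N - m. f (n + m))"
    proof -
      have "(\<Sum>n<m + k. f n) = (\<Sum>n<m. f n) + (\<Sum>n<k. f (n + m))" for k
        by (induction k) (simp_all add: add_ac)
      from this[of "N - m"] show ?thesis unfolding N(1)[symmetric] .
    qed
    also have "(\<Sum>n<N - m. f (n + m)) = (\<Sum>n<N - m. f n)"
    proof (rule sum.cong)
      show "f (n + m) = f n" for n using assms(1)[of "n + m"] assms(1)[of n] by simp
    qed simp
    also have "\<dots> = (\<Sum>n<(N - m) mod m. f n)" by (rule less.IH[OF N(2)])
    also have "(N - m) mod m = N mod m" using False by (simp add: le_mod_geq)
    finally show ?thesis using assms(2) by simp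
  qed auto
qed

lemma periodic_bounded_char:
  fixes f :: "nat \<Rightarrow> complex"
  assumes "compl_mult f" "\<And>n. f (n mod m) = f n" "\<And>n. norm (f n) \<le> 1"
    and "coprime u m" "f u \<noteq> 1" "m > 0"
  shows "bounded_char (real m) f"
  unfolding bounded_char_def bounded_partials_def
proof (intro conjI allI assms)
  fix N
  \<comment> \<open>Partial sums start at 1 but periods at 0; f 0 = 0 reconciles them.\<close>
  have "f (u * 0) = f u * f 0" using assms(1) unfolding compl_mult_def by blast
  then have f0: "f 0 = 0" using assms(5) by simp
  have "partial f N = (\<Sum>n<Suc N. f n)"
    by (induction N) (simp_all add: partial_Suc f0)
  also have "\<dots> = (\<Sum>n<Suc N mod m. f n)"
    by (rule periodic_sum_mod[OF assms(2) periodic_sum_zero[OF assms(1,2,4,5,6)]])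
  also have "norm \<dots> \<le> (\<Sum>n<Suc N mod m. 1)" by (intro sum_norm_le assms)
  also have "\<dots> \<le> real m" using mod_less_divisor[OF assms(6), of "Suc N"] by simp
  finally show "norm (partial f N) \<le> real m" .
qed

definition dir_char :: "nat \<Rightarrow> (int \<Rightarrow> complex) \<Rightarrow> bool" where
  "dir_char p \<phi> \<longleftrightarrow> (\<forall>x y. \<phi> (x * y) = \<phi> x * \<phi> y) \<and> (\<forall>x. \<phi> (x mod int p) = \<phi> x) \<and>
     (\<forall>x. norm (\<phi> x) = (if int p dvd x then 0 else 1))"

definition nonprincipal :: "nat \<Rightarrow> (int \<Rightarrow> complex) \<Rightarrow> bool" where
  "nonprincipal p \<phi> \<longleftrightarrow> (\<exists>u. \<not> int p dvd u \<and> \<phi> u \<noteq> 1)"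

lemma dir_charD:
  assumes "dir_char p \<phi>"
  shows "\<phi> (x * y) = \<phi> x * \<phi> y" "\<phi> (x mod int p) = \<phi> x" "int p dvd x \<Longrightarrow> \<phi> x = 0"
    "\<not> int p dvd x \<Longrightarrow> norm (\<phi> x) = 1" "norm (\<phi> x) \<le> 1"
proof -
  have *: "norm (\<phi> x) = (if int p dvd x then 0 else 1)" using assms by (auto simp: dir_char_def)
  show "\<phi> (x * y) = \<phi> x * \<phi> y" "\<phi> (x mod int p) = \<phi> x" using assms by (auto simp: dir_char_def)
  show "int p dvd x \<Longrightarrow> \<phi> x = 0" "\<not> int p dvd x \<Longrightarrow> norm (\<phi> x) = 1" "norm (\<phi> x) \<le> 1"
    using * by auto
qed

lemma dir_char_1:
  assumes "dir_char p \<phi>" "p > 1"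
  shows "\<phi> 1 = 1"
proof -
  have "norm (\<phi> 1) = 1" using assms by (intro dir_charD(4)) auto
  moreover have "\<phi> 1 = \<phi> 1 * \<phi> 1" using dir_charD(1)[OF assms(1), of 1 1] by simp
  ultimately show ?thesis by auto
qed

lemma dir_char_nat_mod: "dir_char p \<phi> \<Longrightarrow> p dvd m \<Longrightarrow> \<phi> (int (n mod m)) = \<phi> (int n)"
  by (metis dir_charD(2) mod_mod_cancel of_nat_mod)

text \<open>The factor \<open>\<theta>\<close> of modulus prime to \<open>p\<close> cannot cancel \<open>\<phi>\<close>: take \<open>u\<close> with \<open>\<phi> u \<noteq> 1\<close> and \<open>u = 1\<close> modulo \<open>m\<close>.\<close>

lemma bounded_char_twist:
  assumes \<phi>: "dir_char p \<phi>" "nonprincipal p \<phi>" and p: "prime p"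
    and \<theta>: "compl_mult \<theta>" "\<And>n. \<theta> (n mod m) = \<theta> n" "\<And>n. norm (\<theta> n) \<le> 1"
    and m: "coprime p m" "m > 0"
  shows "bounded_char (real (p * m)) (\<lambda>n. \<phi> (int n) * \<theta> n)"
proof -
  have p1: "p > 1" using prime_gt_1_nat[OF p] .
  obtain u0 where u0: "\<not> int p dvd u0" "\<phi> u0 \<noteq> 1" using \<phi>(2) by (auto simp: nonprincipal_def)
  define v where "v = nat (u0 mod int p)"
  have v: "int v = u0 mod int p" using p1 by (simp add: v_def)
  obtain u where u: "[u = v] (mod p)" "[u = 1] (mod m)"
    using binary_chinese_remainder_nat[OF m(1)] by blast
  have "int u mod int p = u0 mod int p"
    using u(1) unfolding unique_euclidean_semiring_class.cong_def by (metis mod_mod_trivial of_nat_mod v)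
  then have \<phi>u: "\<phi> (int u) = \<phi> u0" "\<not> int p dvd int u"
    using dir_charD(2)[OF \<phi>(1)] u0(1) by (metis, metis dvd_eq_mod_eq_0)
  have "coprime u p" using \<phi>u(2) p by (simp add: coprime_commute prime_imp_coprime)
  moreover have "coprime u m" using u(2) by (metis cong_imp_coprime cong_sym coprime_1_left)
  ultimately have cop: "coprime u (p * m)" by simp
  have "\<theta> u = \<theta> (1 mod m)" using u(2) \<theta>(2)[of u] by (simp add: unique_euclidean_semiring_class.cong_def)
  also have "\<dots> = 1" using \<theta>(1) unfolding \<theta>(2) compl_mult_def by blast
  finally have \<theta>u: "\<theta> u = 1" .
  show ?thesis
  proof (rule periodic_bounded_char[OF _ _ _ cop])
    show "compl_mult (\<lambda>n. \<phi> (int n) * \<theta> n)"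
      using \<theta>(1) dir_charD(1)[OF \<phi>(1)] dir_char_1[OF \<phi>(1) p1] by (simp add: compl_mult_def)
    show "\<phi> (int (n mod (p * m))) * \<theta> (n mod (p * m)) = \<phi> (int n) * \<theta> n" for n
      using dir_char_nat_mod[OF \<phi>(1), of "p * m" n] \<theta>(2)[of n] \<theta>(2)[of "n mod (p * m)"]
      by (simp add: mod_mod_cancel)
    show "norm (\<phi> (int n) * \<theta> n) \<le> 1" for n
      using mult_mono[OF dir_charD(5)[OF \<phi>(1), of "int n"] \<theta>(3)[of n]] by (simp add: norm_mult)
    show "\<phi> (int u) * \<theta> u \<noteq> 1" using \<phi>u u0 \<theta>u by simp
  qed (use p1 m in auto)
qed

section \<open>Twisting by the character modulo 3\<close>

definition chi3 :: "nat \<Rightarrow> complex" where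
  "chi3 n = (if n mod 3 = 1 then 1 else if n mod 3 = 2 then -1 else 0)"

lemma chi3_periodic: "chi3 (n mod 3) = chi3 n"
  by (simp add: chi3_def)

lemma compl_mult_chi3: "compl_mult chi3"
  unfolding compl_mult_def
proof (intro conjI allI)
  fix m n :: nat
  have small: "chi3 (a * b) = chi3 a * chi3 b" if "a \<in> {0, 1, 2}" "b \<in> {0, 1, 2}" for a b
    using that by (auto simp: chi3_def)
  have "k mod 3 \<in> {0, 1, 2}" for k :: nat
    using mod_less_divisor[of 3 k] unfolding insert_iff empty_iff by linarith
  then have "chi3 ((m mod 3) * (n mod 3)) = chi3 (m mod 3) * chi3 (n mod 3)" by (intro small)
  moreover have "chi3 ((m mod 3) * (n mod 3)) = chi3 (m * n)"
    by (subst (1 2) chi3_periodic[symmetric]) (simp only: mod_mult_eq)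
  ultimately show "chi3 (m * n) = chi3 m * chi3 n" by (simp only: chi3_periodic)
qed (simp add: chi3_def)

lemma norm_chi3: "norm (chi3 n) \<le> 1" and chi3_real: "chi3 n \<in> \<real>"
  by (simp_all add: chi3_def)

lemma dir_char_square: "dir_char p \<phi> \<Longrightarrow> dir_char p (\<lambda>x. (\<phi> x)\<^sup>2)"
  by (auto simp: dir_char_def power_mult_distrib norm_power)

lemma compl_mult_square: "compl_mult f \<Longrightarrow> compl_mult (\<lambda>n. (f n)\<^sup>2)"
  by (simp add: compl_mult_def power_mult_distrib)

text \<open>The family for \<open>siegel\<close>. The tag 3p makes distinct primes distinct moduli,
  and the condition on values singles out the \<phi> whose square is principal.\<close>

definition real_chars :: "(real \<times> (nat \<Rightarrow> complex)) set" where
  "real_chars = {(real (p * 3), \<lambda>n. \<phi> (int n) * chi3 n) | p \<phi>.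
     prime p \<and> p > 3 \<and> dir_char p \<phi> \<and> nonprincipal p \<phi> \<and> (\<forall>x. \<phi> x \<in> {-1, 0, 1})}"

lemma coprime_prime_3: "prime p \<Longrightarrow> p > 3 \<Longrightarrow> coprime p (3::nat)"
proof (rule prime_imp_coprime)
  show "\<not> p dvd 3" if "p > 3" using that dvd_imp_le[of p 3] by auto
qed

lemma chi3_twist:
  assumes "prime p" "p > 3" "dir_char p \<phi>" "nonprincipal p \<phi>"
  shows "bounded_char (real (p * 3)) (\<lambda>n. \<phi> (int n) * chi3 n)"
  using bounded_char_twist[OF assms(3,4,1) compl_mult_chi3 chi3_periodic norm_chi3 coprime_prime_3[OF assms(1,2)]]
  by simp

text \<open>By periodicity a member is determined by its values on one period, and these lie in a
  set of three elements.\<close>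

lemma finite_real_chars: "finite {\<psi>. (q, \<psi>) \<in> real_chars}"
proof (cases "\<exists>m::nat. q = real m")
  case True
  then obtain m where m: "q = real m" by blast
  let ?S = "{\<psi>. (q, \<psi>) \<in> real_chars}"
  have per: "\<psi> (n mod m) = \<psi> n" and val: "\<psi> n \<in> {-1, 0, 1}" and m0: "m > 0" if \<psi>S: "\<psi> \<in> ?S" for \<psi> n
  proof -
    obtain p \<phi> where h: "prime p" "p > 3" "q = real (p * 3)" "\<psi> = (\<lambda>n. \<phi> (int n) * chi3 n)" "dir_char p \<phi>"
        "\<forall>x. \<phi> x \<in> {-1, 0, 1}"
      using \<psi>S unfolding real_chars_def by blast
    then have mp: "m = p * 3" using m by (simp only: of_nat_eq_iff)
    have "chi3 (n mod m) = chi3 n"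
      using chi3_periodic[of "n mod m"] chi3_periodic[of n] mp by (simp add: mod_mod_cancel)
    then show "\<psi> (n mod m) = \<psi> n" using dir_char_nat_mod[OF h(5), of m n] mp h(4) by simp
    have "chi3 n \<in> {-1, 0, 1}" by (simp add: chi3_def)
    then show "\<psi> n \<in> {-1, 0, 1}" using h(6)[rule_format, of "int n"] unfolding h(4) by auto
    show "m > 0" using h mp by simp
  qed
  have "inj_on (\<lambda>\<psi>. restrict \<psi> {..<m}) ?S"
  proof (rule inj_onI, rule ext)
    fix f g n assume fg: "f \<in> ?S" "g \<in> ?S" "restrict f {..<m} = restrict g {..<m}"
    have "n mod m \<in> {..<m}" using m0[OF fg(1)] by simp
    then have "f (n mod m) = g (n mod m)" using fun_cong[OF fg(3), of "n mod m"] by simp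
    then show "f n = g n" using per[OF fg(1)] per[OF fg(2)] by simp
  qed
  moreover have "(\<lambda>\<psi>. restrict \<psi> {..<m}) ` ?S \<subseteq> {..<m} \<rightarrow>\<^sub>E {-1, 0, 1}"
    using val by (intro image_subsetI restrict_PiE_iff[THEN iffD2] ballI)
  then have "finite ((\<lambda>\<psi>. restrict \<psi> {..<m}) ` ?S)"
    by (rule finite_subset) (intro finite_PiE, auto)
  ultimately show ?thesis using finite_imageD by blast
next
  case False
  then have "{\<psi>. (q, \<psi>) \<in> real_chars} = {}" unfolding real_chars_def by blast
  then show ?thesis by simp
qed

text \<open>If \<phi>^2 is nonprincipal, so is the square of the twist, and
  \<open>complex_char_lower_bound\<close> applies; otherwise \<phi> takes the values -1, 0, 1 and
  the twist belongs to the Siegel family. Replacing 3p by p costs the factor 3^(-\<eta>).\<close>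

theorem L_chi3_lower_bound:
  assumes "\<epsilon> > 0"
  obtains c where "c > 0"
    "\<And>p \<phi>. prime p \<Longrightarrow> p > 3 \<Longrightarrow> dir_char p \<phi> \<Longrightarrow> nonprincipal p \<phi> \<Longrightarrow>
      norm (Lfun (\<lambda>n. \<phi> (int n) * chi3 n) 1) \<ge> c * real p powr (- \<epsilon>)"
proof -
  define \<eta> where "\<eta> = min 1 \<epsilon>"
  have \<eta>: "0 < \<eta>" "\<eta> \<le> 1" "\<eta> \<le> \<epsilon>" using assms by (auto simp: \<eta>_def)
  obtain c1 where c1: "c1 > 0"
    "\<And>q \<psi>. q \<ge> 1 \<Longrightarrow> bounded_char q \<psi> \<Longrightarrow> bounded_char q (\<lambda>n. (\<psi> n)\<^sup>2) \<Longrightarrow>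
       norm (Lfun \<psi> 1) \<ge> c1 * q powr (- \<eta>)"
    using complex_char_lower_bound[OF \<eta>(1,2)] by blast
  have mem: "q \<ge> 1 \<and> bounded_char q \<psi> \<and> (\<forall>n. \<psi> n \<in> \<real>)" if q\<psi>: "(q, \<psi>) \<in> real_chars" for q \<psi>
  proof -
    obtain p \<phi> where h: "prime p" "p > 3" "q = real (p * 3)" "\<psi> = (\<lambda>n. \<phi> (int n) * chi3 n)" "dir_char p \<phi>"
        "nonprincipal p \<phi>" "\<forall>x. \<phi> x \<in> {-1, 0, 1}"
      using q\<psi> unfolding real_chars_def by blast
    have "\<phi> x \<in> \<real>" for x using h(7)[rule_format, of x] by auto
    then show ?thesis using h chi3_twist[OF h(1,2,5,6)] by (auto intro!: Reals_mult chi3_real)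
  qed
  have indep: "bounded_partials (q * q') (\<lambda>n. f n * g n)"
    if qf: "(q, f) \<in> real_chars" and qg: "(q', g) \<in> real_chars" and ne: "q \<noteq> q'" for q f q' g
  proof -
    obtain p \<phi> where h: "prime p" "p > 3" "q = real (p * 3)" "f = (\<lambda>n. \<phi> (int n) * chi3 n)" "dir_char p \<phi>"
        "nonprincipal p \<phi>"
      using qf unfolding real_chars_def by blast
    obtain p' \<phi>' where h': "prime p'" "p' > 3" "q' = real (p' * 3)" "g = (\<lambda>n. \<phi>' (int n) * chi3 n)" "dir_char p' \<phi>'"
        "nonprincipal p' \<phi>'"
      using qg unfolding real_chars_def by blast
    have "p \<noteq> p'" using ne h(3) h'(3) by auto
    then have "coprime p' p" using h(1) h'(1) by (simp add: primes_coprime)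
    then have cop: "coprime p' (p * 3)" using coprime_prime_3[OF h'(1,2)] by simp
    \<comment> \<open>All of f g except \<phi>' is put into \<theta>, which has period 3p, prime to
      p'. Thus nonprincipality of \<phi>' alone carries over to the product; its modulus 3pp' is
      below q q' = 9pp'.\<close>
    define \<theta> where "\<theta> = (\<lambda>n. f n * chi3 n)"
    have chf: "bounded_char (real (p * 3)) f" unfolding h(4) by (rule chi3_twist[OF h(1,2,5,6)])
    have "bounded_char (real (p' * (p * 3))) (\<lambda>n. \<phi>' (int n) * \<theta> n)"
    proof (rule bounded_char_twist[OF h'(5,6,1) _ _ _ cop])
      show "compl_mult \<theta>" using bounded_charD(1)[OF chf] compl_mult_chi3 by (simp add: \<theta>_def compl_mult_def)
      show "\<theta> (n mod (p * 3)) = \<theta> n" for n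
        using dir_char_nat_mod[OF h(5), of "p * 3" n] chi3_periodic[of "n mod (p * 3)"] chi3_periodic[of n]
        by (simp add: \<theta>_def h(4) mod_mod_cancel)
      show "norm (\<theta> n) \<le> 1" for n
        using mult_mono[OF bounded_charD(2)[OF chf, of n] norm_chi3[of n]] by (simp add: \<theta>_def norm_mult)
    qed (use h(2) in simp)
    also have "(\<lambda>n. \<phi>' (int n) * \<theta> n) = (\<lambda>n. f n * g n)"
      by (simp add: \<theta>_def h'(4) mult_ac)
    finally have "bounded_partials (real (p' * (p * 3))) (\<lambda>n. f n * g n)" by (rule bounded_charD)
    moreover have "real (p' * (p * 3)) \<le> q * q'" by (simp add: h(3) h'(3))
    ultimately show ?thesis by (auto simp: bounded_partials_def intro: order_trans)
  qed
  obtain c2 where c2: "c2 > 0" "\<And>q \<psi>. (q, \<psi>) \<in> real_chars \<Longrightarrow> norm (Lfun \<psi> 1) \<ge> c2 * q powr (- \<eta>)"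
    using siegel[OF mem indep finite_real_chars \<eta>(1)] by blast
  define c where "c = min c1 c2 * 3 powr (- \<eta>)"
  have "norm (Lfun (\<lambda>n. \<phi> (int n) * chi3 n) 1) \<ge> c * real p powr (- \<epsilon>)"
    if p: "prime p" "p > 3" and \<phi>: "dir_char p \<phi>" "nonprincipal p \<phi>" for p \<phi>
  proof -
    let ?\<psi> = "\<lambda>n. \<phi> (int n) * chi3 n"
    have ch: "bounded_char (real (p * 3)) ?\<psi>" by (rule chi3_twist[OF p \<phi>])
    have "min c1 c2 * real (p * 3) powr (- \<eta>) \<le> norm (Lfun ?\<psi> 1)"
    proof (cases "nonprincipal p (\<lambda>x. (\<phi> x)\<^sup>2)")
      case True
      have "bounded_char (real (p * 3)) (\<lambda>n. (\<phi> (int n))\<^sup>2 * (chi3 n)\<^sup>2)"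
      proof (rule bounded_char_twist[OF dir_char_square[OF \<phi>(1)] True p(1) compl_mult_square[OF compl_mult_chi3] _ _ coprime_prime_3[OF p]])
        show "norm ((chi3 n)\<^sup>2) \<le> 1" for n using norm_chi3[of n] by (simp add: norm_power power_le_one)
      qed (simp_all add: chi3_periodic)
      then have "bounded_char (real (p * 3)) (\<lambda>n. (?\<psi> n)\<^sup>2)" by (simp add: power_mult_distrib)
      then have "c1 * real (p * 3) powr (- \<eta>) \<le> norm (Lfun ?\<psi> 1)"
        using p by (intro c1(2) ch) auto
      moreover have "min c1 c2 * real (p * 3) powr (- \<eta>) \<le> c1 * real (p * 3) powr (- \<eta>)"
        by (intro mult_right_mono) auto
      ultimately show ?thesis by linarith
    next
      case False
      have "\<phi> x \<in> {-1, 0, 1}" for x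
      proof (cases "int p dvd x")
        case True
        then show ?thesis using dir_charD(3)[OF \<phi>(1)] by simp
      next
        case nd: False
        then have "(\<phi> x)\<^sup>2 = 1" using False by (auto simp: nonprincipal_def)
        then show ?thesis by (auto simp: power2_eq_1_iff)
      qed
      then have "(real (p * 3), ?\<psi>) \<in> real_chars" using p \<phi> unfolding real_chars_def by blast
      then have "c2 * real (p * 3) powr (- \<eta>) \<le> norm (Lfun ?\<psi> 1)" by (rule c2(2))
      moreover have "min c1 c2 * real (p * 3) powr (- \<eta>) \<le> c2 * real (p * 3) powr (- \<eta>)"
        by (intro mult_right_mono) auto
      ultimately show ?thesis by linarith
    qed
    moreover have "c * real p powr (- \<epsilon>) \<le> min c1 c2 * real (p * 3) powr (- \<eta>)"
    proof -
      have "real p powr (- \<epsilon>) \<le> real p powr (- \<eta>)" using p \<eta> by (intro powr_mono) auto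
      then have "c * real p powr (- \<epsilon>) \<le> c * real p powr (- \<eta>)"
        using c1(1) c2(1) by (intro mult_left_mono) (auto simp: c_def)
      also have "\<dots> = min c1 c2 * real (p * 3) powr (- \<eta>)"
        by (simp add: c_def powr_mult mult_ac)
      finally show ?thesis .
    qed
    ultimately show ?thesis by linarith
  qed
  moreover have "c > 0" using c1(1) c2(1) by (simp add: c_def)
  ultimately show ?thesis using that by blast
qed


section \<open>Orthogonality of characters and Gauss sums\<close>

definition unit_root :: "nat \<Rightarrow> int \<Rightarrow> complex" where
  "unit_root m k = cis (2 * pi * (of_int k / of_nat m))"

lemma unit_root_add: "unit_root m (a + b) = unit_root m a * unit_root m b"
  by (simp add: unit_root_def cis_mult add_divide_distrib distrib_left)

lemma unit_root_0 [simp]: "unit_root m 0 = 1"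
  by (simp add: unit_root_def)

lemma cnj_unit_root: "cnj (unit_root m k) = unit_root m (- k)"
  by (simp add: unit_root_def cis_cnj)

lemma norm_unit_root [simp]: "norm (unit_root m k) = 1"
  by (simp add: unit_root_def)

lemma unit_root_eq_1_iff:
  assumes "m > 0"
  shows "unit_root m k = 1 \<longleftrightarrow> int m dvd k"
proof -
  have "unit_root m k = 1 \<longleftrightarrow> (\<exists>n. 2 * pi * (real_of_int k / real m) = of_int (2 * n) * pi)"
    unfolding unit_root_def cis_conv_exp exp_eq_1 by simp
  also have "\<dots> \<longleftrightarrow> (\<exists>n. real_of_int k = of_int (int m * n))"
    using assms by (intro ex_cong1) (simp add: field_simps)
  also have "\<dots> \<longleftrightarrow> int m dvd k" unfolding of_int_eq_iff dvd_def by blast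
  finally show ?thesis .
qed

lemma unit_root_cong:
  assumes "m > 0" "int m dvd a - b"
  shows "unit_root m a = unit_root m b"
proof -
  have "unit_root m (b + (a - b)) = unit_root m b * 1"
    unfolding unit_root_add using unit_root_eq_1_iff[OF assms(1)] assms(2) by simp
  then show ?thesis by simp
qed

lemma unit_root_sum:
  assumes "m > 0"
  shows "(\<Sum>j<m. unit_root m (int j * k)) = (if int m dvd k then of_nat m else 0)"
proof -
  have pow: "unit_root m (int j * k) = unit_root m k ^ j" for j
    by (induction j) (simp_all add: distrib_right unit_root_add)
  show ?thesis
  proof (cases "int m dvd k")
    case True
    then show ?thesis using unit_root_eq_1_iff[OF assms, of k] by (simp add: pow)
  next
    case False
    then have "unit_root m k \<noteq> 1" using unit_root_eq_1_iff[OF assms] by simp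
    moreover have "unit_root m k ^ m = 1" unfolding pow[symmetric] using unit_root_eq_1_iff[OF assms] by simp
    ultimately show ?thesis using False by (simp add: pow geometric_sum)
  qed
qed

text \<open>With the discrete logarithm \<open>ind\<close> to a primitive root, X j sends x to exp(2
  pi i j ind(x) / (p-1)), and orthogonality is a geometric sum over j. That these are all the
  characters is not claimed: orthogonality suffices for Parseval.\<close>

lemma dir_char_family:
  assumes p: "prime p"
  obtains X where "\<And>j. dir_char p (X j)"
    "\<And>x y. x \<in> {1..<int p} \<Longrightarrow> y \<in> {1..<int p} \<Longrightarrow>
      (\<Sum>j<p-1. X j x * cnj (X j y)) = (if x = y then of_nat (p - 1) else 0)"
proof -
  have p1: "p > 1" using prime_gt_1_nat[OF p] .
  then have m: "p - 1 > 0" by simp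
  obtain g where g: "residue_primroot p g" using prime_primitive_root_exists[OF p1 p] by blast
  have tot: "totient p = p - 1" using p by (rule totient_prime)
  have bij: "bij_betw (\<lambda>i. g ^ i mod p) {..<p - 1} (totatives p)"
    using residue_primroot_is_generator[OF p1 g] by (simp add: tot)
  have "\<exists>i<p-1. [int g ^ i = x] (mod int p)" if "\<not> int p dvd x" for x
  proof -
    have "nat (x mod int p) \<in> totatives p"
    proof -
      have "x mod int p \<noteq> 0" using that by (simp add: dvd_eq_mod_eq_0)
      then have "0 < x mod int p" "x mod int p < int p"
        using p1 pos_mod_sign[of "int p" x] pos_mod_bound[of "int p" x] by linarith+
      then have "0 < nat (x mod int p)" "nat (x mod int p) < p" by auto
      then show ?thesis using p by (auto simp: totatives_def coprime_commute intro!: prime_imp_coprime dest: dvd_imp_le)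
    qed
    then have "nat (x mod int p) \<in> (\<lambda>i. g ^ i mod p) ` {..<p - 1}"
      using bij by (simp add: bij_betw_def)
    then obtain i where i: "i < p - 1" "g ^ i mod p = nat (x mod int p)" by auto
    have "int g ^ i mod int p = int (g ^ i mod p)" by (simp add: of_nat_mod)
    also have "\<dots> = x mod int p" unfolding i(2) using p1 by simp
    finally show ?thesis using i(1) by (auto simp: unique_euclidean_semiring_class.cong_def)
  qed
  then obtain ind where ind: "\<And>x. \<not> int p dvd x \<Longrightarrow> ind x < p - 1 \<and> [int g ^ ind x = x] (mod int p)"
    by metis
  have gcop: "coprime p g" and ordg: "ord p g = p - 1" using g tot by (auto simp: residue_primroot_def)
  \<comment> \<open>The primitive root has order p - 1, so \<open>ind\<close> is additive modulo p -
    1, which is what makes X j multiplicative.\<close>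
  have expo: "[a = b] (mod (p - 1))" if "[int g ^ a = int g ^ b] (mod int p)" for a b
  proof -
    have "[g ^ a = g ^ b] (mod p)" using that by (simp add: cong_int_iff flip: of_nat_power)
    then show ?thesis using order_divides_expdiff[OF gcop] ordg by simp
  qed
  define X where "X = (\<lambda>j x. if int p dvd x then 0 else unit_root (p - 1) (int j * int (ind x)))"
  have ur: "unit_root (p - 1) (int j * int a) = unit_root (p - 1) (int j * int b)"
    if "[a = b] (mod (p - 1))" for a b j
  proof (rule unit_root_cong[OF m])
    have "[int a = int b] (mod int (p - 1))" using that by (simp add: cong_int_iff)
    then have "int (p - 1) dvd int a - int b" by (simp add: cong_iff_dvd_diff)
    then show "int (p - 1) dvd int j * int a - int j * int b"
      by (simp add: right_diff_distrib[symmetric] dvd_mult)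
  qed
  have pp: "prime (int p)" using p by simp
  have "dir_char p (X j)" for j
    unfolding dir_char_def
  proof (intro conjI allI)
    fix x y
    show "X j (x * y) = X j x * X j y"
    proof (cases "int p dvd x \<or> int p dvd y")
      case True
      then show ?thesis by (auto simp: X_def)
    next
      case False
      then have nd: "\<not> int p dvd x" "\<not> int p dvd y" "\<not> int p dvd x * y"
        using prime_dvd_multD[OF pp] by auto
      have "[int g ^ ind (x * y) = x * y] (mod int p)" using ind[OF nd(3)] by simp
      also have "[x * y = int g ^ ind x * int g ^ ind y] (mod int p)"
        using ind[OF nd(1)] ind[OF nd(2)] by (intro cong_mult) (auto simp: cong_sym)
      also have "int g ^ ind x * int g ^ ind y = int g ^ (ind x + ind y)" by (simp add: power_add)
      finally have "unit_root (p - 1) (int j * int (ind (x * y))) = unit_root (p - 1) (int j * int (ind x + ind y))"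
        by (intro ur expo)
      also have "\<dots> = unit_root (p - 1) (int j * int (ind x)) * unit_root (p - 1) (int j * int (ind y))"
        by (simp add: distrib_left unit_root_add)
      finally show ?thesis using nd by (simp add: X_def)
    qed
  next
    fix x
    show "X j (x mod int p) = X j x"
    proof (cases "int p dvd x")
      case False
      then have nd: "\<not> int p dvd x mod int p" by (simp add: dvd_mod_iff)
      have "[int g ^ ind (x mod int p) = x mod int p] (mod int p)" using ind[OF nd] by simp
      also have "[x mod int p = int g ^ ind x] (mod int p)" using ind[OF False] by (auto simp: unique_euclidean_semiring_class.cong_def)
      finally show ?thesis using False nd ur[OF expo] by (simp add: X_def)
    qed (simp add: X_def dvd_mod_iff)
  next
    fix x show "norm (X j x) = (if int p dvd x then 0 else 1)" by (simp add: X_def)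
  qed
  moreover have "(\<Sum>j<p-1. X j x * cnj (X j y)) = (if x = y then of_nat (p - 1) else 0)"
    if x: "x \<in> {1..<int p}" and y: "y \<in> {1..<int p}" for x y
  proof -
    have nd: "\<not> int p dvd x" "\<not> int p dvd y" using x y by (auto dest: zdvd_imp_le)
    have "(\<Sum>j<p-1. X j x * cnj (X j y)) = (\<Sum>j<p-1. unit_root (p - 1) (int j * (int (ind x) - int (ind y))))"
      using nd by (intro sum.cong) (simp_all add: X_def cnj_unit_root right_diff_distrib flip: unit_root_add)
    also have "\<dots> = (if int (p - 1) dvd int (ind x) - int (ind y) then of_nat (p - 1) else 0)"
      by (rule unit_root_sum[OF m])
    also have "int (p - 1) dvd int (ind x) - int (ind y) \<longleftrightarrow> x = y"
    proof
      assume "int (p - 1) dvd int (ind x) - int (ind y)"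
      then have "[int (ind x) = int (ind y)] (mod int (p - 1))" by (simp only: cong_iff_dvd_diff)
      then have "[ind x = ind y] (mod (p - 1))" by (simp only: cong_int_iff)
      then have "ind x = ind y" using ind[OF nd(1)] ind[OF nd(2)] by (simp add: unique_euclidean_semiring_class.cong_def)
      then have "[x = y] (mod int p)" using ind[OF nd(1)] ind[OF nd(2)] by (metis cong_sym cong_trans)
      then show "x = y" using x y by (simp add: unique_euclidean_semiring_class.cong_def)
    qed simp
    finally show ?thesis by simp
  qed
  ultimately show ?thesis by (rule that)
qed

lemma norm_sum_square:
  fixes f :: "'a \<Rightarrow> complex"
  shows "of_real ((norm (sum f A))\<^sup>2) = (\<Sum>x\<in>A. \<Sum>y\<in>A. f x * cnj (f y))"
  by (simp only: complex_norm_square cnj_sum sum_product)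

lemma parseval_dir_char:
  assumes X: "\<And>x y. x \<in> {1..<int p} \<Longrightarrow> y \<in> {1..<int p} \<Longrightarrow>
      (\<Sum>j<p-1. X j x * cnj (X j y)) = (if x = y then of_nat (p - 1) else 0)"
  shows "(\<Sum>j<p-1. (norm (\<Sum>x\<in>{1..<int p}. h x * X j x))\<^sup>2) = real (p - 1) * (\<Sum>x\<in>{1..<int p}. (norm (h x))\<^sup>2)"
proof -
  let ?G = "{1..<int p}"
  have "complex_of_real (\<Sum>j<p-1. (norm (\<Sum>x\<in>?G. h x * X j x))\<^sup>2)
      = (\<Sum>j<p-1. \<Sum>x\<in>?G. \<Sum>y\<in>?G. (h x * X j x) * cnj (h y * X j y))"
    by (simp only: of_real_sum norm_sum_square)
  also have "\<dots> = (\<Sum>x\<in>?G. \<Sum>y\<in>?G. \<Sum>j<p-1. (h x * X j x) * cnj (h y * X j y))"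
    by (subst sum.swap) (intro sum.cong refl sum.swap)
  also have "\<dots> = (\<Sum>x\<in>?G. \<Sum>y\<in>?G. h x * cnj (h y) * (\<Sum>j<p-1. X j x * cnj (X j y)))"
    by (simp add: sum_distrib_left mult_ac)
  also have "\<dots> = (\<Sum>x\<in>?G. \<Sum>y\<in>?G. if y = x then h x * cnj (h x) * of_nat (p - 1) else 0)"
  proof (intro sum.cong refl)
    fix x y assume xy: "x \<in> ?G" "y \<in> ?G"
    show "h x * cnj (h y) * (\<Sum>j<p-1. X j x * cnj (X j y)) = (if y = x then h x * cnj (h x) * of_nat (p - 1) else 0)"
      unfolding X[OF xy] by auto
  qed
  also have "\<dots> = (\<Sum>x\<in>?G. of_real ((norm (h x))\<^sup>2) * of_nat (p - 1))"
    by (intro sum.cong refl) (simp add: complex_norm_square del: of_real_power)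
  also have "\<dots> = complex_of_real (real (p - 1) * (\<Sum>x\<in>?G. (norm (h x))\<^sup>2))"
    by (simp add: sum_distrib_left mult.commute)
  finally show ?thesis by (simp only: of_real_eq_iff)
qed

lemma sum_mult_units:
  assumes p: "prime p" and n: "\<not> int p dvd n"
  shows "(\<Sum>x\<in>{1..<int p}. f (x * n mod int p)) = (\<Sum>x\<in>{1..<int p}. f x)"
proof -
  let ?G = "{1..<int p}" and ?h = "\<lambda>x. x * n mod int p"
  have p1: "p > 1" using prime_gt_1_nat[OF p] .
  have pp: "prime (int p)" using p by simp
  have cop: "coprime n (int p)" using prime_imp_coprime[OF pp n] by (simp add: coprime_commute)
  have inj: "inj_on ?h ?G"
  proof (rule inj_onI)
    fix x y assume xy: "x \<in> ?G" "y \<in> ?G" "?h x = ?h y"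
    then have "[x = y] (mod int p)" using cop by (metis unique_euclidean_semiring_class.cong_def cong_mult_rcancel coprime_commute)
    then show "x = y" using xy by (simp add: unique_euclidean_semiring_class.cong_def)
  qed
  have "?h ` ?G \<subseteq> ?G"
  proof (rule image_subsetI)
    fix x assume x: "x \<in> ?G"
    then have "\<not> int p dvd x" by (auto dest: zdvd_imp_le)
    then have "?h x \<noteq> 0" using n prime_dvd_multD[OF pp] by (auto simp flip: dvd_eq_mod_eq_0)
    moreover have "?h x \<ge> 0" "?h x < int p" using p1 by auto
    ultimately show "?h x \<in> ?G" by simp
  qed
  then have im: "?h ` ?G = ?G" using inj by (intro endo_inj_surj) auto
  have "(\<Sum>x\<in>?G. f x) = (\<Sum>x\<in>?h ` ?G. f x)" by (simp only: im)
  also have "\<dots> = (\<Sum>x\<in>?G. f (?h x))" by (simp add: sum.reindex[OF inj])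
  finally show ?thesis ..
qed

lemma dir_char_sum_zero:
  assumes "prime p" "dir_char p \<phi>" "nonprincipal p \<phi>"
  shows "(\<Sum>x\<in>{1..<int p}. \<phi> x) = 0"
proof -
  obtain u where u: "\<not> int p dvd u" "\<phi> u \<noteq> 1" using assms(3) by (auto simp: nonprincipal_def)
  have "(\<Sum>x\<in>{1..<int p}. \<phi> x) = (\<Sum>x\<in>{1..<int p}. \<phi> (x * u mod int p))"
    by (rule sum_mult_units[OF assms(1) u(1), symmetric])
  also have "\<dots> = (\<Sum>x\<in>{1..<int p}. \<phi> x) * \<phi> u"
    by (simp add: dir_charD[OF assms(2)] sum_distrib_right)
  finally have "(\<Sum>x\<in>{1..<int p}. \<phi> x) * (1 - \<phi> u) = 0" by (simp add: right_diff_distrib)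
  then show ?thesis using u(2) by simp
qed

definition gauss_sum :: "nat \<Rightarrow> (int \<Rightarrow> complex) \<Rightarrow> int \<Rightarrow> complex" where
  "gauss_sum p \<phi> n = (\<Sum>x\<in>{1..<int p}. \<phi> x * unit_root p (x * n))"

text \<open>Substitution of x n for x when n is a unit. For p dividing n both sides are 0, the left
  one because a nonprincipal character sums to 0; so no case distinction on n is left to later
  uses.\<close>

lemma gauss_sum_twist:
  assumes p: "prime p" and \<phi>: "dir_char p \<phi>" "nonprincipal p \<phi>"
  shows "gauss_sum p \<phi> n = cnj (\<phi> n) * gauss_sum p \<phi> 1"
proof (cases "int p dvd n")
  case True
  have p0: "p > 0" using prime_gt_0_nat[OF p] .
  have "unit_root p (x * n) = 1" for x using True unit_root_eq_1_iff[OF p0] by simp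
  then show ?thesis
    using dir_char_sum_zero[OF p \<phi>] dir_charD(3)[OF \<phi>(1) True] by (simp add: gauss_sum_def)
next
  case False
  have p0: "p > 0" using prime_gt_0_nat[OF p] .
  have "gauss_sum p \<phi> 1 = (\<Sum>x\<in>{1..<int p}. \<phi> (x * n mod int p) * unit_root p (x * n mod int p))"
    unfolding gauss_sum_def
    using sum_mult_units[OF p False, of "\<lambda>x. \<phi> x * unit_root p (x * 1)"] by simp
  also have "\<dots> = (\<Sum>x\<in>{1..<int p}. \<phi> n * (\<phi> x * unit_root p (x * n)))"
  proof (intro sum.cong refl)
    fix x
    have "unit_root p (x * n mod int p) = unit_root p (x * n)"
      by (rule unit_root_cong[OF p0]) (simp add: mod_eq_dvd_iff[symmetric])
    then show "\<phi> (x * n mod int p) * unit_root p (x * n mod int p) = \<phi> n * (\<phi> x * unit_root p (x * n))"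
      by (simp add: dir_charD[OF \<phi>(1)])
  qed
  also have "\<dots> = \<phi> n * gauss_sum p \<phi> n" by (simp add: gauss_sum_def sum_distrib_left)
  finally have "cnj (\<phi> n) * gauss_sum p \<phi> 1 = (\<phi> n * cnj (\<phi> n)) * gauss_sum p \<phi> n" by simp
  also have "\<phi> n * cnj (\<phi> n) = 1"
    using dir_charD(4)[OF \<phi>(1) False] by (simp flip: complex_norm_square)
  finally show ?thesis by simp
qed

text \<open>The sum of |G(n)|^2 over n modulo p is computed twice: as (p-1) |G(1)|^2 by the twist
  rule, and as (p-1) p by orthogonality of the additive characters.\<close>

lemma norm_gauss_sum:
  assumes p: "prime p" and \<phi>: "dir_char p \<phi>" "nonprincipal p \<phi>"
  shows "(norm (gauss_sum p \<phi> 1))\<^sup>2 = real p"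
proof -
  let ?G = "{1..<int p}"
  have p1: "p > 1" and p0: "p > 0" using prime_gt_1_nat[OF p] by auto
  have nG: "norm (\<phi> x) = 1" if "x \<in> ?G" for x
    using that by (intro dir_charD(4)[OF \<phi>(1)]) (auto dest: zdvd_imp_le)
  have "(\<Sum>n<p. (norm (gauss_sum p \<phi> (int n)))\<^sup>2) = (\<Sum>n<p. (norm (\<phi> (int n)))\<^sup>2 * (norm (gauss_sum p \<phi> 1))\<^sup>2)"
    by (subst gauss_sum_twist[OF p \<phi>]) (simp add: norm_mult power_mult_distrib)
  also have "\<dots> = (\<Sum>n<p. (norm (\<phi> (int n)))\<^sup>2) * (norm (gauss_sum p \<phi> 1))\<^sup>2"
    by (simp add: sum_distrib_right)
  also have "(\<Sum>n<p. (norm (\<phi> (int n)))\<^sup>2) = (\<Sum>n\<in>{1..<p}. 1)"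
  proof (rule sum.mono_neutral_cong_right)
    show "\<forall>n\<in>{..<p} - {1..<p}. (norm (\<phi> (int n)))\<^sup>2 = 0"
    proof
      fix n assume "n \<in> {..<p} - {1..<p}"
      then have "n = 0" by auto
      then show "(norm (\<phi> (int n)))\<^sup>2 = 0" using dir_charD(3)[OF \<phi>(1), of 0] by simp
    qed
    show "(norm (\<phi> (int n)))\<^sup>2 = 1" if "n \<in> {1..<p}" for n
      using nG[of "int n"] that by simp
  qed auto
  finally have 1: "(\<Sum>n<p. (norm (gauss_sum p \<phi> (int n)))\<^sup>2) = real (p - 1) * (norm (gauss_sum p \<phi> 1))\<^sup>2"
    by simp
  have "complex_of_real (\<Sum>n<p. (norm (gauss_sum p \<phi> (int n)))\<^sup>2)
      = (\<Sum>n<p. \<Sum>x\<in>?G. \<Sum>y\<in>?G. (\<phi> x * unit_root p (x * int n)) * cnj (\<phi> y * unit_root p (y * int n)))"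
    by (simp only: of_real_sum norm_sum_square gauss_sum_def)
  also have "\<dots> = (\<Sum>x\<in>?G. \<Sum>y\<in>?G. \<Sum>n<p. (\<phi> x * unit_root p (x * int n)) * cnj (\<phi> y * unit_root p (y * int n)))"
    by (subst sum.swap) (intro sum.cong refl sum.swap)
  also have "\<dots> = (\<Sum>x\<in>?G. \<Sum>y\<in>?G. \<phi> x * cnj (\<phi> y) * (\<Sum>n<p. unit_root p (int n * (x - y))))"
    unfolding sum_distrib_left
    by (intro sum.cong refl) (simp add: cnj_unit_root algebra_simps unit_root_add[of _ "_ * _" "- _", simplified])
  also have "\<dots> = (\<Sum>x\<in>?G. \<Sum>y\<in>?G. if y = x then of_nat p else 0)"
  proof (intro sum.cong refl)
    fix x y assume xy: "x \<in> ?G" "y \<in> ?G"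
    have "int p dvd x - y \<longleftrightarrow> y = x"
    proof
      assume "int p dvd x - y"
      then have "x mod int p = y mod int p" by (simp add: mod_eq_dvd_iff)
      then show "y = x" using xy by simp
    qed simp
    moreover have "\<phi> x * cnj (\<phi> x) = 1" using nG[OF xy(1)] by (simp flip: complex_norm_square)
    ultimately show "\<phi> x * cnj (\<phi> y) * (\<Sum>n<p. unit_root p (int n * (x - y))) = (if y = x then of_nat p else 0)"
      unfolding unit_root_sum[OF p0] by auto
  qed
  also have "\<dots> = complex_of_real (real (p - 1) * real p)" using p1 by simp
  finally have "(\<Sum>n<p. (norm (gauss_sum p \<phi> (int n)))\<^sup>2) = real (p - 1) * real p" by (simp only: of_real_eq_iff)
  then show ?thesis using 1 p1 by simp
qed

section \<open>The middle third\<close>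


text \<open>The series \<open>\<Sum>n. z\<^sup>n / n\<close> on the unit circle: after multiplication by \<open>1 - z\<close> it converges absolutely and
  uniformly on the closed disc, so \<open>- Ln (1 - z)\<close> extends to the boundary.\<close>

definition log_aux :: "complex \<Rightarrow> complex" where
  "log_aux z = (\<Sum>n. z ^ (n + 2) / (of_nat (n + 1) * of_nat (n + 2)))"

lemma log_aux_term:
  fixes z :: complex
  assumes "norm z \<le> 1"
  shows "norm (z ^ (n + 2) / (of_nat (n + 1) * of_nat (n + 2))) \<le> real (Suc n) powr - 2"
proof -
  have "norm (z ^ (n + 2)) \<le> 1" unfolding norm_power using assms by (intro power_le_one) auto
  then have "norm (z ^ (n + 2)) / (real (n + 1) * real (n + 2)) \<le> 1 / (real (n + 1) * real (n + 1))"
    by (intro frac_le mult_left_mono) auto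
  also have "\<dots> = real (Suc n) powr - 2"
    by (simp add: powr_minus_divide power2_eq_square)
  finally show ?thesis by (simp only: norm_divide norm_mult norm_of_nat)
qed

lemma summable_inverse_squares: "summable (\<lambda>n. real (Suc n) powr - 2)"
  using summable_powr_shift[of 1] by simp

lemma log_aux_sums:
  assumes "norm z \<le> 1"
  shows "(\<lambda>n. z ^ (n + 2) / (of_nat (n + 1) * of_nat (n + 2))) sums log_aux z"
  unfolding log_aux_def
  by (rule summable_sums, rule summable_comparison_test'[OF summable_inverse_squares, of 0]) (rule log_aux_term[OF assms])

lemma log_aux_continuous: "continuous_on (cball 0 1) log_aux"
proof -
  have "uniform_limit (cball 0 1) (\<lambda>N z. \<Sum>n<N. z ^ (n + 2) / (of_nat (n + 1) * of_nat (n + 2)))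
      (\<lambda>z. \<Sum>n. z ^ (n + 2) / (of_nat (n + 1) * of_nat (n + 2)) :: complex) sequentially"
    by (rule Weierstrass_m_test[OF _ summable_inverse_squares]) (rule log_aux_term, simp)
  then have "uniform_limit (cball 0 1) (\<lambda>N z. \<Sum>n<N. z ^ (n + 2) / (of_nat (n + 1) * of_nat (n + 2))) log_aux sequentially"
    by (simp only: log_aux_def[abs_def])
  then show ?thesis
    by (rule uniform_limit_theorem[rotated]) (auto intro!: always_eventually continuous_intros simp del: of_nat_Suc of_nat_add)
qed

lemma log_partial_sum:
  "(1 - z) * (\<Sum>n=1..Suc N. z ^ n / of_nat n) =
   z - (\<Sum>n<N. z ^ (n + 2) / (of_nat (n + 1) * of_nat (n + 2))) - z ^ (N + 2) / (of_nat (Suc N) :: complex)"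
proof (induction N)
  case 0
  show ?case by (simp add: power2_eq_square algebra_simps)
next
  case (Suc N)
  define a b where "a = (of_nat (N + 1) :: complex)" and "b = (of_nat (N + 2) :: complex)"
  have ab: "a \<noteq> 0" "b \<noteq> 0" "b = a + 1" by (simp_all add: a_def b_def del: of_nat_Suc) simp
  have "(1 - z) * (\<Sum>n=1..Suc (Suc N). z ^ n / of_nat n) =
      (1 - z) * (\<Sum>n=1..Suc N. z ^ n / of_nat n) + (1 - z) * (z ^ (N + 2) / b)"
    by (simp add: b_def distrib_left)
  also have "\<dots> = z - (\<Sum>n<N. z ^ (n + 2) / (of_nat (n + 1) * of_nat (n + 2))) + ((1 - z) * (z ^ (N + 2) / b) - z ^ (N + 2) / a)"
    unfolding Suc.IH by (simp add: a_def)
  also have "(1 - z) * (z ^ (N + 2) / b) - z ^ (N + 2) / a = - (z ^ (N + 2) / (a * b)) - z ^ (Suc N + 2) / b"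
  proof -
    have "1 / a - 1 / b = 1 / (a * b)" using ab by (simp add: field_simps)
    then have "z ^ (N + 2) / (a * b) = z ^ (N + 2) / a - z ^ (N + 2) / b"
      by (metis (no_types, lifting) mult.right_neutral right_diff_distrib times_divide_eq_right)
    then show ?thesis by (simp add: left_diff_distrib diff_divide_distrib)
  qed
  also have "z - (\<Sum>n<N. z ^ (n + 2) / (of_nat (n + 1) * of_nat (n + 2))) + (- (z ^ (N + 2) / (a * b)) - z ^ (Suc N + 2) / b)
      = z - (\<Sum>n<Suc N. z ^ (n + 2) / (of_nat (n + 1) * of_nat (n + 2))) - z ^ (Suc N + 2) / of_nat (Suc (Suc N))"
    unfolding sum.lessThan_Suc a_def[symmetric] b_def[symmetric] by (simp add: b_def)
  finally show ?case .
qed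

lemma log_series_limit_aux:
  assumes "norm z \<le> 1" "z \<noteq> 1"
  shows "(\<lambda>N. \<Sum>n=1..Suc N. z ^ n / of_nat n) \<longlonglongrightarrow> (z - log_aux z) / (1 - z)"
proof -
  have "(\<lambda>N. z ^ (N + 2) / (of_nat (Suc N) :: complex)) \<longlonglongrightarrow> 0"
  proof (rule tendsto_norm_zero_cancel, rule tendsto_sandwich[OF _ _ tendsto_const LIMSEQ_inverse_real_of_nat])
    have "norm (z ^ (N + 2) / (of_nat (Suc N) :: complex)) \<le> inverse (real (Suc N))" for N
    proof -
      have "norm (z ^ (N + 2)) \<le> 1" unfolding norm_power using assms(1) by (intro power_le_one) auto
      then show ?thesis by (simp add: norm_divide divide_simps del: of_nat_Suc)
    qed
    then show "\<forall>\<^sub>F N in sequentially. norm (z ^ (N + 2) / (of_nat (Suc N) :: complex)) \<le> inverse (real (Suc N))"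
      by (intro always_eventually) blast
  qed (intro always_eventually, simp)
  then have "(\<lambda>N. (z - (\<Sum>n<N. z ^ (n + 2) / (of_nat (n + 1) * of_nat (n + 2))) - z ^ (N + 2) / (of_nat (Suc N) :: complex)) / (1 - z))
      \<longlonglongrightarrow> (z - log_aux z - 0) / (1 - z)"
    using assms log_aux_sums[OF assms(1), unfolded sums_def] by (intro tendsto_intros) auto
  moreover have "(\<Sum>n=1..Suc N. z ^ n / of_nat n) =
     (z - (\<Sum>n<N. z ^ (n + 2) / (of_nat (n + 1) * of_nat (n + 2))) - z ^ (N + 2) / (of_nat (Suc N) :: complex)) / (1 - z)" for N
    unfolding log_partial_sum[symmetric] using assms(2) by simp
  ultimately show ?thesis by simp
qed

lemma log_aux_eq:
  assumes "norm z < 1"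
  shows "(z - log_aux z) / (1 - z) = - Ln (1 - z)"
proof (rule LIMSEQ_unique)
  have z1: "z \<noteq> 1" using assms by auto
  show "(\<lambda>N. \<Sum>n=1..Suc N. z ^ n / of_nat n) \<longlonglongrightarrow> (z - log_aux z) / (1 - z)"
    using assms z1 by (intro log_series_limit_aux) auto
  have "(\<lambda>n. (-1) ^ Suc n / of_nat n * (- z) ^ n) sums Ln (1 + (- z))"
    using assms by (intro Ln_series) simp
  then have "(\<lambda>n. - ((-1) ^ Suc n / of_nat n * (- z) ^ n)) sums (- Ln (1 - z))"
    using sums_minus by fastforce
  moreover have k: "- ((-1) ^ Suc n / of_nat n * (- z) ^ n) = z ^ n / of_nat n" for n
  proof -
    have "(- z) ^ n = (-1) ^ n * z ^ n" by (metis mult_minus1 power_mult_distrib)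
    moreover have "(-1) ^ n * ((-1) ^ n :: complex) = 1" by (simp flip: power_mult_distrib)
    ultimately show ?thesis by (simp add: mult.assoc[symmetric])
  qed
  ultimately have "(\<lambda>n. z ^ n / of_nat n) sums (- Ln (1 - z))" by (simp only: k)
  then have "(\<lambda>N. \<Sum>n<N. z ^ n / of_nat n) \<longlonglongrightarrow> - Ln (1 - z)" by (simp only: sums_def)
  from LIMSEQ_ignore_initial_segment[OF this, of 2]
  have "(\<lambda>N. \<Sum>n<N + 2. z ^ n / of_nat n) \<longlonglongrightarrow> - Ln (1 - z)" .
  moreover have "(\<Sum>n<N + 2. z ^ n / of_nat n) = (\<Sum>n=1..Suc N. z ^ n / of_nat n)" for N
    by (induction N) simp_all
  ultimately show "(\<lambda>N. \<Sum>n=1..Suc N. z ^ n / of_nat n) \<longlonglongrightarrow> - Ln (1 - z)" by simp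
qed

text \<open>Radial approach to z from inside the disc: \<open>log_aux\<close> is continuous up to
  the circle, and 1 - z has positive real part for z different from 1, so Ln is continuous there
  too.\<close>

lemma log_series_unit_circle:
  assumes "norm z = 1" "z \<noteq> 1"
  shows "(\<lambda>N. \<Sum>n=1..Suc N. z ^ n / of_nat n) \<longlonglongrightarrow> - Ln (1 - z)"
proof -
  define t where "t = (\<lambda>k. complex_of_real (1 - inverse (real (Suc k))))"
  have t: "t \<longlonglongrightarrow> of_real (1 - 0)" unfolding t_def
    by (intro tendsto_of_real tendsto_diff tendsto_const LIMSEQ_inverse_real_of_nat)
  have nt: "norm (t k) < 1" for k
  proof -
    have "0 < inverse (real (Suc k))" "inverse (real (Suc k)) \<le> 1" by (simp_all add: inverse_le_1_iff)
    then show ?thesis unfolding t_def norm_of_real by linarith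
  qed
  have ntz: "norm (t k * z) < 1" for k using nt[of k] assms by (simp add: norm_mult)
  have tz: "(\<lambda>k. t k * z) \<longlonglongrightarrow> z" using tendsto_mult_right[OF t, of z] by simp
  have "(\<lambda>k. log_aux (t k * z)) \<longlonglongrightarrow> log_aux z"
    by (rule continuous_on_tendsto_compose[OF log_aux_continuous tz])
       (use ntz assms in \<open>auto intro!: always_eventually less_imp_le\<close>)
  then have "(\<lambda>k. (t k * z - log_aux (t k * z)) / (1 - t k * z)) \<longlonglongrightarrow> (z - log_aux z) / (1 - z)"
    using assms(2) by (intro tendsto_intros tz) auto
  moreover have "(\<lambda>k. - Ln (1 - t k * z)) \<longlonglongrightarrow> - Ln (1 - z)"
  proof (intro tendsto_minus tendsto_Ln tendsto_diff tendsto_const tz)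
    have "Re z < 1"
    proof (rule ccontr)
      assume "\<not> Re z < 1"
      then have "Re z = 1" using complex_Re_le_cmod[of z] assms(1) by simp
      then have "(Im z)\<^sup>2 = 0" using assms(1) cmod_power2[of z] by simp
      then show False using \<open>Re z = 1\<close> assms(2) by (simp add: complex_eq_iff)
    qed
    then show "1 - z \<notin> \<real>\<^sub>\<le>\<^sub>0" by (auto simp: complex_nonpos_Reals_iff)
  qed
  ultimately have "(z - log_aux z) / (1 - z) = - Ln (1 - z)"
    unfolding log_aux_eq[OF ntz] by (rule LIMSEQ_unique)
  then show ?thesis using log_series_limit_aux[of z] assms by simp
qed

text \<open>The Fourier series of the sawtooth, as the imaginary part of the logarithm: 1 - cis
  \<theta> = 2 sin(\<theta>/2) cis((\<theta> - pi)/2), and this argument lies in the principal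
  range.\<close>

lemma sine_series:
  assumes "0 < \<theta>" "\<theta> < 2 * pi"
  shows "(\<lambda>N. \<Sum>n=1..Suc N. sin (real n * \<theta>) / real n) \<longlonglongrightarrow> (pi - \<theta>) / 2"
proof -
  have s: "sin (\<theta> / 2) > 0" using assms by (intro sin_gt_zero) auto
  define w where "w = of_real (ln (2 * sin (\<theta> / 2))) + \<i> * of_real ((\<theta> - pi) / 2)"
  have "exp w = of_real (2 * sin (\<theta> / 2)) * cis ((\<theta> - pi) / 2)"
    unfolding w_def exp_add using s by (simp add: cis_conv_exp exp_of_real)
  also have "\<dots> = 1 - cis \<theta>"
  proof (rule complex_eqI)
    have e: "(\<theta> - pi) / 2 = \<theta> / 2 - pi / 2" by (simp add: diff_divide_distrib)
    have c: "cos ((\<theta> - pi) / 2) = sin (\<theta> / 2)" "sin ((\<theta> - pi) / 2) = - cos (\<theta> / 2)"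
      unfolding e by (simp_all add: cos_diff sin_diff)
    have "cos \<theta> = 1 - 2 * (sin (\<theta> / 2))\<^sup>2" "sin \<theta> = 2 * sin (\<theta> / 2) * cos (\<theta> / 2)"
      using cos_double_sin[of "\<theta> / 2"] sin_double[of "\<theta> / 2"] by simp_all
    then show "Re (of_real (2 * sin (\<theta> / 2)) * cis ((\<theta> - pi) / 2)) = Re (1 - cis \<theta>)"
      "Im (of_real (2 * sin (\<theta> / 2)) * cis ((\<theta> - pi) / 2)) = Im (1 - cis \<theta>)"
      by (simp_all add: c power2_eq_square)
  qed
  finally have ew: "exp w = 1 - cis \<theta>" .
  have "Im w = (\<theta> - pi) / 2" by (simp add: w_def)
  then have Lw: "Ln (1 - cis \<theta>) = w" using assms ew by (intro Ln_unique) auto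
  have "cis \<theta> \<noteq> 1"
  proof
    assume "cis \<theta> = 1"
    then have "exp w = 0" using ew by simp
    then show False by simp
  qed
  then have "(\<lambda>N. \<Sum>n=1..Suc N. cis \<theta> ^ n / of_nat n) \<longlonglongrightarrow> - w"
    using log_series_unit_circle[of "cis \<theta>"] Lw by simp
  then have "(\<lambda>N. Im (\<Sum>n=1..Suc N. cis \<theta> ^ n / of_nat n)) \<longlonglongrightarrow> Im (- w)" by (rule tendsto_Im)
  moreover have "Im (\<Sum>n=1..Suc N. cis \<theta> ^ n / of_nat n) = (\<Sum>n=1..Suc N. sin (real n * \<theta>) / real n)" for N
    unfolding Im_sum by (intro sum.cong refl) (simp add: Complex.DeMoivre)
  ultimately show ?thesis using \<open>Im w = _\<close> by (simp add: diff_divide_distrib)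
qed


section \<open>Fourier series of the middle third\<close>

text \<open>The Gauss sum expansion of chi_3, which ties the character to Fourier series with breaks
  at multiples of 1/3.\<close>

lemma chi3_sin: "chi3 n = of_real (2 / sqrt 3 * sin (real n * (2 * pi / 3)))"
proof -
  have s1: "sin (2 * pi / 3) = sqrt 3 / 2"
    using sin_pi_minus[of "pi / 3"] sin_60 by simp
  have s2: "sin (4 * pi / 3) = - (sqrt 3 / 2)"
    using sin_periodic_pi2[of "pi / 3"] sin_60 by simp
  define r k where "r = n mod 3" and "k = n div 3"
  have n: "n = 3 * k + r" by (simp add: r_def k_def)
  have "real n * (2 * pi / 3) = real r * (2 * pi / 3) + 2 * real k * pi"
    unfolding n by (simp add: field_simps)
  then have "sin (real n * (2 * pi / 3)) = sin (real r * (2 * pi / 3) + 2 * real k * pi)"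
    by (simp only:)
  also have "\<dots> = sin (real r * (2 * pi / 3))"
    by (simp only: sin_add sin_2npi cos_2npi mult_1_right mult_zero_right add_0_right)
  finally have e: "sin (real n * (2 * pi / 3)) = sin (real r * (2 * pi / 3))" .
  have "r < 3" by (simp add: r_def)
  then consider "r = 0" | "r = 1" | "r = 2" by linarith
  then show ?thesis
    unfolding e chi3_def r_def[symmetric] by cases (simp_all add: s1 s2)
qed

text \<open>By the product formula for sin times cos the series is half the sum of two sawtooths at
  1/3 + x and 1/3 - x, scaled by 2/sqrt 3. Their linear parts cancel, leaving a step function with
  jumps at 1/3 and 2/3.\<close>

lemma chi3_cos_series:
  assumes x: "0 < x" "x < 1" "x \<noteq> 1/3" "x \<noteq> 2/3"
  shows "(\<lambda>N. \<Sum>n=1..Suc N. Re (chi3 n) * cos (real n * (2 * pi * x)) / real n)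
     \<longlonglongrightarrow> pi / (3 * sqrt 3) - (if 1/3 < x \<and> x < 2/3 then pi / sqrt 3 else 0)"
proof -
  have gen: "(\<lambda>N. \<Sum>n=1..Suc N. Re (chi3 n) * cos (real n * (2 * pi * x)) / real n)
     \<longlonglongrightarrow> 1 / sqrt 3 * ((pi - 2 * pi * (1/3 + x - of_int i)) / 2 + (pi - 2 * pi * (1/3 - x - of_int j)) / 2)"
    if i: "0 < 1/3 + x - of_int i" "1/3 + x - of_int i < 1" and j: "0 < 1/3 - x - of_int j" "1/3 - x - of_int j < 1" for i j :: int
  proof -
    let ?a = "2 * pi * (1/3 + x - of_int i)" and ?b = "2 * pi * (1/3 - x - of_int j)"
    have per: "sin (real n * (2 * pi * (y - of_int k))) = sin (real n * (2 * pi * y))" for n y and k :: int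
    proof -
      have e: "real n * (2 * pi * (y - of_int k)) = real n * (2 * pi * y) - (2 * pi) * of_int (int n * k)"
        by (simp add: algebra_simps)
      show ?thesis
        unfolding e sin_diff sin_int_2pin cos_int_2pin by simp
    qed
    have "Re (chi3 n) * cos (real n * (2 * pi * x)) / real n
       = 1 / sqrt 3 * (sin (real n * ?a) / real n + sin (real n * ?b) / real n)" for n
    proof -
      have "real n * (2 * pi * (1/3 + x)) = real n * (2 * pi / 3) + real n * (2 * pi * x)"
        "real n * (2 * pi * (1/3 - x)) = real n * (2 * pi / 3) - real n * (2 * pi * x)"
        by (simp_all add: algebra_simps)
      then have "sin (real n * ?a) + sin (real n * ?b) = 2 * sin (real n * (2 * pi / 3)) * cos (real n * (2 * pi * x))"
        unfolding per by (simp add: sin_add sin_diff)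
      then have "1 / sqrt 3 * (sin (real n * ?a) / real n + sin (real n * ?b) / real n)
          = 1 / sqrt 3 * (2 * sin (real n * (2 * pi / 3)) * cos (real n * (2 * pi * x))) / real n"
        by (simp flip: add_divide_distrib)
      then show ?thesis unfolding chi3_sin by simp
    qed
    then have eq: "(\<Sum>n=1..Suc N. Re (chi3 n) * cos (real n * (2 * pi * x)) / real n) =
        1 / sqrt 3 * ((\<Sum>n=1..Suc N. sin (real n * ?a) / real n) + (\<Sum>n=1..Suc N. sin (real n * ?b) / real n))" for N
      by (simp only: sum.distrib[symmetric] sum_distrib_left)
    have sine: "(\<lambda>N. \<Sum>n=1..Suc N. sin (real n * (2 * pi * y)) / real n) \<longlonglongrightarrow> (pi - 2 * pi * y) / 2"
      if y: "0 < y" "y < 1" for y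
    proof (rule sine_series)
      show "0 < 2 * pi * y" using y by simp
      show "2 * pi * y < 2 * pi" using mult_strict_left_mono[OF y(2), of "2 * pi"] by simp
    qed
    show ?thesis unfolding eq
      by (intro tendsto_mult tendsto_const tendsto_add sine i j)
  qed
  have gen': "(\<lambda>N. \<Sum>n=1..Suc N. Re (chi3 n) * cos (real n * (2 * pi * x)) / real n)
     \<longlonglongrightarrow> 1 / sqrt 3 * (pi / 3 + pi * of_int (i + j))"
    if "0 < 1/3 + x - of_int i" "1/3 + x - of_int i < 1" "0 < 1/3 - x - of_int j" "1/3 - x - of_int j < 1" for i j :: int
  proof -
    have "(pi - 2 * pi * (1/3 + x - of_int i)) / 2 + (pi - 2 * pi * (1/3 - x - of_int j)) / 2
        = pi / 3 + pi * of_int (i + j)"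
      by (simp add: field_simps)
    then show ?thesis using gen[OF that] by (simp only:)
  qed
  \<comment> \<open>i and j are the integer parts of 1/3 + x and 1/3 - x; i + j is -1 exactly in the
    middle third and 0 in the other two cases.\<close>
  consider "x < 1/3" | "1/3 < x" "x < 2/3" | "2/3 < x" using x by linarith
  then show ?thesis
  proof cases
    case 1
    have "pi / (3 * sqrt 3) - (if 1/3 < x \<and> x < 2/3 then pi / sqrt 3 else 0) = 1 / sqrt 3 * (pi / 3 + pi * of_int (0 + 0))"
      using 1 by simp
    moreover have "0 < 1/3 + x - of_int 0" "1/3 + x - of_int 0 < 1" "0 < 1/3 - x - of_int 0" "1/3 - x - of_int 0 < 1"
      using 1 x by simp_all
    note gen'[OF this]
    ultimately show ?thesis by (simp only:)
  next
    case 2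
    have "pi / (3 * sqrt 3) - (if 1/3 < x \<and> x < 2/3 then pi / sqrt 3 else 0) = 1 / sqrt 3 * (pi / 3 + pi * of_int (0 + -1))"
      using 2 by (simp add: diff_divide_distrib)
    moreover have "0 < 1/3 + x - of_int 0" "1/3 + x - of_int 0 < 1" "0 < 1/3 - x - of_int (-1)" "1/3 - x - of_int (-1) < 1"
      using 2 x by simp_all
    note gen'[OF this]
    ultimately show ?thesis by (simp only:)
  next
    case 3
    have "pi / (3 * sqrt 3) - (if 1/3 < x \<and> x < 2/3 then pi / sqrt 3 else 0) = 1 / sqrt 3 * (pi / 3 + pi * of_int (1 + -1))"
      using 3 by simp
    moreover have "0 < 1/3 + x - of_int 1" "1/3 + x - of_int 1 < 1" "0 < 1/3 - x - of_int (-1)" "1/3 - x - of_int (-1) < 1"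
      using 3 x by simp_all
    note gen'[OF this]
    ultimately show ?thesis by (simp only:)
  qed
qed

section \<open>Character sums over the middle third\<close>

definition middle_third :: "nat \<Rightarrow> int set" where
  "middle_third p = {x. int p < 3 * x \<and> 3 * x < 2 * int p}"

lemma middle_third_subset: "middle_third p \<subseteq> {1..<int p}"
  by (auto simp: middle_third_def)

text \<open>Averaging over x and p - x cancels the sines when \<phi> is even. Evenness is essential:
  the series evaluated above contains cosines only.\<close>

lemma gauss_sum_even:
  assumes p: "prime p" and \<phi>: "dir_char p \<phi>" and even: "\<phi> (-1) = 1"
  shows "gauss_sum p \<phi> n = (\<Sum>x\<in>{1..<int p}. \<phi> x * of_real (cos (of_int n * (2 * pi * (of_int x / real p)))))"
proof -
  let ?G = "{1..<int p}"
  have p0: "p > 0" using prime_gt_0_nat[OF p] .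
  have reflect: "gauss_sum p \<phi> n = (\<Sum>x\<in>?G. \<phi> x * unit_root p (- (x * n)))"
    unfolding gauss_sum_def
  proof (rule sum.reindex_bij_witness[where i = "\<lambda>x. int p - x" and j = "\<lambda>x. int p - x"])
    fix x assume "x \<in> ?G"
    have "\<phi> (int p - x) = \<phi> ((int p - x) mod int p)" by (rule dir_charD(2)[OF \<phi>, symmetric])
    also have "(int p - x) mod int p = (-1 * x) mod int p" by simp
    also have "\<phi> \<dots> = \<phi> (-1) * \<phi> x" by (simp only: dir_charD(1,2)[OF \<phi>])
    finally have "\<phi> (int p - x) = \<phi> x" using even by simp
    moreover have "unit_root p (- ((int p - x) * n)) = unit_root p (x * n)"
      by (rule unit_root_cong[OF p0]) (simp add: algebra_simps)
    ultimately show "\<phi> (int p - x) * unit_root p (- ((int p - x) * n)) = \<phi> x * unit_root p (x * n)" by simp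
  qed auto
  have cs: "unit_root p (x * n) + unit_root p (- (x * n)) = 2 * of_real (cos (of_int n * (2 * pi * (of_int x / real p))))" for x
  proof -
    have "2 * pi * (of_int (x * n) / real p) = of_int n * (2 * pi * (of_int x / real p))" by simp
    then have "Re (unit_root p (x * n)) = cos (of_int n * (2 * pi * (of_int x / real p)))"
      by (simp only: unit_root_def cis.sel)
    moreover have "unit_root p (x * n) + unit_root p (- (x * n)) = of_real (2 * Re (unit_root p (x * n)))"
      unfolding cnj_unit_root[symmetric] by (rule complex_add_cnj)
    ultimately show ?thesis by simp
  qed
  have "2 * gauss_sum p \<phi> n = (\<Sum>x\<in>?G. \<phi> x * (unit_root p (x * n) + unit_root p (- (x * n))))"
    unfolding distrib_left sum.distrib reflect[symmetric] by (simp add: gauss_sum_def)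
  also have "\<dots> = 2 * (\<Sum>x\<in>?G. \<phi> x * of_real (cos (of_int n * (2 * pi * (of_int x / real p)))))"
    unfolding cs sum_distrib_left by (rule sum.cong[OF refl]) (rule mult.left_commute)
  finally show ?thesis by simp
qed

lemma dir_char_cnj: "dir_char p \<phi> \<Longrightarrow> dir_char p (\<lambda>x. cnj (\<phi> x))"
  by (simp add: dir_char_def)

lemma nonprincipal_cnj: "nonprincipal p \<phi> \<Longrightarrow> nonprincipal p (\<lambda>x. cnj (\<phi> x))"
  by (auto simp: nonprincipal_def)

text \<open>The twist rule turns G(\<phi>) conj(\<phi>(n)) into G evaluated at n, so partial sums of
  the L-series become finite sums over x of cosine partial sums, where limits may be taken termwise.
  The constant part of the step function disappears because \<phi> sums to 0.\<close>

lemma middle_third_L: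
  assumes p: "prime p" "p > 3" and \<phi>: "dir_char p \<phi>" "nonprincipal p \<phi>" and even: "\<phi> (-1) = 1"
  shows "gauss_sum p \<phi> 1 * Lfun (\<lambda>n. cnj (\<phi> (int n)) * chi3 n) 1 = - of_real (pi / sqrt 3) * (\<Sum>x\<in>middle_third p. \<phi> x)"
proof -
  let ?G = "{1..<int p}" and ?\<psi> = "\<lambda>n. cnj (\<phi> (int n)) * chi3 n"
  have p0: "p > 0" using p by simp
  have ch: "bounded_char (real (p * 3)) ?\<psi>"
    by (rule chi3_twist[OF p dir_char_cnj[OF \<phi>(1)] nonprincipal_cnj[OF \<phi>(2)]])
  have "(\<lambda>N. \<Sum>n=1..N. ?\<psi> n * npow n 1) \<longlonglongrightarrow> Lfun ?\<psi> 1"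
    by (rule Lfun_limit[OF bounded_charD(3)[OF ch]]) simp
  from tendsto_mult_left[OF LIMSEQ_Suc[OF this], of "gauss_sum p \<phi> 1"]
  have lim1: "(\<lambda>N. gauss_sum p \<phi> 1 * (\<Sum>n=1..Suc N. ?\<psi> n * npow n 1)) \<longlonglongrightarrow> gauss_sum p \<phi> 1 * Lfun ?\<psi> 1" .
  let ?c = "\<lambda>x N. \<Sum>n=1..Suc N. Re (chi3 n) * cos (real n * (2 * pi * (of_int x / real p))) / real n"
  have eq: "gauss_sum p \<phi> 1 * (\<Sum>n=1..Suc N. ?\<psi> n * npow n 1) = (\<Sum>x\<in>?G. \<phi> x * of_real (?c x N))" for N
  proof -
    have "gauss_sum p \<phi> 1 * (?\<psi> n * npow n 1)
        = (\<Sum>x\<in>?G. \<phi> x * of_real (Re (chi3 n) * cos (real n * (2 * pi * (of_int x / real p))) / real n))"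
      if n: "n \<in> {1..Suc N}" for n
    proof -
      have "npow n 1 = of_real (1 / real n)"
        using n npow_of_real[of n 1] by (simp add: powr_minus_divide)
      moreover have "chi3 n = of_real (Re (chi3 n))" using chi3_real[of n] by simp
      ultimately have "gauss_sum p \<phi> 1 * (?\<psi> n * npow n 1)
          = gauss_sum p \<phi> (int n) * of_real (Re (chi3 n) / real n)"
        unfolding gauss_sum_twist[OF p(1) \<phi>, of "int n"] by (metis (no_types, lifting) mult.assoc mult.commute of_real_mult times_divide_eq_right mult.right_neutral)
      also have "\<dots> = (\<Sum>x\<in>?G. \<phi> x * of_real (Re (chi3 n) * cos (real n * (2 * pi * (of_int x / real p))) / real n))"
        unfolding gauss_sum_even[OF p(1) \<phi>(1) even] sum_distrib_right by (intro sum.cong refl) simp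
      finally show ?thesis .
    qed
    then have "gauss_sum p \<phi> 1 * (\<Sum>n=1..Suc N. ?\<psi> n * npow n 1)
        = (\<Sum>n=1..Suc N. \<Sum>x\<in>?G. \<phi> x * of_real (Re (chi3 n) * cos (real n * (2 * pi * (of_int x / real p))) / real n))"
      unfolding sum_distrib_left by (intro sum.cong refl)
    also have "\<dots> = (\<Sum>x\<in>?G. \<phi> x * of_real (?c x N))"
      by (subst sum.swap) (simp only: sum_distrib_left of_real_sum)
    finally show ?thesis .
  qed
  let ?l = "\<lambda>x. pi / (3 * sqrt 3) - (if x \<in> middle_third p then pi / sqrt 3 else 0)"
  have lim2: "(\<lambda>N. \<Sum>x\<in>?G. \<phi> x * of_real (?c x N)) \<longlonglongrightarrow> (\<Sum>x\<in>?G. \<phi> x * of_real (?l x))"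
  proof (intro tendsto_sum tendsto_mult tendsto_const tendsto_of_real)
    fix x assume x: "x \<in> ?G"
    \<comment> \<open>As p is prime to 3, x/p never meets a jump of the step function.\<close>
    have n3: "3 * x \<noteq> int p" "3 * x \<noteq> 2 * int p"
    proof -
      have "\<not> 3 dvd p" using p primes_dvd_imp_eq[of 3 p] by auto
      then have "\<not> 3 dvd int p" by presburger
      then show "3 * x \<noteq> int p" "3 * x \<noteq> 2 * int p" by presburger+
    qed
    have i: "real_of_int x / real p = 1/3 \<longleftrightarrow> 3 * x = int p" "real_of_int x / real p = 2/3 \<longleftrightarrow> 3 * x = 2 * int p"
      "1/3 < real_of_int x / real p \<longleftrightarrow> int p < 3 * x" "real_of_int x / real p < 2/3 \<longleftrightarrow> 3 * x < 2 * int p"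
      using p0 by (simp_all add: field_simps) linarith+
    have "0 < real_of_int x / real p" "real_of_int x / real p < 1" using x p0 by auto
    from chi3_cos_series[OF this] n3 show "?c x \<longlonglongrightarrow> ?l x"
      unfolding i middle_third_def by simp
  qed
  have "gauss_sum p \<phi> 1 * Lfun ?\<psi> 1 = (\<Sum>x\<in>?G. \<phi> x * of_real (?l x))"
    using lim1 lim2 unfolding eq by (rule LIMSEQ_unique)
  also have "\<dots> = (\<Sum>x\<in>?G. \<phi> x) * of_real (pi / (3 * sqrt 3)) - (\<Sum>x\<in>?G. if x \<in> middle_third p then \<phi> x * of_real (pi / sqrt 3) else 0)"
    unfolding sum_distrib_right sum_subtractf[symmetric]
    by (intro sum.cong refl) (simp only: of_real_diff right_diff_distrib, simp)
  also have "(\<Sum>x\<in>?G. if x \<in> middle_third p then \<phi> x * of_real (pi / sqrt 3) else 0) = (\<Sum>x\<in>middle_third p. \<phi> x * of_real (pi / sqrt 3))"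
    using middle_third_subset[of p] by (simp add: sum.inter_restrict[symmetric] Int_absorb1)
  finally show ?thesis
    unfolding dir_char_sum_zero[OF p(1) \<phi>] sum_distrib_right[symmetric] by (simp only: mult.commute) simp
qed

lemma middle_third_lower_bound:
  assumes "prime p" "p > 3" "dir_char p \<phi>" "nonprincipal p \<phi>" "\<phi> (-1) = 1"
  shows "sqrt (real p) * norm (Lfun (\<lambda>n. cnj (\<phi> (int n)) * chi3 n) 1) / 2 \<le> norm (\<Sum>x\<in>middle_third p. \<phi> x)"
proof -
  let ?M = "norm (\<Sum>x\<in>middle_third p. \<phi> x)"
  have "sqrt (real p) = norm (gauss_sum p \<phi> 1)"
    using norm_gauss_sum[OF assms(1,3,4)] by (simp add: real_sqrt_unique)
  then have "sqrt (real p) * norm (Lfun (\<lambda>n. cnj (\<phi> (int n)) * chi3 n) 1)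
      = norm (- of_real (pi / sqrt 3) * (\<Sum>x\<in>middle_third p. \<phi> x))"
    unfolding middle_third_L[OF assms, symmetric] by (simp add: norm_mult)
  also have "\<dots> = pi / sqrt 3 * ?M"
    by (simp add: norm_mult norm_divide)
  also have "\<dots> \<le> 2 * ?M"
  proof (rule mult_right_mono)
    have "(17/10)\<^sup>2 \<le> (3::real)" by (simp add: power2_eq_square)
    then have "17/10 \<le> sqrt 3" by (rule real_le_rsqrt)
    moreover have "pi < 34/10" using pi_less_4 pi_approx by simp
    ultimately have "pi \<le> 2 * sqrt 3" by linarith
    then show "pi / sqrt 3 \<le> 2" by (simp add: pos_divide_le_eq)
  qed simp
  finally show ?thesis by simp
qed

text \<open>The count is (p-1)/3 or (p+1)/3 according to p modulo 3. That its share of the p - 1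
  units is never below 1/3 makes the average over dilates at least |A|/3.\<close>

lemma card_middle_third:
  assumes "prime p" "p > 3"
  shows "real (card (middle_third p)) \<ge> (real p - 1) / 3"
proof -
  have "\<not> 3 dvd p" using assms primes_dvd_imp_eq[of 3 p] by auto
  then have nd: "\<not> 3 dvd int p" by presburger
  have "middle_third p = {int p div 3 + 1..2 * int p div 3}"
    unfolding middle_third_def using nd by (auto; presburger)
  then have "int (card (middle_third p)) = 2 * int p div 3 - int p div 3" by simp
  moreover have "3 * (2 * int p div 3 - int p div 3) \<ge> int p - 1" using nd by presburger
  ultimately have "3 * int (card (middle_third p)) \<ge> int p - 1" by simp
  then have "real_of_int (int p - 1) \<le> real_of_int (3 * int (card (middle_third p)))"
    by (simp only: of_int_le_iff)
  then show ?thesis by simp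
qed

section \<open>Sum-free sets and cosets\<close>


lemma Fp_simps:
  assumes "p > 1"
  shows "carrier (Fp p) = {0..int p - 1}" "x \<oplus>\<^bsub>Fp p\<^esub> y = (x + y) mod int p" "\<zero>\<^bsub>Fp p\<^esub> = 0"
    "\<ominus>\<^bsub>Fp p\<^esub> \<one>\<^bsub>Fp p\<^esub> = (- 1) mod int p"
proof -
  interpret residues "int p" "Fp p" using assms by unfold_locales auto
  show "carrier (Fp p) = {0..int p - 1}" by (rule res_carrier_eq)
  show "x \<oplus>\<^bsub>Fp p\<^esub> y = (x + y) mod int p" by (rule res_add_eq)
  show "\<zero>\<^bsub>Fp p\<^esub> = 0" by (rule res_zero_eq)
  show "\<ominus>\<^bsub>Fp p\<^esub> \<one>\<^bsub>Fp p\<^esub> = (- 1) mod int p" by (simp only: res_neg_eq res_one_eq)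
qed

lemma Fp_star_simps:
  assumes "prime p"
  shows "group (Fp_star p)" "carrier (Fp_star p) = {1..<int p}" "x \<otimes>\<^bsub>Fp_star p\<^esub> y = x * y mod int p"
proof -
  have p1: "p > 1" using prime_gt_1_nat[OF assms] .
  interpret residues_prime p "Fp p" using assms by (unfold_locales) (auto simp: p1)
  show "group (Fp_star p)" by (rule units_group)
  show "carrier (Fp_star p) = {1..<int p}"
    unfolding units_of_carrier res_prime_units_eq by auto
  show "x \<otimes>\<^bsub>Fp_star p\<^esub> y = x * y mod int p"
    by (simp add: units_of_mult res_mult_eq)
qed

lemma sf_ge:
  assumes "finite A" "S \<subseteq> A" "sum_free R S"
  shows "card S \<le> sf R A"
  unfolding sf_def using assms by (intro Max_ge) auto

text \<open>\<open>0 + 0 = 0\<close>, so \<open>0\<close> lies in no sum-free set.\<close>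

lemma sf_remove_zero:
  assumes "p > 1"
  shows "sf (Fp p) (A - {0}) = sf (Fp p) A"
proof -
  have "0 \<notin> S" if "sum_free (Fp p) S" for S
    using that unfolding sum_free_def Fp_simps(2)[OF assms] by fastforce
  then have "{S. S \<subseteq> A - {0} \<and> sum_free (Fp p) S} = {S. S \<subseteq> A \<and> sum_free (Fp p) S}" by auto
  then show ?thesis by (simp add: sf_def)
qed

text \<open>Dilation respects addition modulo p, and for a, b, c in the middle third 0 < a + b - c <
  p, which rules out a + b = c modulo p.\<close>

lemma dilate_sum_free:
  assumes "p > 1"
  shows "sum_free (Fp p) {a \<in> A. a * u mod int p \<in> middle_third p}"
  unfolding sum_free_def Fp_simps(2)[OF assms]
proof (safe)
  fix x y assume h: "x * u mod int p \<in> middle_third p" "y * u mod int p \<in> middle_third p"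
    "(x + y) mod int p * u mod int p \<in> middle_third p"
  define a b c where "a = x * u mod int p" and "b = y * u mod int p" and "c = (x + y) mod int p * u mod int p"
  have "c = (x * u + y * u) mod int p" by (simp add: c_def mod_mult_left_eq distrib_right)
  also have "\<dots> = (a + b) mod int p" by (simp add: a_def b_def mod_add_eq)
  finally have "(a + b) mod int p = c mod int p" by (simp add: c_def)
  then have "int p dvd a + b - c" by (simp only: mod_eq_dvd_iff)
  moreover have "0 < a + b - c" "a + b - c < int p"
    using h unfolding a_def[symmetric] b_def[symmetric] c_def[symmetric] middle_third_def by auto
  ultimately show False using zdvd_imp_le by fastforce
qed

lemma of_real_of_bool: "complex_of_real (of_bool b) = of_bool b"
  by (cases b) simp_all

text \<open>The substitution x = u a, with a invertible. It is what turns the transform of a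
  dilation count into a product of two character sums.\<close>

lemma dilate_char_sum:
  assumes p: "prime p" and \<phi>: "dir_char p \<phi>" and a: "a \<in> {1..<int p}" and M: "M \<subseteq> {1..<int p}"
  shows "(\<Sum>u\<in>{1..<int p}. \<phi> u * of_bool (u * a mod int p \<in> M)) = cnj (\<phi> a) * (\<Sum>x\<in>M. \<phi> x)"
proof -
  let ?G = "{1..<int p}"
  have nd: "\<not> int p dvd a" using a by (auto dest: zdvd_imp_le)
  have n1: "cnj (\<phi> a) * \<phi> a = 1"
    using dir_charD(4)[OF \<phi> nd] by (simp add: mult.commute[of "cnj _"] flip: complex_norm_square)
  have "(\<Sum>x\<in>M. \<phi> x) = (\<Sum>x\<in>?G. \<phi> x * of_bool (x \<in> M))"
    using M by (simp add: sum.If_cases of_bool_def if_distrib Int_absorb1 cong: if_cong)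
  also have "\<dots> = (\<Sum>u\<in>?G. \<phi> (u * a mod int p) * of_bool (u * a mod int p \<in> M))"
    by (rule sum_mult_units[OF p nd, symmetric])
  also have "\<dots> = (\<Sum>u\<in>?G. \<phi> a * (\<phi> u * of_bool (u * a mod int p \<in> M)))"
    by (simp add: dir_charD[OF \<phi>] mult_ac)
  finally have "cnj (\<phi> a) * (\<Sum>x\<in>M. \<phi> x) = (cnj (\<phi> a) * \<phi> a) * (\<Sum>u\<in>?G. \<phi> u * of_bool (u * a mod int p \<in> M))"
    by (simp only: sum_distrib_left mult.assoc)
  then show ?thesis unfolding n1 by (simp only: mult_1)
qed

lemma norm_sum_cnj: "norm (\<Sum>a\<in>A. cnj (f a)) = norm (\<Sum>a\<in>A. f a)"
  by (simp flip: cnj_sum)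

text \<open>No dilate of the middle third meets \<open>A\<close> in more than \<open>|A|/3 + \<psi>\<close> points, while the average over the dilates is at
  least \<open>|A|/3\<close>. Hence the deviation is at most \<open>2 \<psi>\<close> on average, also in absolute value.\<close>

lemma char_sum_bound:
  assumes p: "prime p" "p > 3" and \<phi>: "dir_char p \<phi>" "nonprincipal p \<phi>" and A: "A \<subseteq> {1..<int p}"
    and \<psi>: "real (sf (Fp p) A) = real (card A) / 3 + \<psi>"
  shows "\<psi> \<ge> 0" "norm (\<Sum>a\<in>A. \<phi> a) * norm (\<Sum>x\<in>middle_third p. \<phi> x) \<le> 2 * \<psi> * (real p - 1)"
proof -
  let ?G = "{1..<int p}" and ?M = "middle_third p"
  have p1: "p > 1" using p by simp
  have finA: "finite A" using A finite_subset by blast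
  have cG: "real (card ?G) = real p - 1" using p1 by (simp add: of_nat_diff)
  define F where "F = (\<lambda>u. (\<Sum>a\<in>A. of_bool (u * a mod int p \<in> ?M)) - real (card A) / 3)"
  have F_le: "F u \<le> \<psi>" for u
  proof -
    have "(\<Sum>a\<in>A. of_bool (u * a mod int p \<in> ?M)) = real (card {a \<in> A. a * u mod int p \<in> ?M})"
      using finA by (simp add: of_bool_def mult.commute sum.If_cases Int_def)
    also have "card {a \<in> A. a * u mod int p \<in> ?M} \<le> sf (Fp p) A"
      by (intro sf_ge finA dilate_sum_free[OF p1]) auto
    finally show ?thesis using \<psi> by (simp add: F_def)
  qed
  have M_count: "(\<Sum>u\<in>?G. of_bool (u * a mod int p \<in> ?M)) = real (card ?M)" if "a \<in> A" for a
  proof -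
    have "a \<in> ?G" using that A by blast
    then have nd: "\<not> int p dvd a" by (auto dest: zdvd_imp_le)
    have "(\<Sum>u\<in>?G. of_bool (u * a mod int p \<in> ?M)) = (\<Sum>x\<in>?G. of_bool (x \<in> ?M) :: real)"
      by (rule sum_mult_units[OF p(1) nd])
    also have "\<dots> = real (card ?M)"
      using middle_third_subset[of p] by (simp add: of_bool_def sum.If_cases Int_absorb1)
    finally show ?thesis .
  qed
  have swap: "(\<Sum>u\<in>?G. \<Sum>a\<in>A. of_bool (u * a mod int p \<in> ?M)) = (\<Sum>a\<in>A. real (card ?M))"
    by (subst sum.swap) (rule sum.cong[OF refl M_count])
  have "(\<Sum>u\<in>?G. F u) = (\<Sum>a\<in>A. real (card ?M)) - real (card ?G) * (real (card A) / 3)"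
    unfolding F_def sum_subtractf swap by simp
  also have "\<dots> = real (card A) * (real (card ?M) - (real p - 1) / 3)"
    unfolding cG by (simp add: algebra_simps)
  also have "\<dots> \<ge> 0" using card_middle_third[OF p] by simp
  finally have F_sum: "(\<Sum>u\<in>?G. F u) \<ge> 0" .
  have "(\<Sum>u\<in>?G. F u) \<le> (\<Sum>u\<in>?G. \<psi>)" by (intro sum_mono F_le)
  then have "0 \<le> (real p - 1) * \<psi>" using F_sum cG by simp
  then show \<psi>0: "\<psi> \<ge> 0" using p1 by (simp add: zero_le_mult_iff)
  \<comment> \<open>A one-sided bound and a nonnegative mean control the L^1-norm: |F| <= 2\<psi> -
    F pointwise since F <= \<psi> and \<psi> >= 0, and the sum of F only helps.\<close>
  have "(\<Sum>u\<in>?G. \<bar>F u\<bar>) \<le> (\<Sum>u\<in>?G. 2 * \<psi> - F u)"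
  proof (rule sum_mono)
    show "\<bar>F u\<bar> \<le> 2 * \<psi> - F u" for u using F_le[of u] \<psi>0 by linarith
  qed
  also have "\<dots> \<le> 2 * \<psi> * (real p - 1)"
    using F_sum cG by (simp add: sum_subtractf mult.commute)
  finally have F_abs: "(\<Sum>u\<in>?G. \<bar>F u\<bar>) \<le> 2 * \<psi> * (real p - 1)" .
  have "(\<Sum>u\<in>?G. \<phi> u * of_real (F u)) = (\<Sum>u\<in>?G. \<Sum>a\<in>A. \<phi> u * of_bool (u * a mod int p \<in> ?M))
      - (\<Sum>u\<in>?G. \<phi> u) * of_real (real (card A) / 3)"
    unfolding F_def of_real_diff right_diff_distrib sum_subtractf sum_distrib_right
    by (simp add: sum_distrib_left of_real_of_bool)
  also have "\<dots> = (\<Sum>a\<in>A. \<Sum>u\<in>?G. \<phi> u * of_bool (u * a mod int p \<in> ?M))"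
    unfolding dir_char_sum_zero[OF p(1) \<phi>] by (subst sum.swap) simp
  also have "\<dots> = (\<Sum>a\<in>A. cnj (\<phi> a) * (\<Sum>x\<in>?M. \<phi> x))"
  proof (intro sum.cong refl)
    show "(\<Sum>u\<in>?G. \<phi> u * of_bool (u * a mod int p \<in> ?M)) = cnj (\<phi> a) * (\<Sum>x\<in>?M. \<phi> x)" if "a \<in> A" for a
      using that A by (intro dilate_char_sum[OF p(1) \<phi>(1) _ middle_third_subset]) auto
  qed
  also have "\<dots> = (\<Sum>a\<in>A. cnj (\<phi> a)) * (\<Sum>x\<in>?M. \<phi> x)" by (simp add: sum_distrib_right)
  finally have "norm (\<Sum>a\<in>A. \<phi> a) * norm (\<Sum>x\<in>?M. \<phi> x) = norm (\<Sum>u\<in>?G. \<phi> u * of_real (F u))"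
    by (simp add: norm_mult norm_sum_cnj)
  also have "\<dots> \<le> (\<Sum>u\<in>?G. \<bar>F u\<bar>)"
  proof (rule sum_norm_le)
    show "norm (\<phi> u * of_real (F u)) \<le> \<bar>F u\<bar>" for u
      using dir_charD(5)[OF \<phi>(1), of u] by (simp add: norm_mult mult_left_le_one_le)
  qed
  finally show "norm (\<Sum>a\<in>A. \<phi> a) * norm (\<Sum>x\<in>?M. \<phi> x) \<le> 2 * \<psi> * (real p - 1)" using F_abs by linarith
qed

text \<open>Parseval for the convolution of the indicators of \<open>A\<close> and \<open>\<Gamma>\<close>: only characters trivial on \<open>\<Gamma>\<close> contribute.\<close>

lemma coset_variance_bound:
  assumes p: "prime p" and \<Gamma>: "subgroup \<Gamma> (Fp_star p)" and A: "A \<subseteq> {1..<int p}" and B: "B \<ge> 0"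
    and bound: "\<And>\<phi>. dir_char p \<phi> \<Longrightarrow> nonprincipal p \<phi> \<Longrightarrow> (\<forall>\<gamma>\<in>\<Gamma>. \<phi> \<gamma> = 1) \<Longrightarrow> norm (\<Sum>a\<in>A. \<phi> a) \<le> B"
  shows "(\<Sum>X\<in>lcosets\<^bsub>Fp_star p\<^esub> \<Gamma>. (real (card (A \<inter> X)) - real (card A) * real (card \<Gamma>) / (real p - 1))\<^sup>2) \<le> B\<^sup>2"
proof -
  let ?G = "{1..<int p}"
  have p1: "p > 1" using prime_gt_1_nat[OF p] .
  interpret group "Fp_star p" by (rule Fp_star_simps[OF p])
  interpret \<Gamma>: subgroup \<Gamma> "Fp_star p" by (rule \<Gamma>)
  note car = Fp_star_simps(2)[OF p] and mul = Fp_star_simps(3)[OF p]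
  have \<Gamma>G: "\<Gamma> \<subseteq> ?G" using \<Gamma>.subset car by simp
  have fin: "finite \<Gamma>" "finite A" using \<Gamma>G A finite_subset by blast+
  have cG: "real (card ?G) = real p - 1" using p1 by (simp add: of_nat_diff)
  have \<Gamma>pos: "card \<Gamma> > 0" using \<Gamma>.one_closed fin(1) card_gt_0_iff by blast
  define m where "m = real (card A) * real (card \<Gamma>) / (real p - 1)"
  \<comment> \<open>The deviation attached to the coset of x. As a function on the whole group it
    has a transform, and it is constant on cosets.\<close>
  define T where "T = (\<lambda>x. (\<Sum>\<gamma>\<in>\<Gamma>. of_bool (x * \<gamma> mod int p \<in> A)) - m)"
  have T_card: "T x = real (card (A \<inter> (x <#\<^bsub>Fp_star p\<^esub> \<Gamma>))) - m" if x: "x \<in> ?G" for x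
  proof -
    let ?f = "\<lambda>\<gamma>. x * \<gamma> mod int p"
    have im: "x <#\<^bsub>Fp_star p\<^esub> \<Gamma> = ?f ` \<Gamma>" unfolding l_coset_def mul by auto
    have inj: "inj_on ?f \<Gamma>"
      using inj_on_g'[OF \<Gamma>.subset, of x] x unfolding mul car by simp
    have "(\<Sum>\<gamma>\<in>\<Gamma>. of_bool (?f \<gamma> \<in> A)) = (\<Sum>y\<in>?f ` \<Gamma>. of_bool (y \<in> A) :: real)"
      by (simp add: sum.reindex[OF inj])
    also have "\<dots> = real (card (?f ` \<Gamma> \<inter> A))"
      using fin by (simp add: of_bool_def sum.If_cases Int_def)
    finally show ?thesis by (simp add: T_def im Int_commute)
  qed
  have hat: "(\<Sum>x\<in>?G. \<phi> x * of_real (T x)) = (\<Sum>\<gamma>\<in>\<Gamma>. cnj (\<phi> \<gamma>)) * (\<Sum>a\<in>A. \<phi> a) - (\<Sum>x\<in>?G. \<phi> x) * of_real m"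
    if \<phi>: "dir_char p \<phi>" for \<phi>
  proof -
    have "(\<Sum>x\<in>?G. \<phi> x * of_real (T x)) = (\<Sum>x\<in>?G. \<Sum>\<gamma>\<in>\<Gamma>. \<phi> x * of_bool (x * \<gamma> mod int p \<in> A)) - (\<Sum>x\<in>?G. \<phi> x) * of_real m"
      unfolding T_def of_real_diff right_diff_distrib sum_subtractf sum_distrib_right
      by (simp add: sum_distrib_left of_real_of_bool)
    also have "(\<Sum>x\<in>?G. \<Sum>\<gamma>\<in>\<Gamma>. \<phi> x * of_bool (x * \<gamma> mod int p \<in> A)) = (\<Sum>\<gamma>\<in>\<Gamma>. \<Sum>x\<in>?G. \<phi> x * of_bool (x * \<gamma> mod int p \<in> A))"
      by (rule sum.swap)
    also have "\<dots> = (\<Sum>\<gamma>\<in>\<Gamma>. cnj (\<phi> \<gamma>) * (\<Sum>a\<in>A. \<phi> a))"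
    proof (intro sum.cong refl)
      show "(\<Sum>x\<in>?G. \<phi> x * of_bool (x * \<gamma> mod int p \<in> A)) = cnj (\<phi> \<gamma>) * (\<Sum>a\<in>A. \<phi> a)" if "\<gamma> \<in> \<Gamma>" for \<gamma>
        using that \<Gamma>G by (intro dilate_char_sum[OF p \<phi> _ A]) auto
    qed
    finally show ?thesis by (simp add: sum_distrib_right)
  qed
  \<comment> \<open>Three cases: for the principal character the mean m makes the transform vanish;
    for characters trivial on \<Gamma> the hypothesis applies; for the others the sum over \<Gamma>
    is 0.\<close>
  have hat_bound: "norm (\<Sum>x\<in>?G. \<phi> x * of_real (T x)) \<le> B * norm (\<Sum>\<gamma>\<in>\<Gamma>. \<phi> \<gamma>)" if \<phi>: "dir_char p \<phi>" for \<phi>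
  proof (cases "nonprincipal p \<phi>")
    case False
    have one: "\<phi> x = 1" if "x \<in> ?G" for x
    proof -
      have "\<not> int p dvd x" using that by (auto dest: zdvd_imp_le)
      then show ?thesis using False by (auto simp: nonprincipal_def)
    qed
    have "(\<Sum>x\<in>?G. \<phi> x * of_real (T x)) = of_nat (card \<Gamma>) * of_nat (card A) - of_real (real (card ?G)) * of_real m"
      unfolding hat[OF \<phi>] using one \<Gamma>G A by (simp add: subset_iff)
    also have "\<dots> = of_real (real (card \<Gamma>) * real (card A) - (real p - 1) * m)"
      unfolding cG by simp
    also have "real (card \<Gamma>) * real (card A) - (real p - 1) * m = 0"
      using p1 by (simp add: m_def)
    finally show ?thesis using B by simp
  next
    case True
    show ?thesis
    proof (cases "\<forall>\<gamma>\<in>\<Gamma>. \<phi> \<gamma> = 1")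
      case all: True
      have "norm (\<Sum>x\<in>?G. \<phi> x * of_real (T x)) = norm (\<Sum>a\<in>A. \<phi> a) * norm (\<Sum>\<gamma>\<in>\<Gamma>. \<phi> \<gamma>)"
        unfolding hat[OF \<phi>] dir_char_sum_zero[OF p \<phi> True] by (simp add: norm_mult norm_sum_cnj mult.commute)
      then show ?thesis using bound[OF \<phi> True all] by (simp add: mult_right_mono)
    next
      case False
      then obtain g where g: "g \<in> \<Gamma>" "\<phi> g \<noteq> 1" by blast
      have "(\<Sum>\<gamma>\<in>\<Gamma>. \<phi> \<gamma>) = (\<Sum>\<gamma>\<in>(\<lambda>\<gamma>. g * \<gamma> mod int p) ` \<Gamma>. \<phi> \<gamma>)"
      proof -
        have inj: "inj_on (\<lambda>\<gamma>. g * \<gamma> mod int p) \<Gamma>"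
          using inj_on_g'[OF \<Gamma>.subset, of g] g \<Gamma>.subset unfolding mul by auto
        have "(\<lambda>\<gamma>. g * \<gamma> mod int p) ` \<Gamma> \<subseteq> \<Gamma>" using \<Gamma>.m_closed[OF g(1)] unfolding mul by auto
        then show ?thesis using endo_inj_surj[OF fin(1) _ inj] by simp
      qed
      also have "\<dots> = (\<Sum>\<gamma>\<in>\<Gamma>. \<phi> (g * \<gamma> mod int p))"
      proof (subst sum.reindex)
        show "inj_on (\<lambda>\<gamma>. g * \<gamma> mod int p) \<Gamma>"
          using inj_on_g'[OF \<Gamma>.subset, of g] g \<Gamma>.subset unfolding mul by auto
      qed simp
      also have "\<dots> = \<phi> g * (\<Sum>\<gamma>\<in>\<Gamma>. \<phi> \<gamma>)" by (simp add: dir_charD[OF \<phi>] sum_distrib_left)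
      finally have "(1 - \<phi> g) * (\<Sum>\<gamma>\<in>\<Gamma>. \<phi> \<gamma>) = 0" by (simp add: left_diff_distrib)
      then have 0: "(\<Sum>\<gamma>\<in>\<Gamma>. \<phi> \<gamma>) = 0" using g(2) by simp
      then have "(\<Sum>\<gamma>\<in>\<Gamma>. cnj (\<phi> \<gamma>)) = 0" using norm_sum_cnj[of \<phi> \<Gamma>] by simp
      then show ?thesis unfolding hat[OF \<phi>] dir_char_sum_zero[OF p \<phi> True] 0 by simp
    qed
  qed
  obtain X where X: "\<And>j. dir_char p (X j)"
    "\<And>x y. x \<in> ?G \<Longrightarrow> y \<in> ?G \<Longrightarrow> (\<Sum>j<p-1. X j x * cnj (X j y)) = (if x = y then of_nat (p - 1) else 0)"
    using dir_char_family[OF p] by blast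
  have "real (p - 1) * (\<Sum>x\<in>?G. (norm (complex_of_real (T x)))\<^sup>2) = (\<Sum>j<p-1. (norm (\<Sum>x\<in>?G. of_real (T x) * X j x))\<^sup>2)"
    using parseval_dir_char[where X = X and p = p and h = "\<lambda>x. of_real (T x)"] X(2) by simp
  also have "\<dots> \<le> (\<Sum>j<p-1. (B * norm (\<Sum>x\<in>?G. of_bool (x \<in> \<Gamma>) * X j x))\<^sup>2)"
  proof (intro sum_mono power_mono norm_ge_zero)
    fix j
    have "(\<Sum>x\<in>?G. of_bool (x \<in> \<Gamma>) * X j x) = (\<Sum>\<gamma>\<in>\<Gamma>. X j \<gamma>)"
      using \<Gamma>G by (simp add: sum.If_cases of_bool_def if_distrib[of "\<lambda>t. t * _"] Int_absorb1 cong: if_cong)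
    then show "norm (\<Sum>x\<in>?G. of_real (T x) * X j x) \<le> B * norm (\<Sum>x\<in>?G. of_bool (x \<in> \<Gamma>) * X j x)"
      using hat_bound[OF X(1), of j] by (simp add: mult.commute)
  qed
  also have "\<dots> = B\<^sup>2 * (\<Sum>j<p-1. (norm (\<Sum>x\<in>?G. of_bool (x \<in> \<Gamma>) * X j x))\<^sup>2)"
    by (simp add: power_mult_distrib sum_distrib_left)
  \<comment> \<open>Parseval a second time, backwards and for the indicator of \<Gamma>: its square
    norm is |\<Gamma>|, so no count of the characters trivial on \<Gamma> is needed.\<close>
  also have "(\<Sum>j<p-1. (norm (\<Sum>x\<in>?G. of_bool (x \<in> \<Gamma>) * X j x))\<^sup>2) = real (p - 1) * (\<Sum>x\<in>?G. (norm (of_bool (x \<in> \<Gamma>) :: complex))\<^sup>2)"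
    by (rule parseval_dir_char) (rule X(2))
  also have "(\<Sum>x\<in>?G. (norm (of_bool (x \<in> \<Gamma>) :: complex))\<^sup>2) = (\<Sum>x\<in>?G. if x \<in> \<Gamma> then 1 else 0)"
    by (intro sum.cong refl) simp
  also have "\<dots> = real (card \<Gamma>)" using \<Gamma>G by (simp add: sum.If_cases Int_absorb1)
  finally have "real (p - 1) * (\<Sum>x\<in>?G. (T x)\<^sup>2) \<le> real (p - 1) * (B\<^sup>2 * real (card \<Gamma>))"
    by (simp add: mult_ac)
  then have total: "(\<Sum>x\<in>?G. (T x)\<^sup>2) \<le> B\<^sup>2 * real (card \<Gamma>)" using p1 by simp
  have finG: "finite (carrier (Fp_star p))" by (simp add: car)
  have "(\<Sum>x\<in>?G. (T x)\<^sup>2) = (\<Sum>x\<in>\<Union>(lcosets\<^bsub>Fp_star p\<^esub> \<Gamma>). (T x)\<^sup>2)"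
    by (simp add: lcosets_part_G[OF \<Gamma>] car)
  also have "\<dots> = (\<Sum>X\<in>lcosets\<^bsub>Fp_star p\<^esub> \<Gamma>. \<Sum>x\<in>X. (T x)\<^sup>2)"
  proof (subst sum.Union_disjoint)
    show "\<forall>X\<in>lcosets\<^bsub>Fp_star p\<^esub> \<Gamma>. finite X"
      using \<Gamma>.lcosets_carrier[OF is_group] finG finite_subset by blast
    show "\<forall>X\<in>lcosets\<^bsub>Fp_star p\<^esub> \<Gamma>. \<forall>Y\<in>lcosets\<^bsub>Fp_star p\<^esub> \<Gamma>. X \<noteq> Y \<longrightarrow> X \<inter> Y = {}"
      using lcos_disjoint[OF \<Gamma>] by blast
  qed simp
  \<comment> \<open>Each coset contributes its value |\<Gamma>| times, which cancels the |\<Gamma>|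
    in \<open>total\<close>.\<close>
  also have "\<dots> = (\<Sum>X\<in>lcosets\<^bsub>Fp_star p\<^esub> \<Gamma>. real (card \<Gamma>) * (real (card (A \<inter> X)) - m)\<^sup>2)"
  proof (intro sum.cong refl)
    fix X assume X: "X \<in> lcosets\<^bsub>Fp_star p\<^esub> \<Gamma>"
    then obtain y where y: "y \<in> carrier (Fp_star p)" "X = y <#\<^bsub>Fp_star p\<^esub> \<Gamma>" by (auto simp: LCOSETS_def)
    have "T x = real (card (A \<inter> X)) - m" if x: "x \<in> X" for x
    proof -
      have "x \<in> ?G" using \<Gamma>.lcosets_carrier[OF is_group X] x car by auto
      moreover have "y <#\<^bsub>Fp_star p\<^esub> \<Gamma> = x <#\<^bsub>Fp_star p\<^esub> \<Gamma>"
        using x y by (intro l_repr_independence[OF _ _ \<Gamma>]) auto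
      ultimately show ?thesis using T_card y(2) by simp
    qed
    then have "(\<Sum>x\<in>X. (T x)\<^sup>2) = real (card X) * (real (card (A \<inter> X)) - m)\<^sup>2" by simp
    then show "(\<Sum>x\<in>X. (T x)\<^sup>2) = real (card \<Gamma>) * (real (card (A \<inter> X)) - m)\<^sup>2"
      using l_card_cosets_equal[OF X \<Gamma>.subset finG] by simp
  qed
  finally have "real (card \<Gamma>) * (\<Sum>X\<in>lcosets\<^bsub>Fp_star p\<^esub> \<Gamma>. (real (card (A \<inter> X)) - m)\<^sup>2) \<le> real (card \<Gamma>) * B\<^sup>2"
    using total by (simp add: sum_distrib_left mult.commute)
  then show ?thesis using \<Gamma>pos by (simp add: m_def)
qed

(* The hypothesis on 0 excludes only sets A that contain 0 and have \<psi> = 0. Without it the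
   claim fails: p = 11, \<Gamma> = {1, 10}, A = {0, 1, 2} gives sf(A) = 1 = |A|/3, so \<psi> = 0,
   while the left-hand side is positive. *)
theorem theorem1:
  fixes \<epsilon> :: real
  assumes "\<epsilon> > 0"
  shows "\<exists>C::real>0. \<forall>(p::nat) (\<Gamma>::int set) (A::int set) (\<psi>::real).
    prime p \<longrightarrow> p > 3 \<longrightarrow>
    subgroup \<Gamma> (Fp_star p) \<longrightarrow> \<ominus>\<^bsub>Fp p\<^esub> \<one>\<^bsub>Fp p\<^esub> \<in> \<Gamma> \<longrightarrow>
    A \<subseteq> carrier (Fp p) \<longrightarrow>
    real (sf (Fp p) A) = real (card A) / 3 + \<psi> \<longrightarrow>
    (\<zero>\<^bsub>Fp p\<^esub> \<in> A \<longrightarrow> \<psi> \<noteq> 0) \<longrightarrow>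
    (\<Sum>X\<in>lcosets\<^bsub>Fp_star p\<^esub> \<Gamma>.
       \<bar>real (card (A \<inter> X)) - real (card A) * real (card \<Gamma>) / (real p - 1)\<bar>\<^sup>2)
      \<le> C * \<psi>\<^sup>2 * real p powr (1 + \<epsilon>)"
proof -
  have "\<epsilon> / 2 > 0" using assms by simp
  then obtain c where c: "c > 0"
    "\<And>p \<phi>. prime p \<Longrightarrow> p > 3 \<Longrightarrow> dir_char p \<phi> \<Longrightarrow> nonprincipal p \<phi> \<Longrightarrow>
      norm (Lfun (\<lambda>n. \<phi> (int n) * chi3 n) 1) \<ge> c * real p powr (- (\<epsilon> / 2))"
    using L_chi3_lower_bound by blast
  \<comment> \<open>128 = 2 * 16 * 4 and 18 = 2 * 9: the 2 from splitting a square, 16 from (4/c)^2,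
    and 4 and 9 from \<open>small\<close>.\<close>
  define C where "C = 128 / c\<^sup>2 + 18"
  have "C > 0" using c(1) by (simp add: C_def add_nonneg_pos)
  moreover have "(\<Sum>X\<in>lcosets\<^bsub>Fp_star p\<^esub> \<Gamma>.
       \<bar>real (card (A \<inter> X)) - real (card A) * real (card \<Gamma>) / (real p - 1)\<bar>\<^sup>2) \<le> C * \<psi>\<^sup>2 * real p powr (1 + \<epsilon>)"
    if p: "prime p" "p > 3" and \<Gamma>: "subgroup \<Gamma> (Fp_star p)" and neg: "\<ominus>\<^bsub>Fp p\<^esub> \<one>\<^bsub>Fp p\<^esub> \<in> \<Gamma>"
      and A: "A \<subseteq> carrier (Fp p)" and \<psi>: "real (sf (Fp p) A) = real (card A) / 3 + \<psi>"
      and zero: "\<zero>\<^bsub>Fp p\<^esub> \<in> A \<longrightarrow> \<psi> \<noteq> 0" for p \<Gamma> A \<psi>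
  proof -
    let ?L = "lcosets\<^bsub>Fp_star p\<^esub> \<Gamma>"
    have p1: "p > 1" using p by simp
    define A' where "A' = A - {0}"
    define d :: real where "d = of_bool (0 \<in> A)"
    \<comment> \<open>Deleting 0 keeps sf and lowers |A| by d, so the excess over a third grows by
      d/3.\<close>
    define \<psi>' where "\<psi>' = \<psi> + d / 3"
    have AG: "A' \<subseteq> {1..<int p}" using A unfolding A'_def Fp_simps(1)[OF p1] by auto
    have finA: "finite A" using A unfolding Fp_simps(1)[OF p1] by (rule finite_subset) simp
    have cA: "real (card A) = real (card A') + d"
    proof (cases "0 \<in> A")
      case True
      then have "card A = Suc (card A')" unfolding A'_def using finA by (simp only: card_Suc_Diff1)
      then show ?thesis using True by (simp add: d_def)
    qed (simp add: A'_def d_def)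
    have \<psi>'_eq: "real (sf (Fp p) A') = real (card A') / 3 + \<psi>'"
      unfolding A'_def sf_remove_zero[OF p1] using \<psi> cA by (simp add: \<psi>'_def A'_def add_divide_distrib)
    have \<psi>'0: "\<psi>' \<ge> 0" if "dir_char p \<phi>" "nonprincipal p \<phi>" for \<phi>
      using char_sum_bound(1)[OF p that AG \<psi>'_eq] .
    have small: "\<psi>'\<^sup>2 \<le> 4 * \<psi>\<^sup>2" "d \<le> 9 * \<psi>\<^sup>2"
    proof -
      \<comment> \<open>3\<psi> is an integer, so a nonzero \<psi> is at least 1/3 in modulus and
        absorbs both the shift d/3 and d itself.\<close>
      have "d = 0 \<or> (d = 1 \<and> \<bar>\<psi>\<bar> \<ge> 1/3)"
      proof (cases "0 \<in> A")
        case True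
        then have "\<psi> \<noteq> 0" using zero by (simp add: Fp_simps(3)[OF p1])
        moreover have "3 * \<psi> = real_of_int (3 * int (sf (Fp p) A) - int (card A))" using \<psi> by simp
        ultimately have "3 * int (sf (Fp p) A) - int (card A) \<noteq> 0" by auto
        then have "\<bar>3 * int (sf (Fp p) A) - int (card A)\<bar> \<ge> 1" by linarith
        then have "\<bar>3 * \<psi>\<bar> \<ge> 1" unfolding \<open>3 * \<psi> = _\<close> by linarith
        then show ?thesis using True by (simp add: d_def)
      qed (simp add: d_def)
      then have "\<bar>\<psi>'\<bar> \<le> 2 * \<bar>\<psi>\<bar>" "d \<le> (3 * \<bar>\<psi>\<bar>)\<^sup>2"
        using one_le_power[of "3 * \<bar>\<psi>\<bar>" 2] by (auto simp: \<psi>'_def)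
      then have "\<bar>\<psi>'\<bar>\<^sup>2 \<le> (2 * \<bar>\<psi>\<bar>)\<^sup>2" "d \<le> (3 * \<bar>\<psi>\<bar>)\<^sup>2"
        using power_mono[of "\<bar>\<psi>'\<bar>" "2 * \<bar>\<psi>\<bar>" 2] by simp_all
      then show "\<psi>'\<^sup>2 \<le> 4 * \<psi>\<^sup>2" "d \<le> 9 * \<psi>\<^sup>2" by (simp_all add: power_mult_distrib)
    qed
    \<comment> \<open>Solving |A^| * sqrt p * c p^(-\<epsilon>/2) / 2 <= 2 |\<psi>'| p for
      |A^|.\<close>
    define B where "B = 4 / c * \<bar>\<psi>'\<bar> * real p powr ((1 + \<epsilon>) / 2)"
    have B: "B \<ge> 0" using c(1) by (simp add: B_def)
    have "(\<Sum>X\<in>?L. (real (card (A' \<inter> X)) - real (card A') * real (card \<Gamma>) / (real p - 1))\<^sup>2) \<le> B\<^sup>2"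
    proof (rule coset_variance_bound[OF p(1) \<Gamma> AG B])
      fix \<phi> assume \<phi>: "dir_char p \<phi>" "nonprincipal p \<phi>" "\<forall>\<gamma>\<in>\<Gamma>. \<phi> \<gamma> = 1"
      \<comment> \<open>Here -1 in \<Gamma> enters: characters trivial on \<Gamma> are even.\<close>
      have "\<phi> ((-1) mod int p) = 1" using \<phi>(3) neg unfolding Fp_simps(4)[OF p1] by blast
      then have even: "\<phi> (-1) = 1" using dir_charD(2)[OF \<phi>(1)] by metis
      let ?a = "norm (\<Sum>a\<in>A'. \<phi> a)" and ?m = "norm (\<Sum>x\<in>middle_third p. \<phi> x)"
      have "c * real p powr (- (\<epsilon> / 2)) \<le> norm (Lfun (\<lambda>n. cnj (\<phi> (int n)) * chi3 n) 1)"
        by (rule c(2)[OF p dir_char_cnj[OF \<phi>(1)] nonprincipal_cnj[OF \<phi>(2)]])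
      then have "sqrt (real p) * (c * real p powr (- (\<epsilon> / 2))) / 2 \<le> sqrt (real p) * norm (Lfun (\<lambda>n. cnj (\<phi> (int n)) * chi3 n) 1) / 2"
        by (intro divide_right_mono mult_left_mono) auto
      also have "\<dots> \<le> ?m" by (rule middle_third_lower_bound[OF p \<phi>(1,2) even])
      finally have m: "sqrt (real p) * (c * real p powr (- (\<epsilon> / 2))) / 2 \<le> ?m" .
      have "?a * (sqrt (real p) * (c * real p powr (- (\<epsilon> / 2))) / 2) \<le> ?a * ?m"
        using m by (rule mult_left_mono) simp
      also have "\<dots> \<le> 2 * \<psi>' * (real p - 1)" by (rule char_sum_bound(2)[OF p \<phi>(1,2) AG \<psi>'_eq])
      also have "\<dots> \<le> 2 * \<bar>\<psi>'\<bar> * real p" by (rule mult_mono) (use p1 in auto)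
      finally have le: "?a * (sqrt (real p) * (c * real p powr (- (\<epsilon> / 2))) / 2) \<le> 2 * \<bar>\<psi>'\<bar> * real p" .
      have "sqrt (real p) * real p powr (- (\<epsilon> / 2)) * real p powr ((1 + \<epsilon>) / 2) = real p"
      proof -
        have "sqrt (real p) * real p powr (- (\<epsilon> / 2)) * real p powr ((1 + \<epsilon>) / 2)
            = real p powr (1/2 + - (\<epsilon> / 2) + (1 + \<epsilon>) / 2)"
          unfolding powr_add by (simp add: powr_half_sqrt)
        also have "1/2 + - (\<epsilon> / 2) + (1 + \<epsilon>) / 2 = 1" by (simp add: field_simps)
        finally show ?thesis by simp
      qed
      then have "2 * \<bar>\<psi>'\<bar> * real p = B * (sqrt (real p) * (c * real p powr (- (\<epsilon> / 2))) / 2)"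
        using c(1) by (simp add: B_def mult_ac)
      with le have "?a * (sqrt (real p) * (c * real p powr (- (\<epsilon> / 2))) / 2) \<le> B * (sqrt (real p) * (c * real p powr (- (\<epsilon> / 2))) / 2)"
        by (simp only:)
      then show "?a \<le> B" using c(1) p1 by (subst (asm) mult_le_cancel_right_pos) auto
    qed
    define r where "r = real (card \<Gamma>) / (real p - 1)"
    interpret group "Fp_star p" by (rule Fp_star_simps[OF p(1)])
    have "0 \<notin> X" if "X \<in> ?L" for X
      using subgroup.lcosets_carrier[OF \<Gamma> is_group that] Fp_star_simps(2)[OF p(1)] by auto
    then have AX: "A \<inter> X = A' \<inter> X" if "X \<in> ?L" for X using that by (auto simp: A'_def)
    have lag: "real (card ?L) * real (card \<Gamma>) = real p - 1"
    proof -
      have "card ?L * card \<Gamma> = p - 1"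
        using l_lagrange[OF _ \<Gamma>] Fp_star_simps(2)[OF p(1)] by (simp add: Coset.order_def)
      then have "real (card ?L * card \<Gamma>) = real (p - 1)" by (simp only:)
      then show ?thesis using p1 by (simp add: of_nat_diff)
    qed
    \<comment> \<open>Putting 0 back shifts the expected count in every coset by r, the inverse of
      the number of cosets; the squares of these shifts add up to r <= 1.\<close>
    have r: "real (card ?L) * r\<^sup>2 = r" "r \<le> 1"
    proof -
      have "real (card ?L) * r\<^sup>2 = real (card ?L) * real (card \<Gamma>) / (real p - 1) * r"
        by (simp add: r_def power2_eq_square)
      then show "real (card ?L) * r\<^sup>2 = r" unfolding lag using p1 by simp
      have "card ?L \<noteq> 0"
      proof
        assume "card ?L = 0"
        then have "real p - 1 = 0" using lag by simp
        then show False using p1 by simp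
      qed
      then have "1 * real (card \<Gamma>) \<le> real (card ?L) * real (card \<Gamma>)" by (intro mult_right_mono) auto
      then show "r \<le> 1" unfolding lag using p1 by (simp add: r_def)
    qed
    have "(\<Sum>X\<in>?L. \<bar>real (card (A \<inter> X)) - real (card A) * real (card \<Gamma>) / (real p - 1)\<bar>\<^sup>2)
        \<le> (\<Sum>X\<in>?L. 2 * (real (card (A' \<inter> X)) - real (card A') * real (card \<Gamma>) / (real p - 1))\<^sup>2 + 2 * d * r\<^sup>2)"
    proof (rule sum_mono)
      fix X assume X: "X \<in> ?L"
      define t where "t = real (card (A' \<inter> X)) - real (card A') * real (card \<Gamma>) / (real p - 1)"
      have "real (card (A \<inter> X)) - real (card A) * real (card \<Gamma>) / (real p - 1) = t - d * r"
        unfolding AX[OF X] cA t_def r_def by (simp add: distrib_right add_divide_distrib)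
      moreover have "(t - d * r)\<^sup>2 \<le> 2 * t\<^sup>2 + 2 * (d * r)\<^sup>2"
        using zero_le_power2[of "t + d * r"] by (simp add: power2_eq_square algebra_simps)
      moreover have "(d * r)\<^sup>2 = d * r\<^sup>2" by (simp add: d_def power_mult_distrib)
      ultimately show "\<bar>real (card (A \<inter> X)) - real (card A) * real (card \<Gamma>) / (real p - 1)\<bar>\<^sup>2 \<le> 2 * t\<^sup>2 + 2 * d * r\<^sup>2"
        by simp
    qed
    also have "\<dots> = 2 * (\<Sum>X\<in>?L. (real (card (A' \<inter> X)) - real (card A') * real (card \<Gamma>) / (real p - 1))\<^sup>2) + 2 * d * (real (card ?L) * r\<^sup>2)"
      by (simp add: sum.distrib sum_distrib_left)
    also have "\<dots> \<le> 2 * B\<^sup>2 + 2 * d * 1"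
      unfolding r(1) using \<open>_ \<le> B\<^sup>2\<close> r(2) by (intro add_mono mult_left_mono) (auto simp: d_def)
    also have "B\<^sup>2 = 16 / c\<^sup>2 * \<psi>'\<^sup>2 * real p powr (1 + \<epsilon>)"
    proof -
      have "(real p powr ((1 + \<epsilon>) / 2))\<^sup>2 = real p powr (1 + \<epsilon>)"
        unfolding power2_eq_square powr_add[symmetric] by simp
      then show ?thesis unfolding B_def power_mult_distrib power_divide by simp
    qed
    also have "2 * (16 / c\<^sup>2 * \<psi>'\<^sup>2 * real p powr (1 + \<epsilon>)) + 2 * d * 1
        \<le> 2 * (16 / c\<^sup>2 * (4 * \<psi>\<^sup>2) * real p powr (1 + \<epsilon>)) + 2 * (9 * \<psi>\<^sup>2) * real p powr (1 + \<epsilon>)"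
      using small p1 assms ge_one_powr_ge_zero[of "real p" "1 + \<epsilon>"]
      by (intro add_mono mult_mono mult_left_mono mult_right_mono) auto
    also have "\<dots> = C * \<psi>\<^sup>2 * real p powr (1 + \<epsilon>)"
      by (simp add: C_def algebra_simps)
    finally show ?thesis .
  qed
  ultimately show ?thesis by blast
qed

end
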